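(* Let $(W, I)$ be a finite Coxeter group and $\sigma$ an automorphism of $W$ with $\sigma(I)=I$. Let $\mathcal O$ be a $\sigma$-conjugacy class of $W$ and $\mathcal O_{\min}$ the set of minimal length elements in $\mathcal O$. Then there exists a good element $w \in \mathcal O_{\min}$.
   Context: $I$ is identified with the set of simple reflections. The $\sigma$-conjugacy classes are the orbits of the action $x\cdot w=xw\sigma(x)^{-1}$ of $W$ on itself. For $K\subset I$, $w_K$ is the longest element of the standard parabolic subgroup $W_K$. Let $B^+$ be the braid monoid associated with $(W,I)$, and for $w\in W$ let $\underline w\in B^+$ be its canonical lift: $w\mapsto\underline w$ is the injection sending each simple reflection to the corresponding generator of $B^+$ and satisfying $\underline{w_1w_2}=\underline{w_1}\,\underline{w_2}$ whenever $l(w_1w_2)=l(w_1)+l(w_2)$. The automorphism $\sigma$ extends to an automorphism of $B^+$, also denoted $\sigma$. The $\sigma$-order of $w\in W$ is the minimal positive integer $d$ such that $w\sigma(w)\cdots\sigma^{d-1}(w)=1$ and $\sigma^d=1$. An element $w\in W$ of $\sigma$-order $d$ is good if there exists a sequence $I_1\supset I_2\supset\cdots\supset I_l$ of subsets of $I$ such that $$\underline w\,\sigma(\underline w)\cdots\sigma^{d-1}(\underline w)=\underline w_{I_1}^2\,\underline w_{I_2}^2\cdots\underline w_{I_l}^2\quad\text{in }B^+,$$ where $\underline w_{I_k}$ denotes the lift of $w_{I_k}$. *)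

theory Defs
  imports "HOL-Algebra.Generated_Groups" "HOL-Algebra.Group_Action" "HOL-Algebra.Multiplicative_Group"
begin

definition mprod :: "('a, 'b) monoid_scheme \<Rightarrow> 'a list \<Rightarrow> 'a"
  where "mprod M xs = foldr (\<otimes>\<^bsub>M\<^esub>) xs \<one>\<^bsub>M\<^esub>"


section \<open>Monoids given by generators and relations\<close>

inductive word_cong :: "'a set \<Rightarrow> ('a list \<times> 'a list) set \<Rightarrow> 'a list \<Rightarrow> 'a list \<Rightarrow> bool"
  for S :: "'a set" and R :: "('a list \<times> 'a list) set"
where
  rel: "(u, v) \<in> R \<Longrightarrow> u \<in> lists S \<Longrightarrow> v \<in> lists S \<Longrightarrow> word_cong S R u v"
| refl: "u \<in> lists S \<Longrightarrow> word_cong S R u u"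
| sym: "word_cong S R u v \<Longrightarrow> word_cong S R v u"
| trans: "word_cong S R u v \<Longrightarrow> word_cong S R v w \<Longrightarrow> word_cong S R u w"
| append: "word_cong S R u u' \<Longrightarrow> word_cong S R v v' \<Longrightarrow> word_cong S R (u @ v) (u' @ v')"

definition word_class :: "'a set \<Rightarrow> ('a list \<times> 'a list) set \<Rightarrow> 'a list \<Rightarrow> 'a list set"
  where "word_class S R u = {v. word_cong S R u v}"

definition presented_monoid :: "'a set \<Rightarrow> ('a list \<times> 'a list) set \<Rightarrow> 'a list set monoid"
  where "presented_monoid S R =
    \<lparr>carrier = word_class S R ` lists S,
     mult = (\<lambda>X Y. \<Union>x\<in>X. \<Union>y\<in>Y. word_class S R (x @ y)),
     one = word_class S R []\<rparr>"

lemma word_cong_lists: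
  "word_cong S R u v \<Longrightarrow> u \<in> lists S \<and> v \<in> lists S"
  by (induction rule: word_cong.induct) auto

lemma word_class_eq_iff:
  assumes "u \<in> lists S"
  shows "word_class S R u = word_class S R v \<longleftrightarrow> word_cong S R u v"
proof
  assume "word_class S R u = word_class S R v"
  then show "word_cong S R u v"
    using word_cong.refl[OF assms, of R] word_cong.sym unfolding word_class_def by blast
next
  assume "word_cong S R u v"
  then show "word_class S R u = word_class S R v"
    unfolding word_class_def using word_cong.sym word_cong.trans by blast
qed

lemma presented_monoid_mult:
  assumes "u \<in> lists S" "v \<in> lists S"
  shows "word_class S R u \<otimes>\<^bsub>presented_monoid S R\<^esub> word_class S R v = word_class S R (u @ v)"
proof -
  have "word_class S R (x @ y) = word_class S R (u @ v)"
    if "x \<in> word_class S R u" "y \<in> word_class S R v" for x y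
  proof -
    have "word_cong S R (u @ v) (x @ y)"
      using that by (auto simp: word_class_def intro: word_cong.append)
    then show ?thesis
      using word_class_eq_iff[of "u @ v" S R "x @ y"] assms by auto
  qed
  moreover have "u \<in> word_class S R u" "v \<in> word_class S R v"
    using assms by (auto simp: word_class_def intro: word_cong.refl)
  ultimately have "(\<Union>x\<in>word_class S R u. \<Union>y\<in>word_class S R v. word_class S R (x @ y)) =
      word_class S R (u @ v)"
    by blast
  then show ?thesis
    by (simp add: presented_monoid_def)
qed

lemma monoid_presented_monoid: "monoid (presented_monoid S R)"
proof (rule monoidI)
  fix X Y Z
  assume "X \<in> carrier (presented_monoid S R)" "Y \<in> carrier (presented_monoid S R)"
    "Z \<in> carrier (presented_monoid S R)"
  then obtain x y z where
    "x \<in> lists S" "y \<in> lists S" "z \<in> lists S"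
    and "X = word_class S R x" "Y = word_class S R y" "Z = word_class S R z"
    by (auto simp: presented_monoid_def)
  then show "X \<otimes>\<^bsub>presented_monoid S R\<^esub> Y \<otimes>\<^bsub>presented_monoid S R\<^esub> Z =
      X \<otimes>\<^bsub>presented_monoid S R\<^esub> (Y \<otimes>\<^bsub>presented_monoid S R\<^esub> Z)"
    by (simp add: presented_monoid_mult append_in_lists_conv)
next
  fix X Y
  assume "X \<in> carrier (presented_monoid S R)" "Y \<in> carrier (presented_monoid S R)"
  then obtain x y where xy: "x \<in> lists S" "y \<in> lists S"
    and "X = word_class S R x" "Y = word_class S R y"
    by (auto simp: presented_monoid_def)
  then have "X \<otimes>\<^bsub>presented_monoid S R\<^esub> Y = word_class S R (x @ y)"
    by (simp only: presented_monoid_mult)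
  moreover have "x @ y \<in> lists S"
    using xy by simp
  ultimately show "X \<otimes>\<^bsub>presented_monoid S R\<^esub> Y \<in> carrier (presented_monoid S R)"
    by (simp only: presented_monoid_def partial_object.simps) (rule imageI)
next
  have one: "\<one>\<^bsub>presented_monoid S R\<^esub> = word_class S R []"
    by (simp add: presented_monoid_def)
  show "\<one>\<^bsub>presented_monoid S R\<^esub> \<in> carrier (presented_monoid S R)"
    by (simp add: presented_monoid_def)
  fix X assume "X \<in> carrier (presented_monoid S R)"
  then obtain x where "x \<in> lists S" "X = word_class S R x"
    by (auto simp: presented_monoid_def)
  then show "\<one>\<^bsub>presented_monoid S R\<^esub> \<otimes>\<^bsub>presented_monoid S R\<^esub> X = X"
    "X \<otimes>\<^bsub>presented_monoid S R\<^esub> \<one>\<^bsub>presented_monoid S R\<^esub> = X"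
    by (simp_all add: one presented_monoid_mult)
qed


section \<open>Coxeter systems\<close>

text \<open>
  The group presentation with generators \<open>I\<close> and relators \<open>(s t) [^] m(s, t)\<close>, where \<open>m(s, t)\<close> is the
  order of \<open>s t\<close>.  Since \<open>m(s, s) = 1\<close>, every generator is its own inverse, so the monoid with
  this presentation is already a group, and there is no need for words with formal inverses.
  As \<open>ord\<close> is 0 for elements of infinite order, such pairs only contribute trivial relations.
\<close>

definition coxeter_relations ::
    "('a, 'b) monoid_scheme \<Rightarrow> 'a set \<Rightarrow> ('a list \<times> 'a list) set"
  where "coxeter_relations W I =
    {(concat (replicate (group.ord W (s \<otimes>\<^bsub>W\<^esub> t)) [s, t]), []) | s t. s \<in> I \<and> t \<in> I}"

locale coxeter_system = group W for W (structure) +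
  fixes I
  assumes simple_closed: "I \<subseteq> carrier W"
    and simple_order: "s \<in> I \<Longrightarrow> ord s = 2"
    and simple_generate: "generate W I = carrier W"
    and presentation: "\<lbrakk>u \<in> lists I; v \<in> lists I\<rbrakk> \<Longrightarrow>
      mprod W u = mprod W v \<longleftrightarrow> word_cong I (coxeter_relations W I) u v"

text \<open>The word \<open>s t s t \<dots>\<close> with \<open>n\<close> letters.\<close>

definition alt_word :: "'a \<Rightarrow> 'a \<Rightarrow> nat \<Rightarrow> 'a list"
  where "alt_word s t n = map (\<lambda>i. if even i then s else t) [0..<n]"

definition braid_relations ::
    "('a, 'b) monoid_scheme \<Rightarrow> 'a set \<Rightarrow> ('a list \<times> 'a list) set"
  where "braid_relations W I =
    {(alt_word s t n, alt_word t s n) | s t n. s \<in> I \<and> t \<in> I \<and> n = group.ord W (s \<otimes>\<^bsub>W\<^esub> t)}"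

context coxeter_system
begin

definition len :: "'a \<Rightarrow> nat"
  where "len w = (LEAST n. \<exists>u \<in> lists I. length u = n \<and> mprod W u = w)"

definition longest :: "'a set \<Rightarrow> 'a"
  where "longest K = (THE w. is_arg_max len (\<lambda>v. v \<in> generate W K) w)"

definition min_length :: "'a set \<Rightarrow> 'a set"
  where "min_length A = {w. is_arg_min len (\<lambda>v. v \<in> A) w}"

definition braid_monoid :: "'a list set monoid"
  where "braid_monoid = presented_monoid I (braid_relations W I)"

definition braid_gen :: "'a \<Rightarrow> 'a list set"
  where "braid_gen s = word_class I (braid_relations W I) [s]"

text \<open>
  The conditions determine the lift on all of \<open>W\<close>: the case \<open>w\<^sub>1 = w\<^sub>2 = \<one>\<close> of the last one makes
  the lift of \<open>\<one>\<close> idempotent, hence trivial, because braid relations preserve the length of words.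
  That such a map exists is Matsumoto's theorem.  Extensionality fixes the irrelevant values
  outside the carrier, so that \<open>THE\<close> is meaningful.
\<close>

definition is_lift :: "('a \<Rightarrow> 'a list set) \<Rightarrow> bool"
  where "is_lift f \<longleftrightarrow>
    f \<in> carrier W \<rightarrow>\<^sub>E carrier braid_monoid \<and>
    inj_on f (carrier W) \<and>
    (\<forall>s \<in> I. f s = braid_gen s) \<and>
    (\<forall>w\<^sub>1 \<in> carrier W. \<forall>w\<^sub>2 \<in> carrier W. len (w\<^sub>1 \<otimes> w\<^sub>2) = len w\<^sub>1 + len w\<^sub>2 \<longrightarrow>
      f (w\<^sub>1 \<otimes> w\<^sub>2) = f w\<^sub>1 \<otimes>\<^bsub>braid_monoid\<^esub> f w\<^sub>2)"

definition lift :: "'a \<Rightarrow> 'a list set"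
  where "lift = (THE f. is_lift f)"

text \<open>
  The extension of \<open>\<sigma>\<close> to the braid monoid applies \<open>\<sigma>\<close> letter by letter; see \<open>braid_aut_gen\<close> and
  \<open>braid_aut_iso\<close> below.
\<close>

definition braid_aut :: "('a \<Rightarrow> 'a) \<Rightarrow> 'a list set \<Rightarrow> 'a list set"
  where "braid_aut \<sigma> X = map \<sigma> ` X"

definition twisted_conj :: "('a \<Rightarrow> 'a) \<Rightarrow> 'a \<Rightarrow> 'a \<Rightarrow> 'a"
  where "twisted_conj \<sigma> x = (\<lambda>w \<in> carrier W. x \<otimes> w \<otimes> inv (\<sigma> x))"

definition twisted_conj_classes :: "('a \<Rightarrow> 'a) \<Rightarrow> 'a set set"
  where "twisted_conj_classes \<sigma> = orbits W (carrier W) (twisted_conj \<sigma>)"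

definition twisted_order :: "('a \<Rightarrow> 'a) \<Rightarrow> 'a \<Rightarrow> nat"
  where "twisted_order \<sigma> w = (LEAST d. d > 0 \<and>
    mprod W (map (\<lambda>i. (\<sigma> ^^ i) w) [0..<d]) = \<one> \<and>
    (\<forall>x \<in> carrier W. (\<sigma> ^^ d) x = x))"

text \<open>
  The inclusions \<open>I\<^sub>1 \<supseteq> I\<^sub>2 \<supseteq> \<dots>\<close> are not required to be strict: repetitions are needed, e.g. for
  the rotation by \<open>4\<pi>/5\<close> in the dihedral group of order 10.
\<close>

definition good :: "('a \<Rightarrow> 'a) \<Rightarrow> 'a \<Rightarrow> bool"
  where "good \<sigma> w \<longleftrightarrow> (\<exists>Ks. Ks \<noteq> [] \<and> (\<forall>K \<in> set Ks. K \<subseteq> I) \<and> sorted_wrt (\<supseteq>) Ks \<and>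
    mprod braid_monoid (map (\<lambda>i. (braid_aut \<sigma> ^^ i) (lift w)) [0..<twisted_order \<sigma> w]) =
    mprod braid_monoid (map (\<lambda>K. lift (longest K) [^]\<^bsub>braid_monoid\<^esub> (2::nat)) Ks))"


subsection \<open>Checks on the definitions\<close>

lemma ord_iso:
  assumes "\<sigma> \<in> iso W W" "x \<in> carrier W"
  shows "ord (\<sigma> x) = ord x"
proof -
  have hom: "group_hom W W \<sigma>"
    using assms(1) by (simp add: group_hom_def group_hom_axioms_def iso_def is_group)
  have bij: "bij_betw \<sigma> (carrier W) (carrier W)"
    using assms(1) by (simp add: iso_def)
  have "\<sigma> x [^] n = \<one> \<longleftrightarrow> x [^] n = \<one>" for n :: nat
  proof -
    have "\<sigma> x [^] n = \<sigma> (x [^] n)" "\<sigma> \<one> = \<one>"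
      using group_hom.hom_nat_pow[OF hom assms(2)] group_hom.hom_one[OF hom] by simp_all
    then show ?thesis
      using bij assms(2) unfolding bij_betw_def inj_on_def
      by (metis nat_pow_closed one_closed)
  qed
  then show ?thesis
    unfolding ord_def by simp
qed

lemma map_lists: "u \<in> lists I \<Longrightarrow> \<sigma> ` I = I \<Longrightarrow> map \<sigma> u \<in> lists I"
  by (metis imageI lists_image)

lemma map_alt_word: "map f (alt_word s t n) = alt_word (f s) (f t) n"
  by (auto simp: alt_word_def)

lemma word_cong_map:
  assumes "\<sigma> \<in> iso W W" "\<sigma> ` I = I"
  shows "word_cong I (braid_relations W I) u v \<Longrightarrow>
    word_cong I (braid_relations W I) (map \<sigma> u) (map \<sigma> v)"
proof (induction rule: word_cong.induct)
  case (rel u v)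
  then obtain s t where st: "s \<in> I" "t \<in> I"
    "u = alt_word s t (ord (s \<otimes> t))" "v = alt_word t s (ord (s \<otimes> t))"
    by (auto simp: braid_relations_def)
  have "\<sigma> (s \<otimes> t) = \<sigma> s \<otimes> \<sigma> t"
    using assms(1) st simple_closed by (auto simp: iso_def hom_def)
  then have "ord (\<sigma> s \<otimes> \<sigma> t) = ord (s \<otimes> t)"
    using ord_iso[OF assms(1), of "s \<otimes> t"] st simple_closed by (metis m_closed subsetD)
  moreover have "\<sigma> s \<in> I" "\<sigma> t \<in> I"
    using st assms(2) by auto
  ultimately have "(map \<sigma> u, map \<sigma> v) \<in> braid_relations W I"
    unfolding braid_relations_def st(3,4) map_alt_word mem_Collect_eq by metis
  moreover have "map \<sigma> u \<in> lists I" "map \<sigma> v \<in> lists I"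
    using rel assms(2) by (simp_all only: map_lists)
  ultimately show ?case by (rule word_cong.rel)
next
  case (refl u)
  then show ?case using assms(2) by (simp only: word_cong.refl map_lists)
next
  case (sym u v)
  then show ?case by (blast intro: word_cong.sym)
next
  case (trans u v w)
  then show ?case by (blast intro: word_cong.trans)
next
  case (append u u' v v')
  then show ?case by (simp add: word_cong.append)
qed

lemma braid_aut_class:
  assumes "\<sigma> \<in> iso W W" "\<sigma> ` I = I" "u \<in> lists I"
  shows "braid_aut \<sigma> (word_class I (braid_relations W I) u) =
    word_class I (braid_relations W I) (map \<sigma> u)"
proof -
  let ?c = "word_cong I (braid_relations W I)"
  define \<tau> where "\<tau> = inv_into (carrier W) \<sigma>"
  have bij: "bij_betw \<sigma> (carrier W) (carrier W)"
    using assms(1) by (simp add: iso_def)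
  have \<tau>: "\<tau> \<in> iso W W"
    unfolding \<tau>_def using assms(1) by (rule iso_set_sym)
  have \<tau>\<sigma>: "\<tau> (\<sigma> x) = x" and \<sigma>\<tau>: "\<sigma> (\<tau> x) = x" if "x \<in> I" for x
    using that simple_closed bij unfolding \<tau>_def
    by (auto simp: bij_betw_inv_into_left bij_betw_inv_into_right)
  have \<tau>I: "\<tau> ` I = I"
  proof -
    have "\<tau> ` \<sigma> ` I = I"
      using \<tau>\<sigma> by (simp add: image_image)
    then show ?thesis
      by (simp only: assms(2))
  qed
  have "v \<in> map \<sigma> ` {v. ?c u v}" if "?c (map \<sigma> u) v" for v
  proof -
    have "?c (map \<tau> (map \<sigma> u)) (map \<tau> v)"
      using word_cong_map[OF \<tau> \<tau>I that] .
    moreover have "map \<tau> (map \<sigma> u) = u"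
      using assms(3) \<tau>\<sigma> by (simp add: map_idI in_lists_conv_set)
    moreover have "map \<sigma> (map \<tau> v) = v"
      using word_cong_lists[OF that] \<sigma>\<tau> by (simp add: map_idI in_lists_conv_set)
    ultimately show ?thesis
      by (metis imageI mem_Collect_eq)
  qed
  then show ?thesis
    unfolding braid_aut_def word_class_def using word_cong_map[OF assms(1,2)] by auto
qed

lemma braid_aut_gen:
  assumes "\<sigma> \<in> iso W W" "\<sigma> ` I = I" "s \<in> I"
  shows "braid_aut \<sigma> (braid_gen s) = braid_gen (\<sigma> s)"
  using braid_aut_class[OF assms(1,2), of "[s]"] assms(3) by (simp add: braid_gen_def)

lemma braid_aut_iso:
  assumes "\<sigma> \<in> iso W W" "\<sigma> ` I = I"
  shows "braid_aut \<sigma> \<in> iso braid_monoid braid_monoid"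
proof -
  have car: "carrier braid_monoid = word_class I (braid_relations W I) ` lists I"
    by (simp add: braid_monoid_def presented_monoid_def)
  have "braid_aut \<sigma> \<in> hom braid_monoid braid_monoid"
  proof (rule homI)
    fix X assume "X \<in> carrier braid_monoid"
    then obtain x where x: "x \<in> lists I" "X = word_class I (braid_relations W I) x"
      unfolding car by blast
    show "braid_aut \<sigma> X \<in> carrier braid_monoid"
      unfolding car x(2) braid_aut_class[OF assms x(1)]
      using map_lists[OF x(1) assms(2)] by (rule imageI)
  next
    fix X Y assume "X \<in> carrier braid_monoid" "Y \<in> carrier braid_monoid"
    then obtain x y where xy: "x \<in> lists I" "y \<in> lists I"
      "X = word_class I (braid_relations W I) x" "Y = word_class I (braid_relations W I) y"
      unfolding car by blast
    then have app: "x @ y \<in> lists I"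
      by simp
    show "braid_aut \<sigma> (X \<otimes>\<^bsub>braid_monoid\<^esub> Y) =
        braid_aut \<sigma> X \<otimes>\<^bsub>braid_monoid\<^esub> braid_aut \<sigma> Y"
      unfolding xy(3,4) braid_monoid_def presented_monoid_mult[OF xy(1,2)]
        braid_aut_class[OF assms xy(1)] braid_aut_class[OF assms xy(2)]
        braid_aut_class[OF assms app] map_append
        presented_monoid_mult[OF map_lists[OF xy(1) assms(2)] map_lists[OF xy(2) assms(2)]]
      by (rule HOL.refl)
  qed
  moreover have "inj_on (braid_aut \<sigma>) (carrier braid_monoid)"
  proof (rule inj_onI)
    fix X Y assume XY: "X \<in> carrier braid_monoid" "Y \<in> carrier braid_monoid"
      and eq: "braid_aut \<sigma> X = braid_aut \<sigma> Y"
    have inj: "inj_on \<sigma> I"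
      using assms(1) simple_closed by (auto simp: iso_def bij_betw_def intro: inj_on_subset)
    have "inj_on (map \<sigma>) (lists I)"
      using inj by (rule inj_on_mapI[OF inj_on_subset]) auto
    moreover have "X \<subseteq> lists I" "Y \<subseteq> lists I"
      using XY word_cong_lists unfolding car word_class_def by fastforce+
    ultimately show "X = Y"
      using eq unfolding braid_aut_def by (meson inj_on_image_eq_iff)
  qed
  moreover have "braid_aut \<sigma> ` carrier braid_monoid = carrier braid_monoid"
  proof -
    have "map \<sigma> ` lists I = lists I"
      using assms(2) by (metis lists_image)
    moreover have "braid_aut \<sigma> ` carrier braid_monoid =
        word_class I (braid_relations W I) ` map \<sigma> ` lists I"
      unfolding car image_image using braid_aut_class[OF assms] by (intro image_cong) auto
    ultimately show ?thesis using car by simp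
  qed
  ultimately show ?thesis
    by (simp add: iso_def bij_betw_def)
qed

lemma twisted_conj_action:
  assumes "\<sigma> \<in> iso W W"
  shows "group_action W (carrier W) (twisted_conj \<sigma>)"
proof -
  have hom: "group_hom W W \<sigma>"
    using assms by (simp add: group_hom_def group_hom_axioms_def iso_def is_group)
  have cl: "\<sigma> x \<in> carrier W" if "x \<in> carrier W" for x
    using group_hom.hom_closed[OF hom that] .
  have comp: "twisted_conj \<sigma> x (twisted_conj \<sigma> y w) = twisted_conj \<sigma> (x \<otimes> y) w"
    if "x \<in> carrier W" "y \<in> carrier W" "w \<in> carrier W" for x y w
    using that cl group_hom.hom_mult[OF hom]
    by (simp add: twisted_conj_def m_assoc inv_mult_group)
  have closed: "twisted_conj \<sigma> x w \<in> carrier W" if "x \<in> carrier W" "w \<in> carrier W" for x w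
    using that cl by (simp add: twisted_conj_def)
  have id: "twisted_conj \<sigma> \<one> w = w" if "w \<in> carrier W" for w
    using that group_hom.hom_one[OF hom] by (simp add: twisted_conj_def)
  have Bij: "twisted_conj \<sigma> x \<in> Bij (carrier W)" if x: "x \<in> carrier W" for x
  proof -
    have "bij_betw (twisted_conj \<sigma> x) (carrier W) (carrier W)"
      by (rule bij_betw_byWitness[where f' = "twisted_conj \<sigma> (inv x)"])
        (use x comp id closed in auto)
    then show ?thesis
      by (simp add: Bij_def twisted_conj_def)
  qed
  have "twisted_conj \<sigma> \<in> hom W (BijGroup (carrier W))"
  proof (rule homI)
    fix x assume "x \<in> carrier W"
    then show "twisted_conj \<sigma> x \<in> carrier (BijGroup (carrier W))"
      using Bij by (simp add: BijGroup_def)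
  next
    fix x y assume xy: "x \<in> carrier W" "y \<in> carrier W"
    have "twisted_conj \<sigma> (x \<otimes> y) = compose (carrier W) (twisted_conj \<sigma> x) (twisted_conj \<sigma> y)"
    proof
      fix w
      show "twisted_conj \<sigma> (x \<otimes> y) w =
          compose (carrier W) (twisted_conj \<sigma> x) (twisted_conj \<sigma> y) w"
        using comp[OF xy, of w, symmetric]
        by (cases "w \<in> carrier W") (simp_all add: compose_def, simp add: twisted_conj_def)
    qed
    then show "twisted_conj \<sigma> (x \<otimes> y) =
        twisted_conj \<sigma> x \<otimes>\<^bsub>BijGroup (carrier W)\<^esub> twisted_conj \<sigma> y"
      using Bij xy by (simp add: BijGroup_def)
  qed
  then show ?thesis
    by (simp add: group_action_def group_hom_def group_hom_axioms_def group_BijGroup is_group)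
qed

end

end

theory Submission
  imports Defs Complex_Main "HOL-Combinatorics.Cycles"
begin

text \<open>
  Let \<open>w \<sigma>\<close> act on the geometric representation, with period \<open>d\<close>, and decompose by the discrete
  Fourier transform along the orbits of \<open>w \<sigma>\<close>. The level of a root \<open>\<gamma>\<close> is the smallest frequency \<open>a\<close>
  occurring in \<open>\<gamma>\<close>.

  Along the chambers \<open>C, w \<sigma> C, \<dots>, (w \<sigma>)\<^sup>d C = C\<close> the root \<open>\<gamma>\<close> changes sign at least
  \<open>2 * level \<gamma>\<close> times, by the discrete version of Hurwitz's theorem on trigonometric polynomials
  without low frequencies. Counting all crossings bounds \<open>d\<close> times the length of any element of the
  class from below.

  Equality is attained, following He and Nie, for a chamber containing a vector whose component of
  frequency 0 dominates that of frequency 1, and so on, so that each root only sees the component at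
  its own level. Rotating the components is then a gallery in which different levels move
  independently and every hyperplane is crossed at most once in each half turn; hence the braid
  element of the gallery depends on its ends only. Comparing the gallery in which the component of
  frequency \<open>a\<close> rotates by \<open>2 * pi * a / d\<close> per step with the one which negates simultaneously all
  components that have not yet completed their turns gives the equation of good elements, since
  negating the components of frequency at least \<open>k\<close> amounts to multiplying by the longest element
  of a standard parabolic subgroup.
\<close>

text \<open>The elements \<open>inv y \<otimes> w \<otimes> \<sigma> y\<close> of the class are the
  relative positions of a chamber \<open>y\<close> and its image under w \<sigma>, so minimising the
  length is a choice of chamber.

  The obstacle is that a gallery winding around several times is not determined in the braid monoid
  by its end chambers. States therefore carry real times instead of angles: after a full turn the
  chamber is the old one but the state is new, as on a universal cover.

  Domination between components is never realised by an actual vector with small constants. A state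
  only prescribes a sign for each root, and such a sign pattern is shown to come from a chamber.
  This makes the pointwise supremum of two states again admissible, which is what lets two galleries
  be compared.

  Frequencies above d/2 are conjugate to those below, so a single step of the rotation never exceeds
  a half turn and is the lift of an element of W.

  A single equation yields both claims: it is the equation of good elements, and since braid
  relations preserve the length of words, it also computes the length and matches it with the lower
  bound.\<close>

declare in_lists_conv_set [simp] ball_Un [simp]

lemma mprod_Nil [simp]: "mprod M [] = \<one>\<^bsub>M\<^esub>"
  by (simp add: mprod_def)

lemma mprod_Cons [simp]: "mprod M (x # xs) = x \<otimes>\<^bsub>M\<^esub> mprod M xs"
  by (simp add: mprod_def)

context monoid
begin

lemma mprod_closed: "xs \<in> lists (carrier G) \<Longrightarrow> mprod G xs \<in> carrier G"
  by (induction xs) auto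

lemma mprod_append:
  "\<lbrakk>xs \<in> lists (carrier G); ys \<in> lists (carrier G)\<rbrakk> \<Longrightarrow>
    mprod G (xs @ ys) = mprod G xs \<otimes> mprod G ys"
  by (induction xs) (auto simp: mprod_closed m_assoc)

end

lemma alt_word_0 [simp]: "alt_word s t 0 = []"
  by (simp add: alt_word_def)

lemma alt_word_Suc: "alt_word s t (Suc n) = alt_word s t n @ [if even n then s else t]"
  by (simp add: alt_word_def)

lemma alt_word_Suc': "alt_word s t (Suc n) = s # alt_word t s n"
  by (rule nth_equalityI) (auto simp: alt_word_def nth_Cons' simp del: upt_Suc)

lemma length_alt_word [simp]: "length (alt_word s t n) = n"
  by (simp add: alt_word_def)

lemma alt_word_in_lists: "s \<in> S \<Longrightarrow> t \<in> S \<Longrightarrow> alt_word s t n \<in> lists S"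
  by (auto simp: alt_word_def)

lemma alt_word_double: "alt_word s t (2 * n) = concat (replicate n [s, t])"
  by (induction n) (simp_all add: alt_word_Suc')

lemma alt_word_append_rev: "alt_word s t n @ rev (alt_word t s n) = alt_word s t (2 * n)"
  by (rule nth_equalityI) (auto simp: alt_word_def nth_append rev_nth)

lemma rev_alt_word_double: "rev (alt_word s t (2 * n)) = alt_word t s (2 * n)"
  by (rule nth_equalityI) (auto simp: alt_word_def rev_nth)

locale finite_coxeter_system = coxeter_system +
  assumes finite_carrier: "finite (carrier W)"
begin

section \<open>Words and lengths\<close>

lemma finite_I: "finite I"
  using finite_carrier simple_closed by (rule rev_finite_subset)

lemma simple_carrier [simp]: "s \<in> I \<Longrightarrow> s \<in> carrier W"
  using simple_closed by blast

lemma lists_carrier: "u \<in> lists I \<Longrightarrow> u \<in> lists (carrier W)"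
  using simple_closed by auto

lemma mprod_lists_closed [simp]: "u \<in> lists I \<Longrightarrow> mprod W u \<in> carrier W"
  by (intro mprod_closed lists_carrier)

lemma mprod_lists_append:
  "\<lbrakk>u \<in> lists I; v \<in> lists I\<rbrakk> \<Longrightarrow> mprod W (u @ v) = mprod W u \<otimes> mprod W v"
  by (intro mprod_append lists_carrier)

lemma simple_square [simp]: "s \<in> I \<Longrightarrow> s \<otimes> s = \<one>"
  using pow_ord_eq_1[of s] simple_order[of s] by (simp add: numeral_2_eq_2)

lemma simple_inv [simp]: "s \<in> I \<Longrightarrow> inv s = s"
  by (simp add: inv_equality)

lemma simple_cancel_left [simp]: "\<lbrakk>s \<in> I; w \<in> carrier W\<rbrakk> \<Longrightarrow> s \<otimes> (s \<otimes> w) = w"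
  by (simp flip: m_assoc)

lemma simple_cancel_right [simp]: "\<lbrakk>s \<in> I; w \<in> carrier W\<rbrakk> \<Longrightarrow> w \<otimes> s \<otimes> s = w"
  by (simp add: m_assoc)

lemma cancel_inv_left [simp]: "\<lbrakk>x \<in> carrier W; y \<in> carrier W\<rbrakk> \<Longrightarrow> x \<otimes> (inv x \<otimes> y) = y"
  by (simp flip: m_assoc)

lemma inv_cancel_left [simp]: "\<lbrakk>x \<in> carrier W; y \<in> carrier W\<rbrakk> \<Longrightarrow> inv x \<otimes> (x \<otimes> y) = y"
  by (simp flip: m_assoc)

lemma word_exists:
  assumes "w \<in> carrier W"
  shows "\<exists>u\<in>lists I. mprod W u = w"
proof -
  have "w \<in> generate W I"
    using assms simple_generate by simp
  then show ?thesis
  proof (induction rule: generate.induct)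
    case one
    show ?case by (rule bexI[of _ "[]"]) auto
  next
    case (incl h)
    then show ?case by (intro bexI[of _ "[h]"]) auto
  next
    case (inv h)
    then show ?case by (intro bexI[of _ "[h]"]) auto
  next
    case (eng h1 h2)
    then obtain u v where "u \<in> lists I" "mprod W u = h1" "v \<in> lists I" "mprod W v = h2"
      by blast
    then show ?case
      by (intro bexI[of _ "u @ v"]) (simp_all add: mprod_lists_append)
  qed
qed

lemma inv_mprod: "u \<in> lists I \<Longrightarrow> inv (mprod W u) = mprod W (rev u)"
proof (induction u)
  case (Cons s u)
  then have s: "s \<in> I" and u: "u \<in> lists I" by auto
  have "rev u \<in> lists I" using u by auto
  then have "mprod W (rev (s # u)) = mprod W (rev u) \<otimes> s"
    using s by (simp add: mprod_lists_append)
  then show ?case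
    using Cons s u by (simp add: inv_mult_group)
qed simp

lemma len_le: "u \<in> lists I \<Longrightarrow> len (mprod W u) \<le> length u"
  unfolding len_def by (rule Least_le) blast

lemma reduced_word:
  assumes "w \<in> carrier W"
  obtains u where "u \<in> lists I" "length u = len w" "mprod W u = w"
proof -
  have "\<exists>u\<in>lists I. length u = len w \<and> mprod W u = w"
    unfolding len_def
    by (rule LeastI_ex[of "\<lambda>n. \<exists>u\<in>lists I. length u = n \<and> mprod W u = w"])
      (use word_exists[OF assms] in blast)
  then show thesis using that by blast
qed

lemma len_one [simp]: "len \<one> = 0"
  using len_le[of "[]"] by simp

lemma len_eq_0: "w \<in> carrier W \<Longrightarrow> len w = 0 \<longleftrightarrow> w = \<one>"
  by (rule iffI, rule reduced_word[of w]) auto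

lemma len_mult:
  assumes "x \<in> carrier W" "y \<in> carrier W"
  shows "len (x \<otimes> y) \<le> len x + len y"
proof -
  obtain u v where "u \<in> lists I" "length u = len x" "mprod W u = x"
    "v \<in> lists I" "length v = len y" "mprod W v = y"
    by (rule reduced_word[OF assms(1)], rule reduced_word[OF assms(2)])
  then show ?thesis
    using len_le[of "u @ v"] by (simp add: mprod_lists_append)
qed

lemma len_inv [simp]:
  assumes "w \<in> carrier W"
  shows "len (inv w) = len w"
proof -
  have le: "len (inv w) \<le> len w" if w: "w \<in> carrier W" for w
  proof -
    obtain u where "u \<in> lists I" "length u = len w" "mprod W u = w"
      by (rule reduced_word[OF w])
    then show ?thesis
      using len_le[of "rev u"] inv_mprod[of u] by auto
  qed
  show ?thesis
    using le[OF assms] le[of "inv w"] assms by simp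
qed

text \<open>Relators have even length, so parity is an invariant of group elements (the sign
  character). It excludes \<open>len (w \<otimes> s) = len w\<close>, which the triangle inequality
  leaves open.\<close>

lemma word_cong_even_length:
  "word_cong I (coxeter_relations W I) u v \<Longrightarrow> even (length u) = even (length v)"
proof (induction rule: word_cong.induct)
  case (rel u v)
  then show ?case
    by (auto simp: coxeter_relations_def simp flip: alt_word_double)
qed auto

lemma even_len:
  assumes "u \<in> lists I"
  shows "even (len (mprod W u)) = even (length u)"
proof -
  obtain v where "v \<in> lists I" "length v = len (mprod W u)" "mprod W v = mprod W u"
    by (rule reduced_word[OF mprod_lists_closed[OF assms]])
  then show ?thesis
    using word_cong_even_length presentation assms by metis
qed

lemma len_mult_simple:
  assumes "w \<in> carrier W" "s \<in> I"
  shows "len (w \<otimes> s) = Suc (len w) \<or> Suc (len (w \<otimes> s)) = len w"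
proof -
  have s1: "len s \<le> 1"
    using len_le[of "[s]"] assms by simp
  have "len (w \<otimes> s) \<le> len w + 1"
    using len_mult[of w s] s1 assms by simp
  moreover have "len w \<le> len (w \<otimes> s) + 1"
    using len_mult[of "w \<otimes> s" s] s1 assms by simp
  moreover have "len (w \<otimes> s) \<noteq> len w"
  proof -
    obtain u where u: "u \<in> lists I" "mprod W u = w"
      using word_exists assms by blast
    then have "even (len (w \<otimes> s)) \<noteq> even (length u)"
      using even_len[of "u @ [s]"] assms by (simp add: mprod_lists_append)
    then show ?thesis
      using even_len[OF u(1)] u(2) by metis
  qed
  ultimately show ?thesis by linarith
qed

lemma len_simple_mult:
  assumes "w \<in> carrier W" "s \<in> I"
  shows "len (s \<otimes> w) = Suc (len w) \<or> Suc (len (s \<otimes> w)) = len w"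
proof -
  have "len (s \<otimes> w) = len (inv w \<otimes> s)"
    using len_inv[of "s \<otimes> w"] assms by (simp add: inv_mult_group)
  then show ?thesis
    using len_mult_simple[of "inv w" s] assms by simp
qed

lemma descent_exists:
  assumes "w \<in> carrier W" "w \<noteq> \<one>"
  obtains s where "s \<in> I" "Suc (len (s \<otimes> w)) = len w"
proof -
  obtain u where u: "u \<in> lists I" "length u = len w" "mprod W u = w"
    by (rule reduced_word[OF assms(1)])
  then obtain s v where sv: "u = s # v"
    using assms by (cases u) auto
  then have s: "s \<in> I" "v \<in> lists I" using u by auto
  then have "s \<otimes> w = mprod W v"
    using u sv by auto
  then have "len (s \<otimes> w) < len w"
    using len_le[of v] s u sv by auto
  then show thesis
    using that[of s] len_simple_mult[OF assms(1) s(1)] s by auto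
qed

lemma right_descent_exists:
  assumes "w \<in> carrier W" "w \<noteq> \<one>"
  obtains s where "s \<in> I" "Suc (len (w \<otimes> s)) = len w"
proof -
  obtain s where s: "s \<in> I" "Suc (len (s \<otimes> inv w)) = len (inv w)"
    using descent_exists[of "inv w"] assms by (metis inv_closed inv_inv inv_one)
  then have "len (s \<otimes> inv w) = len (w \<otimes> s)"
    using len_inv[of "w \<otimes> s"] assms by (simp add: inv_mult_group)
  then show thesis
    using that s assms by simp
qed

section \<open>Relations between two simple reflections\<close>

lemma order_pos [simp]: "w \<in> carrier W \<Longrightarrow> ord w > 0"
  using ord_ge_1[OF finite_carrier] by fastforce

lemma order_commute: "s \<in> I \<Longrightarrow> t \<in> I \<Longrightarrow> ord (s \<otimes> t) = ord (t \<otimes> s)"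
  using ord_inv[of "s \<otimes> t"] by (simp add: inv_mult_group)

lemma order_ge_2:
  assumes "s \<in> I" "t \<in> I" "s \<noteq> t"
  shows "ord (s \<otimes> t) \<ge> 2"
proof -
  have "ord (s \<otimes> t) \<noteq> 1"
  proof
    assume "ord (s \<otimes> t) = 1"
    then have "s \<otimes> t = \<one>"
      using pow_ord_eq_1[of "s \<otimes> t"] assms by simp
    then have "s = t"
      using inv_equality[of s t] assms by simp
    then show False using assms by simp
  qed
  then show ?thesis
    using order_pos[of "s \<otimes> t"] assms by (simp del: order_pos)
qed

lemma mprod_alt_word_double:
  assumes "s \<in> I" "t \<in> I"
  shows "mprod W (alt_word s t (2 * ord (s \<otimes> t))) = \<one>"
proof -
  let ?u = "concat (replicate (ord (s \<otimes> t)) [s, t])"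
  have u: "?u \<in> lists I" "[] \<in> lists I"
    using assms by (simp_all add: in_lists_conv_set)
  have "(?u, []) \<in> coxeter_relations W I"
    unfolding coxeter_relations_def mem_Collect_eq 
    by (intro exI[of _ s] exI[of _ t] conjI HOL.refl assms)
  then have "word_cong I (coxeter_relations W I) ?u []"
    using u by (rule word_cong.rel)
  then have "mprod W ?u = mprod W []"
    by (rule presentation[OF u, THEN iffD2])
  then show ?thesis
    unfolding alt_word_double by (simp only: mprod_Nil)
qed

text \<open>The relator is one alternating word followed by the reversal of the other. Reversal is
  inversion in W, so the two words have the same product.\<close>

lemma mprod_alt_word_commute:
  assumes "s \<in> I" "t \<in> I"
  shows "mprod W (alt_word s t (ord (s \<otimes> t))) = mprod W (alt_word t s (ord (s \<otimes> t)))"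
proof -
  let ?n = "ord (s \<otimes> t)"
  have l: "alt_word s t ?n \<in> lists I" "alt_word t s ?n \<in> lists I" "rev (alt_word t s ?n) \<in> lists I"
    using assms alt_word_in_lists[of s I t] alt_word_in_lists[of t I s] by auto
  have "mprod W (alt_word s t ?n) \<otimes> inv (mprod W (alt_word t s ?n)) = \<one>"
    using mprod_alt_word_double[OF assms] l
    by (simp add: inv_mprod alt_word_append_rev flip: mprod_lists_append)
  then have "inv (mprod W (alt_word t s ?n)) = inv (mprod W (alt_word s t ?n))"
    using l by (metis inv_closed inv_comm inv_equality mprod_lists_closed)
  then show ?thesis
    using l by (metis inv_inv mprod_lists_closed)
qed

section \<open>The geometric representation\<close>

text \<open>Vectors are coordinate functions with respect to the simple roots; only their values on
  \<open>I\<close> matter. For s = t the order is 1 and - cos pi = 1, so simple roots are unit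
  vectors.\<close>

definition coxeter_form :: "'a \<Rightarrow> 'a \<Rightarrow> real"
  where "coxeter_form s t = - cos (pi / real (ord (s \<otimes> t)))"

definition pairing :: "('a \<Rightarrow> real) \<Rightarrow> 'a \<Rightarrow> real"
  where "pairing v s = (\<Sum>t\<in>I. v t * coxeter_form t s)"

definition reflect :: "'a \<Rightarrow> ('a \<Rightarrow> real) \<Rightarrow> 'a \<Rightarrow> real"
  where "reflect s v = (\<lambda>x. v x - (if x = s then 2 * pairing v s else 0))"

definition simple_root :: "'a \<Rightarrow> 'a \<Rightarrow> real"
  where "simple_root s = (\<lambda>x. if x = s then 1 else 0)"

lemma coxeter_form_commute: "s \<in> I \<Longrightarrow> t \<in> I \<Longrightarrow> coxeter_form s t = coxeter_form t s"
  by (simp add: coxeter_form_def order_commute)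

lemma ord_square [simp]: "s \<in> I \<Longrightarrow> ord (s \<otimes> s) = 1"
  by simp

lemma coxeter_form_self [simp]: "s \<in> I \<Longrightarrow> coxeter_form s s = 1"
  unfolding coxeter_form_def by (subst ord_square) auto

lemma pairing_linear:
  "pairing (\<lambda>x. a * u x + b * v x) s = a * pairing u s + b * pairing v s"
  by (simp add: pairing_def sum.distrib sum_distrib_left algebra_simps)

lemma pairing_simple_root [simp]: "t \<in> I \<Longrightarrow> pairing (simple_root t) s = coxeter_form t s"
  by (simp add: pairing_def simple_root_def finite_I if_distrib[of "\<lambda>x. x * _"] cong: if_cong)

lemma reflect_linear:
  "reflect s (\<lambda>x. a * u x + b * v x) = (\<lambda>x. a * reflect s u x + b * reflect s v x)"
  by (auto simp: reflect_def pairing_linear algebra_simps)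

lemma reflect_alt: "reflect s v = (\<lambda>x. 1 * v x + (- 2 * pairing v s) * simple_root s x)"
  by (auto simp: reflect_def simple_root_def)

lemma pairing_reflect:
  "s \<in> I \<Longrightarrow> pairing (reflect s v) t = pairing v t - 2 * pairing v s * coxeter_form s t"
  by (simp only: reflect_alt pairing_linear) simp

lemma reflect_reflect [simp]: "s \<in> I \<Longrightarrow> reflect s (reflect s v) = v"
  using pairing_reflect[of s v s] unfolding reflect_def[of s "reflect s v"]
  by (auto simp: reflect_def)

lemma reflect_simple_root: "s \<in> I \<Longrightarrow> reflect s (simple_root s) = (\<lambda>x. - simple_root s x)"
  unfolding reflect_def by (subst pairing_simple_root) (auto simp: simple_root_def)

lemma reflect_zero: "pairing v s = 0 \<Longrightarrow> reflect s v = v"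
  by (auto simp: reflect_def)

lemma foldr_reflect_linear:
  "foldr reflect u (\<lambda>x. a * f x + b * g x) = (\<lambda>x. a * foldr reflect u f x + b * foldr reflect u g x)"
  by (induction u) (simp_all add: reflect_linear)

lemma fold_reflect_linear:
  "fold reflect u (\<lambda>x. a * f x + b * g x) = (\<lambda>x. a * fold reflect u f x + b * fold reflect u g x)"
  using foldr_reflect_linear[of "rev u"] by (simp add: foldr_conv_fold)

text \<open>The Chebyshev polynomial of the second kind of degree k - 1 at cos (pi / n). These are
  the coordinates of the roots of a dihedral group, and their being non-negative for k \<le> n is
  the source of positivity in rank two.\<close>

definition dihedral_coeff :: "nat \<Rightarrow> nat \<Rightarrow> real"
  where "dihedral_coeff n k = sin (real k * (pi / real n)) / sin (pi / real n)"

lemma sin_pi_div_pos: "n \<ge> 2 \<Longrightarrow> sin (pi / real n) > 0"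
  by (rule sin_gt_zero) (auto simp: field_simps)

lemma dihedral_coeff_nonneg:
  assumes "n \<ge> 2" "k \<le> n"
  shows "dihedral_coeff n k \<ge> 0"
proof -
  have "real k * pi / real n \<le> pi"
    using assms by (simp add: field_simps)
  then have "sin (real k * (pi / real n)) \<ge> 0"
    by (intro sin_ge_zero) auto
  then show ?thesis
    using sin_pi_div_pos[OF assms(1)] by (simp add: dihedral_coeff_def)
qed

lemma dihedral_coeff_rec:
  assumes "n \<ge> 2"
  shows "dihedral_coeff n (Suc (Suc k)) =
    2 * cos (pi / real n) * dihedral_coeff n (Suc k) - dihedral_coeff n k"
proof -
  define x where "x = pi / real n"
  have "real (Suc (Suc k)) * x = real (Suc k) * x + x" "real k * x = real (Suc k) * x - x"
    by (simp_all add: algebra_simps)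
  then have "sin (real (Suc (Suc k)) * x) = 2 * cos x * sin (real (Suc k) * x) - sin (real k * x)"
    by (simp only: sin_add sin_diff) simp
  then show ?thesis
    using sin_pi_div_pos[OF assms] unfolding dihedral_coeff_def x_def[symmetric]
    by (simp add: diff_divide_distrib)
qed

text \<open>Each reflection changes a single coordinate, and does so by the Chebyshev recurrence, so
  the two coordinates are always consecutive coefficients. \<open>fold\<close> applies the leftmost
  letter first.\<close>

lemma fold_reflect_alt_word:
  assumes st: "s \<in> I" "t \<in> I" "s \<noteq> t"
  defines "c \<equiv> dihedral_coeff (ord (s \<otimes> t))"
  shows "fold reflect (alt_word t s k) (simple_root s) =
    (\<lambda>x. (if even k then c (Suc k) else c k) * simple_root s x +
         (if even k then c k else c (Suc k)) * simple_root t x)"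
proof (induction k)
  case 0
  have "c 1 = 1" "c 0 = 0"
    using sin_pi_div_pos[OF order_ge_2[OF st]] by (simp_all add: c_def dihedral_coeff_def)
  then show ?case by simp
next
  case (Suc k)
  have rec: "c (Suc (Suc k)) = 2 * cos (pi / real (ord (s \<otimes> t))) * c (Suc k) - c k"
    unfolding c_def by (rule dihedral_coeff_rec[OF order_ge_2[OF st]])
  have form: "coxeter_form s t = - cos (pi / real (ord (s \<otimes> t)))"
      "coxeter_form t s = - cos (pi / real (ord (s \<otimes> t)))"
    using coxeter_form_commute[of s t] st by (auto simp: coxeter_form_def)
  show ?case
    using Suc st form rec
    by (cases "even k")
      (simp_all add: alt_word_Suc reflect_alt[of s] reflect_alt[of t] pairing_linear,
        simp_all add: algebra_simps)
qed

lemma foldr_reflect_relator: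
  assumes "s \<in> I" "t \<in> I"
  shows "foldr reflect (concat (replicate (ord (s \<otimes> t)) [s, t])) v = v"
proof (cases "s = t")
  case True
  then show ?thesis using assms ord_square[of s] by (simp del: simple_square)
next
  case False
  define n where "n = ord (s \<otimes> t)"
  have n2: "n \<ge> 2"
    using order_ge_2[OF assms False] by (simp add: n_def)
  note sin_pos = sin_pi_div_pos[OF n2]
  let ?R = "fold reflect (alt_word t s (2 * n))"
  have per: "real (2 * n) * (pi / real n) = 2 * pi"
    using n2 by (simp add: field_simps)
  have c1: "dihedral_coeff n (2 * n) = 0"
    unfolding dihedral_coeff_def per by simp
  have c2: "dihedral_coeff n (Suc (2 * n)) = 1"
  proof -
    have "real (Suc (2 * n)) * (pi / real n) = pi / real n + 2 * pi"
      using n2 by (simp add: field_simps)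
    then show ?thesis
      using sin_pos unfolding dihedral_coeff_def by (simp only: sin_periodic) simp
  qed
  have c3: "dihedral_coeff n (2 * n - 1) = - 1"
  proof -
    have "real (2 * n - 1) * (pi / real n) = - (pi / real n) + 2 * pi"
      using per n2 by (simp add: of_nat_diff field_simps)
    then show ?thesis
      using sin_pos unfolding dihedral_coeff_def by (simp only: sin_periodic) simp
  qed
  have Rs: "?R (simple_root s) = simple_root s"
    using fold_reflect_alt_word[OF assms False, of "2 * n", folded n_def] c1 c2 by simp
  \<comment> \<open>The first reflection of the word just negates the root of \<open>t\<close>. The
    remaining 2 n - 1 letters begin with \<open>s\<close>, so the formula applies with the two
    letters exchanged and gives a second sign.\<close>
  have Rt: "?R (simple_root t) = simple_root t"
  proof -
    have suc: "2 * n = Suc (2 * n - 1)" and odd: "odd (2 * n - 1)"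
      using n2 by auto
    have neg: "reflect t (simple_root t) = (\<lambda>x. (- 1) * simple_root t x + 0 * simple_root t x)"
      using reflect_simple_root[OF assms(2)] by simp
    have "?R (simple_root t) = fold reflect (alt_word s t (2 * n - 1)) (reflect t (simple_root t))"
      by (subst suc) (simp only: alt_word_Suc' fold_Cons comp_def)
    also have "\<dots> = (\<lambda>x. (- 1) * fold reflect (alt_word s t (2 * n - 1)) (simple_root t) x)"
      unfolding neg fold_reflect_linear by simp
    also have "\<dots> = simple_root t"
      using fold_reflect_alt_word[OF assms(2,1) False[symmetric], of "2 * n - 1"] odd
        order_commute[OF assms] c1 c3 suc
      by (simp add: n_def[symmetric] del: One_nat_def flip: suc)
    finally show ?thesis .
  qed
  define c where "c = coxeter_form s t"
  have cc: "coxeter_form t s = c"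
    using coxeter_form_commute assms by (simp add: c_def)
  have c: "1 - c * c \<noteq> 0"
  proof -
    have "c * c + sin (pi / real n) * sin (pi / real n) = 1"
      unfolding c_def coxeter_form_def n_def[symmetric]
      using sin_cos_squared_add[of "pi / real n"] by (simp add: power2_eq_square)
    then show ?thesis using sin_pos by auto
  qed
  \<comment> \<open>Cramer's rule for the Gram matrix of the two simple roots, whose determinant 1 -
    c^2 is the square of sin (pi / n). Then \<open>p\<close> is the orthogonal projection of
    \<open>v\<close> to their plane, and the rest \<open>q\<close> is fixed by both
    reflections.\<close>
  define a where "a = (pairing v s - c * pairing v t) / (1 - c * c)"
  define b where "b = (pairing v t - c * pairing v s) / (1 - c * c)"
  have ab: "a + b * c = pairing v s" "a * c + b = pairing v t"
  proof -
    have "(a + b * c) * (1 - c * c) = pairing v s * (1 - c * c)"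
      using c by (simp add: a_def b_def distrib_right) (simp add: algebra_simps)
    then show "a + b * c = pairing v s" using c by simp
    have "(a * c + b) * (1 - c * c) = pairing v t * (1 - c * c)"
      using c by (simp add: a_def b_def distrib_right) (simp add: algebra_simps)
    then show "a * c + b = pairing v t" using c by simp
  qed
  define p where "p = (\<lambda>x. a * simple_root s x + b * simple_root t x)"
  define q where "q = (\<lambda>x. 1 * v x + (- 1) * p x)"
  have pq: "pairing q s = 0" "pairing q t = 0"
    unfolding q_def pairing_linear unfolding p_def pairing_linear
    using ab assms cc by (simp_all add: c_def[symmetric])
  have "fold reflect u q = q" if "set u \<subseteq> {s, t}" for u
    using that by (induction u) (auto simp: reflect_zero pq)
  moreover have "set (alt_word t s (2 * n)) \<subseteq> {s, t}"
    by (auto simp: alt_word_def)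
  ultimately have Rq: "?R q = q" by blast
  have Rp: "?R p = p"
    unfolding p_def fold_reflect_linear Rs Rt by simp
  have v: "v = (\<lambda>x. 1 * q x + 1 * p x)"
    by (simp add: q_def)
  have "?R v = v"
    by (subst v, subst fold_reflect_linear) (simp add: Rq Rp, simp add: q_def)
  then show ?thesis
    by (simp add: n_def[symmetric] foldr_conv_fold rev_alt_word_double flip: alt_word_double)
qed

lemma word_cong_foldr_reflect:
  "word_cong I (coxeter_relations W I) u v \<Longrightarrow> foldr reflect u f = foldr reflect v f"
proof (induction arbitrary: f rule: word_cong.induct)
  case (rel u v)
  then show ?case
    by (auto simp: coxeter_relations_def foldr_reflect_relator simp del: foldr_append)
qed auto

text \<open>The choice of a word is harmless: words with equal product are congruent by the axiom
  \<open>presentation\<close>, and each relator acts trivially by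
  \<open>foldr_reflect_relator\<close>.\<close>

definition act :: "'a \<Rightarrow> ('a \<Rightarrow> real) \<Rightarrow> 'a \<Rightarrow> real"
  where "act w = foldr reflect (SOME u. u \<in> lists I \<and> mprod W u = w)"

lemma act_mprod:
  assumes "u \<in> lists I"
  shows "act (mprod W u) v = foldr reflect u v"
proof -
  define u' where "u' = (SOME u'. u' \<in> lists I \<and> mprod W u' = mprod W u)"
  have "u' \<in> lists I \<and> mprod W u' = mprod W u"
    unfolding u'_def by (rule someI[of _ u]) (use assms in simp)
  then show ?thesis
    using word_cong_foldr_reflect presentation assms unfolding act_def u'_def[symmetric] by metis
qed

lemma act_one [simp]: "act \<one> v = v"
  using act_mprod[of "[]"] by simp

lemma act_simple: "s \<in> I \<Longrightarrow> act s v = reflect s v"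
  using act_mprod[of "[s]"] by simp

lemma act_mult:
  assumes "x \<in> carrier W" "y \<in> carrier W"
  shows "act (x \<otimes> y) v = act x (act y v)"
proof -
  obtain u u' where "u \<in> lists I" "mprod W u = x" "u' \<in> lists I" "mprod W u' = y"
    using assms word_exists by metis
  then show ?thesis
    using act_mprod[of u] act_mprod[of u'] act_mprod[of "u @ u'"]
    by (auto simp: mprod_lists_append)
qed

lemma act_linear: "act w (\<lambda>x. a * f x + b * g x) = (\<lambda>x. a * act w f x + b * act w g x)"
  unfolding act_def by (rule foldr_reflect_linear)

lemma act_inv_act [simp]: "w \<in> carrier W \<Longrightarrow> act (inv w) (act w v) = v"
  by (simp flip: act_mult)

lemma act_act_inv [simp]: "w \<in> carrier W \<Longrightarrow> act w (act (inv w) v) = v"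
  by (simp flip: act_mult)

text \<open>Removing letters \<open>t, s, t, \<dots>\<close> from the right of \<open>w\<close> as long as the length drops reduces the
  claim to the shortest representative of the coset \<open>w\<langle>s, t\<rangle>\<close> and a computation in the plane
  spanned by the two simple roots.\<close>

lemma act_simple_root_nonneg:
  assumes "w \<in> carrier W" "s \<in> I" "len (w \<otimes> s) > len w"
  shows "act w (simple_root s) x \<ge> 0"
  using assms
proof (induction "len w" arbitrary: w s x rule: less_induct)
  case less
  note w = less.prems(1) and s = less.prems(2) and up = less.prems(3)
  show ?case
  proof (cases "w = \<one>")
    case True
    then show ?thesis by (simp add: simple_root_def)
  next
    case False
    obtain t where t: "t \<in> I" "Suc (len (w \<otimes> t)) = len w"
      using right_descent_exists[OF w False] .
    have st: "s \<noteq> t" using up t by auto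
    define n where "n = ord (s \<otimes> t)"
    have n2: "n \<ge> 2" using order_ge_2[OF s t(1) st] by (simp add: n_def)
    define r where "r k = mprod W (alt_word t s k)" for k
    have lists: "alt_word t s k \<in> lists I" "rev (alt_word t s k) \<in> lists I"
        "alt_word s t k \<in> lists I" "rev (alt_word s t k) \<in> lists I" for k
      using alt_word_in_lists[of t I s k] alt_word_in_lists[of s I t k] s t by auto
    have r [simp]: "r k \<in> carrier W" for k
      using lists by (simp add: r_def)
    have rSuc: "r (Suc k) = r k \<otimes> (if even k then t else s)" for k
      using lists[of k] s t by (simp add: r_def alt_word_Suc mprod_lists_append)
    \<comment> \<open>\<open>Q k\<close> says that each of the first k removed letters shortens the
      element, i.e. that the removal is still reduced.\<close>
    define Q where "Q k \<longleftrightarrow> len (w \<otimes> r k) + k = len w" for k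
    have step: "len (w \<otimes> r k) \<le> Suc (len (w \<otimes> r (Suc k)))" for k
      using len_mult_simple[of "w \<otimes> r k" t] len_mult_simple[of "w \<otimes> r k" s] w s t
      by (auto simp: rSuc m_assoc)
    have ge: "len w \<le> len (w \<otimes> r k) + k" for k
    proof (induction k)
      case 0
      then show ?case using w by (simp add: r_def)
    next
      case (Suc k)
      then show ?case using step[of k] by simp
    qed
    have Qdown: "Q k" if "Q (Suc k)" for k
      using that step[of k] ge[of k] by (simp add: Q_def)
    have Qdown': "Q k" if "Q l" "k \<le> l" for k l
      using that(2,1) by (induction rule: dec_induct) (auto dest: Qdown)
    have Q1: "Q 1"
      using t w by (simp add: Q_def r_def alt_word_Suc')
    have Qbound: "k \<le> len w" if "Q k" for k
      using that by (simp add: Q_def)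
    define k where "k = (GREATEST k. Q k)"
    have Qk: "Q k"
      unfolding k_def using Q1 Qbound by (rule GreatestI_nat)
    have k_max: "l \<le> k" if "Q l" for l
      unfolding k_def using that Qbound by (rule Greatest_le_nat)
    have k1: "k \<ge> 1" using k_max[OF Q1] .
    \<comment> \<open>If all n letters could be removed, then, since \<open>r n\<close> also begins
      with \<open>s\<close>, multiplying \<open>w\<close> by \<open>s\<close> would shorten it,
      against the hypothesis.\<close>
    have kn: "k < n"
    proof (rule ccontr)
      assume "\<not> k < n"
      then have Qn: "Q n" using Qdown'[OF Qk, of n] by simp
      obtain n' where n': "n = Suc n'" using n2 by (cases n) auto
      have "r n = mprod W (alt_word s t n)"
        using mprod_alt_word_commute[OF s t(1)] by (simp add: r_def n_def)
      also have "\<dots> = s \<otimes> r n'"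
        by (simp add: n' alt_word_Suc' r_def)
      finally have rn: "r n = s \<otimes> r n'" .
      have "w \<otimes> s = (w \<otimes> r n) \<otimes> (inv (r n) \<otimes> s)"
        using w s r[of n] by (simp add: m_assoc)
      also have "inv (r n) \<otimes> s = inv (r n')"
        using s by (simp add: rn inv_mult_group m_assoc)
      finally have "len (w \<otimes> s) \<le> len (w \<otimes> r n) + len (r n')"
        using len_mult[of "w \<otimes> r n" "inv (r n')"] w by simp
      moreover have "len (r n') \<le> n'"
        using len_le[OF lists(1), of n'] by (simp add: r_def)
      ultimately show False
        using Qn up n' by (simp add: Q_def)
    qed
    define v where "v = w \<otimes> r k"
    have v [simp]: "v \<in> carrier W" using w by (simp add: v_def)
    have v_less: "len v < len w"
      using Qk k1 by (simp add: Q_def v_def)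
    \<comment> \<open>\<open>y\<close> is the letter removed last and \<open>z\<close> the one due
      next. Putting \<open>y\<close> back lengthens \<open>v\<close>, and so does \<open>z\<close>
      by maximality of k; hence the induction hypothesis applies to both roots.\<close>
    define y z where "y = (if even k then s else t)" and "z = (if even k then t else s)"
    have yz: "y \<in> I" "z \<in> I" using s t by (auto simp: y_def z_def)
    have upz: "len (v \<otimes> z) > len v"
    proof (rule ccontr)
      assume "\<not> ?thesis"
      then have "Suc (len (v \<otimes> z)) = len v"
        using len_mult_simple[OF v yz(2)] by auto
      moreover have "v \<otimes> z = w \<otimes> r (Suc k)"
        using w s t by (simp add: v_def z_def rSuc m_assoc)
      ultimately have "Q (Suc k)"
        using Qk by (simp add: Q_def v_def)
      then show False using k_max[of "Suc k"] by simp
    qed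
    have upy: "len (v \<otimes> y) > len v"
    proof -
      obtain k' where k': "k = Suc k'" using k1 by (cases k) auto
      have "r k = r k' \<otimes> y" by (simp add: k' rSuc y_def)
      then have "v \<otimes> y = w \<otimes> r k'"
        using w yz by (simp add: v_def m_assoc)
      moreover have "Q k'" using Qdown Qk k' by simp
      ultimately show ?thesis
        using Qk by (simp add: Q_def v_def k')
    qed
    have nonneg: "act v (simple_root s) x \<ge> 0" "act v (simple_root t) x \<ge> 0"
      using less.hyps[OF v_less v yz(1) upy, of x] less.hyps[OF v_less v yz(2) upz, of x]
      by (auto simp: y_def z_def split: if_splits)
    have "w = v \<otimes> inv (r k)"
      using w by (simp add: v_def m_assoc)
    then have "act w (simple_root s) = act v (act (inv (r k)) (simple_root s))"
      by (simp add: act_mult)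
    also have "inv (r k) = mprod W (rev (alt_word t s k))"
      using inv_mprod[OF lists(1)] by (simp add: r_def)
    also have "act \<dots> (simple_root s) = fold reflect (alt_word t s k) (simple_root s)"
      using act_mprod[OF lists(2)] by (simp add: foldr_conv_fold)
    finally have "act w (simple_root s) =
        act v (fold reflect (alt_word t s k) (simple_root s))" .
    then show ?thesis
      unfolding fold_reflect_alt_word[OF s t(1) st] act_linear n_def[symmetric]
      using nonneg dihedral_coeff_nonneg[OF n2, of k] dihedral_coeff_nonneg[OF n2, of "Suc k"] kn
      by auto
  qed
qed

end

context finite_coxeter_system
begin

section \<open>Roots\<close>

definition roots :: "('a \<Rightarrow> real) set"
  where "roots = {act w (simple_root s) | w s. w \<in> carrier W \<and> s \<in> I}"

definition positive :: "('a \<Rightarrow> real) \<Rightarrow> bool"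
  where "positive v \<longleftrightarrow> (\<forall>x. v x \<ge> 0)"

lemma act_uminus: "act w (- v) = - act w v"
  using act_linear[of w "-1" v 0 v] by (simp add: fun_Compl_def)

lemma act_sum:
  assumes "finite A"
  shows "act w (\<lambda>x. \<Sum>i\<in>A. c i * f i x) = (\<lambda>x. \<Sum>i\<in>A. c i * act w (f i) x)"
  using assms
proof (induction A rule: finite_induct)
  case empty
  show ?case using act_linear[of w 0 "\<lambda>_. 0" 0 "\<lambda>_. 0"] by simp
next
  case (insert i A)
  then show ?case
    using act_linear[of w "c i" "f i" 1 "\<lambda>x. \<Sum>i\<in>A. c i * f i x"] by simp
qed

lemma act_outside:
  assumes "w \<in> carrier W" "x \<notin> I"
  shows "act w v x = v x"
proof -
  obtain u where u: "u \<in> lists I" "mprod W u = w"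
    using word_exists assms by blast
  from u(1) have "foldr reflect u v x = v x"
    using assms(2) by (induction u) (auto simp: reflect_def)
  then show ?thesis
    using act_mprod[OF u(1)] u(2) by simp
qed

lemma simple_root_in_roots [simp]: "s \<in> I \<Longrightarrow> simple_root s \<in> roots"
  unfolding roots_def by (rule CollectI, rule exI[of _ \<one>], rule exI[of _ s]) simp

lemma act_in_roots [simp]:
  assumes "\<gamma> \<in> roots" "w \<in> carrier W"
  shows "act w \<gamma> \<in> roots"
proof -
  obtain v s where "v \<in> carrier W" "s \<in> I" "\<gamma> = act v (simple_root s)"
    using assms unfolding roots_def by blast
  then have "act w \<gamma> = act (w \<otimes> v) (simple_root s)" "w \<otimes> v \<in> carrier W" "s \<in> I"
    using assms by (auto simp: act_mult)
  then show ?thesis unfolding roots_def by blast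
qed

lemma act_in_roots_iff: "w \<in> carrier W \<Longrightarrow> act w \<gamma> \<in> roots \<longleftrightarrow> \<gamma> \<in> roots"
  using act_in_roots[of "act w \<gamma>" "inv w"] act_in_roots[of \<gamma> w] by auto

lemma uminus_in_roots [simp]: "- \<gamma> \<in> roots \<longleftrightarrow> \<gamma> \<in> roots"
proof -
  have *: "- \<gamma> \<in> roots" if root: "\<gamma> \<in> roots" for \<gamma>
  proof -
    obtain v s where v: "v \<in> carrier W" "s \<in> I" "\<gamma> = act v (simple_root s)"
      using root unfolding roots_def by blast
    have "- \<gamma> = act (v \<otimes> s) (simple_root s)"
      using v act_uminus[of v "simple_root s"]
      by (simp add: act_mult act_simple reflect_simple_root fun_Compl_def)
    moreover have "v \<otimes> s \<in> carrier W" using v by simp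
    ultimately show ?thesis using v(2) unfolding roots_def by blast
  qed
  show ?thesis
    using *[of \<gamma>] *[of "- \<gamma>"] by (auto simp: fun_Compl_def)
qed

lemma finite_roots [simp]: "finite roots"
proof -
  have "roots = (\<lambda>(w, s). act w (simple_root s)) ` (carrier W \<times> I)"
    by (auto simp: roots_def)
  then show ?thesis
    using finite_carrier finite_I by simp
qed

lemma root_outside: "\<gamma> \<in> roots \<Longrightarrow> x \<notin> I \<Longrightarrow> \<gamma> x = 0"
  by (auto simp: roots_def act_outside simple_root_def)

lemma root_expansion:
  assumes "\<gamma> \<in> roots"
  shows "\<gamma> = (\<lambda>x. \<Sum>s\<in>I. \<gamma> s * simple_root s x)"
proof
  fix x
  show "\<gamma> x = (\<Sum>s\<in>I. \<gamma> s * simple_root s x)"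
    using root_outside[OF assms, of x] finite_I
    by (cases "x \<in> I") (auto simp: simple_root_def if_distrib[of "\<lambda>y. _ * y"] cong: if_cong)
qed

lemma act_root_expansion:
  "\<gamma> \<in> roots \<Longrightarrow> act w \<gamma> x = (\<Sum>s\<in>I. \<gamma> s * act w (simple_root s) x)"
  using act_sum[OF finite_I, of w \<gamma> simple_root] root_expansion[of \<gamma>] by metis

lemma root_nonzero:
  assumes "\<gamma> \<in> roots"
  shows "\<exists>x\<in>I. \<gamma> x \<noteq> 0"
proof (rule ccontr)
  assume zero: "\<not> ?thesis"
  obtain v s where v: "v \<in> carrier W" "s \<in> I" "\<gamma> = act v (simple_root s)"
    using assms unfolding roots_def by blast
  have "simple_root s s = act (inv v) \<gamma> s"
    using v by simp
  also have "\<dots> = 0"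
    using act_root_expansion[OF assms] zero by simp
  finally show False by (simp add: simple_root_def)
qed

lemma positive_act_simple_root_iff:
  assumes "w \<in> carrier W" "s \<in> I"
  shows "positive (act w (simple_root s)) \<longleftrightarrow> len (w \<otimes> s) > len w"
    and "positive (- act w (simple_root s)) \<longleftrightarrow> len (w \<otimes> s) < len w"
proof -
  have 1: "positive (act w (simple_root s))" if "len (w \<otimes> s) > len w" "w \<in> carrier W" for w
    using act_simple_root_nonneg[OF that(2) assms(2) that(1)] by (simp add: positive_def)
  have 2: "positive (- act w (simple_root s))" if "len (w \<otimes> s) < len w"
  proof -
    have "act (w \<otimes> s) (simple_root s) = - act w (simple_root s)"
      using assms act_uminus[of w "simple_root s"]
      by (simp add: act_mult act_simple reflect_simple_root fun_Compl_def)
    then show ?thesis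
      using 1[of "w \<otimes> s"] assms that by simp
  qed
  have 3: "\<not> (positive (act w (simple_root s)) \<and> positive (- act w (simple_root s)))"
  proof
    assume "positive (act w (simple_root s)) \<and> positive (- act w (simple_root s))"
    then have "act w (simple_root s) x = 0" for x
      by (auto simp: positive_def intro: antisym)
    then show False
      using root_nonzero[of "act w (simple_root s)"] assms by simp
  qed
  have 4: "len (w \<otimes> s) \<noteq> len w"
    using len_mult_simple[OF assms] by auto
  show "positive (act w (simple_root s)) \<longleftrightarrow> len (w \<otimes> s) > len w"
    "positive (- act w (simple_root s)) \<longleftrightarrow> len (w \<otimes> s) < len w"
    using 1 2 3 4 assms by (metis nat_neq_iff)+
qed

text \<open>Multiplication by a simple reflection always changes the length, and either direction of
  the change fixes one sign for all coordinates of the root.\<close>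

lemma positive_uminus_iff:
  assumes "\<gamma> \<in> roots"
  shows "positive (- \<gamma>) \<longleftrightarrow> \<not> positive \<gamma>"
proof -
  obtain v s where v: "v \<in> carrier W" "s \<in> I" "\<gamma> = act v (simple_root s)"
    using assms unfolding roots_def by blast
  have "len (v \<otimes> s) \<noteq> len v"
    using len_mult_simple[OF v(1,2)] by auto
  then show ?thesis
    using positive_act_simple_root_iff[OF v(1,2)] v(3) by auto
qed

lemma positive_simple_root [simp]: "positive (simple_root s)"
  by (simp add: positive_def simple_root_def)

lemma left_descent_iff:
  assumes "w \<in> carrier W" "s \<in> I"
  shows "len (s \<otimes> w) < len w \<longleftrightarrow> \<not> positive (act (inv w) (simple_root s))"
proof -
  have "len (inv w \<otimes> s) = len (s \<otimes> w)"
    using len_inv[of "s \<otimes> w"] assms by (simp add: inv_mult_group)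
  then show ?thesis
    using positive_act_simple_root_iff(1)[of "inv w" s] len_simple_mult[OF assms] assms by auto
qed

section \<open>Inversions and the length function\<close>

definition bilinear_form :: "('a \<Rightarrow> real) \<Rightarrow> ('a \<Rightarrow> real) \<Rightarrow> real"
  where "bilinear_form u v = (\<Sum>s\<in>I. v s * pairing u s)"

lemma bilinear_form_reflect:
  assumes "s \<in> I"
  shows "bilinear_form (reflect s u) (reflect s v) = bilinear_form u v"
proof -
  have sym: "(\<Sum>t\<in>I. v t * coxeter_form s t) = pairing v s"
    unfolding pairing_def using assms by (intro sum.cong) (auto simp: coxeter_form_commute)
  have "bilinear_form (reflect s u) (reflect s v) =
      (\<Sum>t\<in>I. v t * pairing (reflect s u) t - (if t = s then 2 * pairing v s * pairing (reflect s u) s else 0))"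
    unfolding bilinear_form_def by (rule sum.cong) (auto simp: reflect_def[of s v] algebra_simps)
  also have "\<dots> = (\<Sum>t\<in>I. v t * pairing (reflect s u) t) + 2 * pairing v s * pairing u s"
    using assms finite_I by (simp add: sum_subtractf pairing_reflect)
  also have "(\<Sum>t\<in>I. v t * pairing (reflect s u) t) =
      (\<Sum>t\<in>I. v t * pairing u t) - 2 * pairing u s * (\<Sum>t\<in>I. v t * coxeter_form s t)"
    using assms by (simp add: pairing_reflect right_diff_distrib sum_subtractf sum_distrib_left
        mult.assoc mult.left_commute)
  finally show ?thesis
    by (simp add: sym bilinear_form_def)
qed

text \<open>The form is invariant and simple roots have norm 1. This serves
  \<open>positive_reflect\<close>, where a root proportional to a simple root has to be that root up
  to sign.\<close>

lemma bilinear_form_root: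
  assumes "\<gamma> \<in> roots"
  shows "bilinear_form \<gamma> \<gamma> = 1"
proof -
  obtain v s where v: "v \<in> carrier W" "s \<in> I" "\<gamma> = act v (simple_root s)"
    using assms unfolding roots_def by blast
  obtain u where u: "u \<in> lists I" "mprod W u = v"
    using word_exists v by blast
  have "bilinear_form (simple_root s) (simple_root s) = 1"
    using v(2) finite_I
    by (simp add: bilinear_form_def simple_root_def[of s] if_distrib[of "\<lambda>x. x * _"] cong: if_cong)
      (simp add: simple_root_def[symmetric])
  moreover from u(1) have "bilinear_form (foldr reflect u f) (foldr reflect u f) = bilinear_form f f" for f
    by (induction u) (auto simp: bilinear_form_reflect)
  ultimately show ?thesis
    using v(3) u act_mprod[OF u(1)] by simp
qed

text \<open>A reflection changes only the coordinate at \<open>s\<close>. If it made the root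
  negative, all other coordinates would vanish, and the norm would force the root to be
  \<open>simple_root s\<close>.\<close>

lemma positive_reflect:
  assumes "s \<in> I" "\<gamma> \<in> roots" "positive \<gamma>" "\<gamma> \<noteq> simple_root s"
  shows "positive (reflect s \<gamma>)"
proof (rule ccontr)
  assume neg: "\<not> positive (reflect s \<gamma>)"
  have r: "reflect s \<gamma> \<in> roots"
    using act_in_roots[of \<gamma> s] assms act_simple[of s] by simp
  have le: "reflect s \<gamma> x \<le> 0" for x
    using neg positive_uminus_iff[OF r] by (simp add: positive_def)
  have zero: "\<gamma> x = 0" if "x \<noteq> s" for x
    using le[of x] assms(3) that by (simp add: reflect_def positive_def order.antisym)
  have \<gamma>: "\<gamma> = (\<lambda>x. \<gamma> s * simple_root s x + 0 * simple_root s x)"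
    using zero by (auto simp: simple_root_def)
  have "\<gamma> s * \<gamma> s = 1"
  proof -
    have "bilinear_form \<gamma> \<gamma> = \<gamma> s * pairing \<gamma> s"
      unfolding bilinear_form_def
      using zero assms(1) finite_I by (subst sum.remove[of _ s]) auto
    also have "pairing \<gamma> s = \<gamma> s"
      using assms(1) by (subst \<gamma>, subst pairing_linear) simp
    finally show ?thesis
      using bilinear_form_root[OF assms(2)] by simp
  qed
  then have "\<gamma> s = 1"
    using assms(3) by (auto simp: square_eq_1_iff positive_def dest: spec[of _ s])
  then show False
    using \<gamma> assms(4) by simp
qed

text \<open>Induction over a right descent w = v s: the inversions of \<open>w\<close> are the
  simple root of \<open>s\<close> and the images under \<open>s\<close> of the inversions of
  \<open>v\<close>.\<close>

lemma card_inversions: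
  assumes "w \<in> carrier W"
  shows "card {\<gamma> \<in> roots. positive \<gamma> \<and> \<not> positive (act w \<gamma>)} = len w"
  using assms
proof (induction "len w" arbitrary: w rule: less_induct)
  case less
  show ?case
  proof (cases "w = \<one>")
    case True
    then show ?thesis by simp
  next
    case False
    obtain s where s: "s \<in> I" "Suc (len (w \<otimes> s)) = len w"
      using right_descent_exists[OF less.prems False] .
    define v where "v = w \<otimes> s"
    have v: "v \<in> carrier W" using s less.prems by (simp add: v_def)
    have w: "w = v \<otimes> s" using s less.prems by (simp add: v_def)
    let ?N = "\<lambda>w. {\<gamma> \<in> roots. positive \<gamma> \<and> \<not> positive (act w \<gamma>)}"
    have vs: "positive (act v (simple_root s))"
      using positive_act_simple_root_iff(1)[OF v s(1)] s(2) w[symmetric] by (simp add: v_def[symmetric])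
    have notin: "simple_root s \<notin> ?N v" using vs by simp
    have act_w: "act w \<gamma> = act v (reflect s \<gamma>)" for \<gamma>
      using v s w by (simp add: act_mult act_simple)
    have refl_roots: "reflect s \<gamma> \<in> roots" if "\<gamma> \<in> roots" for \<gamma>
      using act_in_roots[OF that, of s] act_simple[of s] s by simp
    have "?N w = insert (simple_root s) (reflect s ` ?N v)"
    proof (intro equalityI subsetI)
      fix \<gamma> assume "\<gamma> \<in> ?N w"
      then have \<gamma>: "\<gamma> \<in> roots" "positive \<gamma>" "\<not> positive (act v (reflect s \<gamma>))"
        by (auto simp: act_w)
      show "\<gamma> \<in> insert (simple_root s) (reflect s ` ?N v)"
      proof (cases "\<gamma> = simple_root s")
        case False
        then have "reflect s \<gamma> \<in> ?N v"
          using \<gamma> positive_reflect[OF s(1)] refl_roots by auto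
        moreover have "\<gamma> = reflect s (reflect s \<gamma>)"
          using s by simp
        ultimately show ?thesis by blast
      qed simp
    next
      fix \<gamma> assume "\<gamma> \<in> insert (simple_root s) (reflect s ` ?N v)"
      then consider "\<gamma> = simple_root s" | \<delta> where "\<delta> \<in> ?N v" "\<gamma> = reflect s \<delta>"
        by blast
      then show "\<gamma> \<in> ?N w"
      proof cases
        case 1
        have "act w \<gamma> = - act v (simple_root s)"
          using 1 s act_uminus[of v "simple_root s"]
          by (simp add: act_w reflect_simple_root fun_Compl_def)
        then show ?thesis
          using 1 s v vs positive_uminus_iff[of "act v (simple_root s)"] by simp
      next
        case 2
        then have "\<delta> \<noteq> simple_root s" using notin by auto
        then show ?thesis
          using 2 s positive_reflect[OF s(1)] refl_roots by (auto simp: act_w)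
      qed
    qed
    moreover have "simple_root s \<notin> reflect s ` ?N v"
    proof
      assume "simple_root s \<in> reflect s ` ?N v"
      then obtain \<delta> where "positive \<delta>" "\<delta> \<in> roots" "simple_root s = reflect s \<delta>" by blast
      then have "\<delta> = - simple_root s"
        using s reflect_simple_root[of s] reflect_reflect[of s \<delta>] by (simp add: fun_Compl_def)
      then show False
        using positive_uminus_iff[of "simple_root s"] \<open>positive \<delta>\<close> s by simp
    qed
    moreover have "inj_on (reflect s) (?N v)"
      by (rule inj_on_inverseI[of _ "reflect s"]) (use s in simp)
    ultimately have "card (?N w) = Suc (card (?N v))"
      by (simp add: card_image)
    then show ?thesis
      using less.hyps[of v] v s by (simp add: v_def)
  qed
qed

text \<open>An element x stands for the chamber obtained by applying x to the fundamental one; a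
  root is positive there iff its image under \<open>inv x\<close> is positive. Each separating
  hyperplane is represented by that one of its two roots which is positive at x.\<close>

definition separating :: "'a \<Rightarrow> 'a \<Rightarrow> ('a \<Rightarrow> real) set"
  where "separating x y =
    {\<gamma> \<in> roots. positive (act (inv x) \<gamma>) \<and> \<not> positive (act (inv y) \<gamma>)}"

lemma card_separating:
  assumes "x \<in> carrier W" "y \<in> carrier W"
  shows "card (separating x y) = len (inv x \<otimes> y)"
proof -
  let ?z = "inv y \<otimes> x"
  have "separating x y = act x ` {\<gamma> \<in> roots. positive \<gamma> \<and> \<not> positive (act ?z \<gamma>)}"
  proof (intro equalityI subsetI)
    fix \<gamma> assume "\<gamma> \<in> separating x y"
    then have "act (inv x) \<gamma> \<in> {\<gamma> \<in> roots. positive \<gamma> \<and> \<not> positive (act ?z \<gamma>)}"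
      using assms by (simp add: separating_def act_mult)
    moreover have "\<gamma> = act x (act (inv x) \<gamma>)" using assms by simp
    ultimately show "\<gamma> \<in> act x ` {\<gamma> \<in> roots. positive \<gamma> \<and> \<not> positive (act ?z \<gamma>)}" by blast
  qed (use assms in \<open>auto simp: separating_def act_mult\<close>)
  moreover have "inj_on (act x) A" for A
    by (rule inj_on_inverseI[of _ "act (inv x)"]) (use assms in simp)
  ultimately have "card (separating x y) = len ?z"
    using card_inversions[of ?z] assms by (simp add: card_image)
  also have "\<dots> = len (inv x \<otimes> y)"
    using len_inv[of "inv y \<otimes> x"] assms by (simp add: inv_mult_group)
  finally show ?thesis .
qed

lemma finite_separating [simp]: "finite (separating x y)"
  by (simp add: separating_def)

lemma separating_empty:
  assumes "x \<in> carrier W" "y \<in> carrier W" "separating x y = {}"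
  shows "x = y"
proof -
  have "len (inv x \<otimes> y) = 0"
    using card_separating[OF assms(1,2)] assms(3) by simp
  then have "inv x \<otimes> y = \<one>"
    using len_eq_0[of "inv x \<otimes> y"] assms by simp
  then show ?thesis
    using assms by (metis cancel_inv_left r_one)
qed

text \<open>No hyperplane is crossed and crossed back on the way from x over y to z. The hypothesis
  speaks of one pattern of signs; the opposite one follows by passing to the negative root.\<close>

lemma len_additive:
  assumes "x \<in> carrier W" "y \<in> carrier W" "z \<in> carrier W"
    and no: "\<And>\<gamma>. \<lbrakk>\<gamma> \<in> roots; positive (act (inv x) \<gamma>); \<not> positive (act (inv y) \<gamma>);
      positive (act (inv z) \<gamma>)\<rbrakk> \<Longrightarrow> False"
  shows "len (inv x \<otimes> z) = len (inv x \<otimes> y) + len (inv y \<otimes> z)"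
proof -
  have no': False if "\<gamma> \<in> roots" "\<not> positive (act (inv x) \<gamma>)" "positive (act (inv y) \<gamma>)"
      "\<not> positive (act (inv z) \<gamma>)" for \<gamma>
  proof -
    have "positive (act (inv a) (- \<gamma>)) \<longleftrightarrow> \<not> positive (act (inv a) \<gamma>)" if "a \<in> carrier W" for a
      using that \<open>\<gamma> \<in> roots\<close> by (simp add: act_uminus positive_uminus_iff)
    then show False
      using no[of "- \<gamma>"] that assms(1-3) by simp
  qed
  have "separating x z = separating x y \<union> separating y z"
    unfolding separating_def using no no' by blast
  moreover have "separating x y \<inter> separating y z = {}"
    unfolding separating_def by blast
  ultimately have "card (separating x z) = card (separating x y) + card (separating y z)"
    by (simp add: card_Un_disjoint)
  then show ?thesis
    using assms(1-3) by (simp add: card_separating)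
qed

text \<open>Take the chamber with the fewest positive roots violating \<open>P\<close>. A violating
  simple root could be reflected away, which would lower the count, so \<open>P\<close> holds on the
  simple roots and, by the convexity hypothesis, on all positive ones. No vector realising the signs
  is required.\<close>

lemma chamber_exists:
  assumes odd: "\<And>\<gamma>. \<gamma> \<in> roots \<Longrightarrow> P (- \<gamma>) \<longleftrightarrow> \<not> P \<gamma>"
    and conv: "\<And>w \<gamma>. \<lbrakk>w \<in> carrier W; \<And>s. s \<in> I \<Longrightarrow> P (act w (simple_root s)); \<gamma> \<in> roots; positive \<gamma>\<rbrakk>
      \<Longrightarrow> P (act w \<gamma>)"
  shows "\<exists>x\<in>carrier W. \<forall>\<gamma>\<in>roots. P \<gamma> \<longleftrightarrow> positive (act (inv x) \<gamma>)"
proof -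
  define B where "B w = {\<gamma> \<in> roots. positive \<gamma> \<and> \<not> P (act w \<gamma>)}" for w
  have fin: "finite (B w)" for w by (simp add: B_def)
  define x where "x = arg_min (\<lambda>w. card (B w)) (\<lambda>w. w \<in> carrier W)"
  have x: "x \<in> carrier W" and x_min: "\<And>w. w \<in> carrier W \<Longrightarrow> card (B x) \<le> card (B w)"
    using arg_min_nat_lemma[of "\<lambda>w. w \<in> carrier W" \<one> "\<lambda>w. card (B w)"] unfolding x_def by auto
  have simple: "P (act x (simple_root s))" if s: "s \<in> I" for s
  proof (rule ccontr)
    assume neg: "\<not> P (act x (simple_root s))"
    have "B (x \<otimes> s) \<subseteq> reflect s ` (B x - {simple_root s})"
    proof
      fix \<gamma> assume "\<gamma> \<in> B (x \<otimes> s)"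
      then have \<gamma>: "\<gamma> \<in> roots" "positive \<gamma>" "\<not> P (act x (reflect s \<gamma>))"
        using x s by (auto simp: B_def act_mult act_simple)
      have ne: "\<gamma> \<noteq> simple_root s"
      proof
        assume "\<gamma> = simple_root s"
        then have "act x (reflect s \<gamma>) = - act x (simple_root s)"
          using s act_uminus[of x "simple_root s"] by (simp add: reflect_simple_root fun_Compl_def)
        then show False
          using \<gamma>(3) neg odd[of "act x (simple_root s)"] x s by simp
      qed
      have "reflect s \<gamma> \<in> roots"
        using act_in_roots[OF \<gamma>(1), of s] act_simple[of s] s by simp
      moreover have "reflect s \<gamma> \<noteq> simple_root s"
      proof
        assume "reflect s \<gamma> = simple_root s"
        then have "\<gamma> = - simple_root s"
          using s reflect_simple_root[of s] reflect_reflect[of s \<gamma>] by (simp add: fun_Compl_def)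
        then show False
          using positive_uminus_iff[of "simple_root s"] \<gamma> s by simp
      qed
      ultimately have "reflect s \<gamma> \<in> B x - {simple_root s}"
        using \<gamma> ne positive_reflect[OF s \<gamma>(1,2)] by (simp add: B_def)
      moreover have "\<gamma> = reflect s (reflect s \<gamma>)" using s by simp
      ultimately show "\<gamma> \<in> reflect s ` (B x - {simple_root s})" by blast
    qed
    then have "card (B (x \<otimes> s)) \<le> card (B x - {simple_root s})"
      using fin by (meson card_image_le card_mono finite_Diff finite_imageI order_trans)
    also have "\<dots> < card (B x)"
      by (rule card_Diff1_less[OF fin]) (use neg s in \<open>simp add: B_def\<close>)
    finally show False
      using x_min[of "x \<otimes> s"] x s by simp
  qed
  have pos: "P (act x \<gamma>)" if "\<gamma> \<in> roots" "positive \<gamma>" for \<gamma>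
    using conv[OF x simple that] by simp
  have "P \<gamma> \<longleftrightarrow> positive (act (inv x) \<gamma>)" if \<gamma>: "\<gamma> \<in> roots" for \<gamma>
  proof
    assume "positive (act (inv x) \<gamma>)"
    then show "P \<gamma>" using pos[of "act (inv x) \<gamma>"] x \<gamma> by simp
  next
    assume "P \<gamma>"
    show "positive (act (inv x) \<gamma>)"
    proof (rule ccontr)
      assume "\<not> positive (act (inv x) \<gamma>)"
      then have "positive (act (inv x) (- \<gamma>))"
        using x \<gamma> positive_uminus_iff[of "act (inv x) \<gamma>"] by (simp add: act_uminus)
      then have "P (- \<gamma>)"
        using pos[of "act (inv x) (- \<gamma>)"] x \<gamma> by simp
      then show False using odd \<open>P \<gamma>\<close> \<gamma> by simp
    qed
  qed
  then show ?thesis using x by blast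
qed

section \<open>The lift to the braid monoid\<close>

abbreviation braid_cong :: "'a list \<Rightarrow> 'a list \<Rightarrow> bool"
  where "braid_cong \<equiv> word_cong I (braid_relations W I)"

abbreviation braid_class :: "'a list \<Rightarrow> 'a list set"
  where "braid_class \<equiv> word_class I (braid_relations W I)"

lemma braid_cong_length: "braid_cong u v \<Longrightarrow> length u = length v"
  by (induction rule: word_cong.induct) (auto simp: braid_relations_def)

lemma braid_cong_mprod: "braid_cong u v \<Longrightarrow> mprod W u = mprod W v"
proof (induction rule: word_cong.induct)
  case (rel u v)
  then obtain s t where "s \<in> I" "t \<in> I"
    "u = alt_word s t (ord (s \<otimes> t))" "v = alt_word t s (ord (s \<otimes> t))"
    by (auto simp: braid_relations_def)
  then show ?case using mprod_alt_word_commute by simp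
next
  case (append u u' v v')
  then show ?case using word_cong_lists by (metis mprod_lists_append)
qed auto

lemma rev_alt_word: "rev (alt_word s t k) = (if even k then alt_word t s k else alt_word s t k)"
  by (rule nth_equalityI) (auto simp: alt_word_def rev_nth)

text \<open>After stripping k alternating letters, the simple root of the next letter is carried to
  a non-negative combination of the roots of \<open>s\<close> and \<open>t\<close>, as k < n. Both
  are made negative by \<open>inv w\<close>, so the next letter is again a left descent of what
  remains.\<close>

lemma common_descents_alt_word:
  assumes w: "w \<in> carrier W" and st: "s \<in> I" "t \<in> I" "s \<noteq> t"
    and desc: "len (s \<otimes> w) < len w" "len (t \<otimes> w) < len w"
    and k: "k \<le> ord (s \<otimes> t)"
  shows "\<exists>v\<in>lists I. length (alt_word s t k @ v) = len w \<and> mprod W (alt_word s t k @ v) = w"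
  using k
proof (induction k)
  case 0
  obtain u where "u \<in> lists I" "length u = len w" "mprod W u = w"
    by (rule reduced_word[OF w])
  then show ?case by (intro bexI[of _ u]) auto
next
  case (Suc k)
  define n where "n = ord (s \<otimes> t)"
  have n2: "n \<ge> 2" using order_ge_2[OF st] by (simp add: n_def)
  obtain v where v: "v \<in> lists I" "k + length v = len w" "mprod W (alt_word s t k @ v) = w"
    using Suc by auto
  define x y where "x = (if even k then s else t)" and "y = (if even k then t else s)"
  have xy: "x \<in> I" "y \<in> I" "x \<noteq> y" "ord (x \<otimes> y) = n"
    using st order_commute[OF st(2,1)] by (cases "even k"; simp add: x_def y_def n_def)+
  have alt: "alt_word s t k \<in> lists I" by (rule alt_word_in_lists[OF st(1,2)])
  define w' where "w' = mprod W v"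
  define a where "a = mprod W (alt_word s t k)"
  have w' [simp]: "w' \<in> carrier W" and a [simp]: "a \<in> carrier W"
    using v alt by (simp_all only: w'_def a_def mprod_lists_closed)
  have wa: "w = a \<otimes> w'"
    using v alt mprod_lists_append[of "alt_word s t k" v] by (simp only: w'_def a_def)
  then have "inv w' = inv w \<otimes> a"
    by (simp add: inv_mult_group m_assoc)
  then have "act (inv w') (simple_root x) = act (inv w) (act a (simple_root x))"
    using w by (simp add: act_mult)
  also have "act a (simple_root x) = fold reflect (alt_word y x k) (simple_root x)"
    unfolding a_def act_mprod[OF alt] foldr_conv_fold rev_alt_word by (simp add: x_def y_def)
  finally have eq: "act (inv w') (simple_root x) =
      act (inv w) (fold reflect (alt_word y x k) (simple_root x))" .
  have neg: "act (inv w) (simple_root r) z \<le> 0" if "r = s \<or> r = t" for r z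
    using that left_descent_iff[OF w, of r] desc st positive_uminus_iff[of "act (inv w) (simple_root r)"] w
    by (auto simp: positive_def)
  have le: "act (inv w') (simple_root x) z \<le> 0" for z
  proof -
    have "act (inv w) (simple_root x) z \<le> 0" "act (inv w) (simple_root y) z \<le> 0"
      using neg by (auto simp: x_def y_def)
    moreover have "dihedral_coeff n k \<ge> 0" "dihedral_coeff n (Suc k) \<ge> 0"
      using dihedral_coeff_nonneg[OF n2] Suc.prems by (auto simp: n_def)
    ultimately show ?thesis
      unfolding eq fold_reflect_alt_word[OF xy(1,2,3)] act_linear xy(4)
      by (auto simp: mult_nonneg_nonpos intro: add_nonpos_nonpos)
  qed
  have "positive (- act (inv w') (simple_root x))"
    using le by (simp add: positive_def)
  then have "len (x \<otimes> w') < len w'"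
    using positive_uminus_iff[of "act (inv w') (simple_root x)"] left_descent_iff[OF w' xy(1)] xy by simp
  moreover have "len w' \<le> length v" using len_le[OF v(1)] by (simp add: w'_def)
  moreover have "len w \<le> k + len w'"
    using len_mult[OF a w'] len_le[OF alt] by (simp add: a_def wa)
  ultimately have lv: "Suc (len (x \<otimes> w')) = length v"
    using v(2) len_simple_mult[OF w' xy(1)] by auto
  obtain v' where v': "v' \<in> lists I" "length v' = len (x \<otimes> w')" "mprod W v' = x \<otimes> w'"
    by (rule reduced_word[of "x \<otimes> w'"]) (use xy in auto)
  have altS: "alt_word s t (Suc k) = alt_word s t k @ [x]"
    by (simp add: alt_word_Suc x_def)
  have "mprod W (alt_word s t k @ ([x] @ v')) = w"
    using mprod_lists_append[OF alt, of "[x] @ v'"] v' xy by (simp add: a_def[symmetric] wa)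
  then show ?case
    using v' lv v(2) by (intro bexI[of _ v']) (simp_all add: altS)
qed

lemma reduced_tail:
  assumes "s \<in> I" "u \<in> lists I" "Suc (length u) = len (s \<otimes> mprod W u)"
  shows "length u = len (mprod W u)"
  using len_le[OF assms(2)] len_simple_mult[of "mprod W u" s] assms by simp

text \<open>Equal first letters are cancelled. Different ones are both descents, so the element also
  has reduced words beginning with the two sides of the braid relation and sharing one tail; each
  given word is linked to one of these by the induction hypothesis for the shorter tails.\<close>

lemma matsumoto:
  assumes "u \<in> lists I" "v \<in> lists I" "mprod W u = mprod W v"
    "length u = len (mprod W u)" "length v = len (mprod W v)"
  shows "braid_cong u v"
  using assms
proof (induction "length u" arbitrary: u v rule: less_induct)
  case less
  have len_eq: "length v = length u" using less.prems by simp
  show ?case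
  proof (cases u)
    case Nil
    then show ?thesis using len_eq by (simp add: word_cong.refl)
  next
    case (Cons s u')
    then obtain t v' where v: "v = t # v'" using len_eq by (cases v) auto
    have I: "s \<in> I" "t \<in> I" "u' \<in> lists I" "v' \<in> lists I"
      using less.prems Cons v by auto
    define w where "w = mprod W u"
    have wu: "w = s \<otimes> mprod W u'" using Cons by (simp add: w_def)
    have wv: "w = t \<otimes> mprod W v'" using v less.prems(3) by (simp add: w_def)
    have w: "w \<in> carrier W" using less.prems by (simp add: w_def)
    have lu: "Suc (length u') = len w" using less.prems(4) Cons by (simp add: w_def)
    have lv: "Suc (length v') = len w" using lu len_eq Cons v by simp
    have ru: "length u' = len (mprod W u')" and rv: "length v' = len (mprod W v')"
      using reduced_tail I lu lv wu wv by metis+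
    have Cons_cong: "braid_cong (r # a) (r # b)" if "braid_cong a b" "r \<in> I" for r a b
      using word_cong.append[OF word_cong.refl[of "[r]"] that(1)] that(2) by simp
    show ?thesis
    proof (cases "s = t")
      case True
      then have "mprod W u' = mprod W v'"
        using wu wv I by (metis simple_cancel_left mprod_lists_closed)
      then have "braid_cong u' v'"
        using less.hyps[of u' v'] I ru rv Cons by simp
      then show ?thesis using Cons_cong Cons v True I by simp
    next
      case False
      define n where "n = ord (s \<otimes> t)"
      have "n \<ge> 2" using order_ge_2[OF I(1,2) False] by (simp add: n_def)
      then obtain n' where n': "n = Suc n'" by (cases n) auto
      have "s \<otimes> w = mprod W u'"
        unfolding wu using I by simp
      moreover have "t \<otimes> w = mprod W v'"
        unfolding wv using I by simp
      ultimately have desc: "len (s \<otimes> w) < len w" "len (t \<otimes> w) < len w"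
        using ru rv lu lv by simp_all
      obtain a where a: "a \<in> lists I" "length (alt_word s t n @ a) = len w"
          "mprod W (alt_word s t n @ a) = w"
        using common_descents_alt_word[OF w I(1,2) False desc, of n] n_def by auto
      have alts: "alt_word s t k \<in> lists I" "alt_word t s k \<in> lists I" for k
        by (rule alt_word_in_lists[OF I(1,2)], rule alt_word_in_lists[OF I(2,1)])
      have a': "mprod W (alt_word t s n @ a) = w"
        using a(3) mprod_lists_append[OF alts(1) a(1)] mprod_lists_append[OF alts(2) a(1)]
          mprod_alt_word_commute[OF I(1,2)] by (simp add: n_def)
      have one: "braid_cong (r # b) (alt_word r q n @ a)"
        if "r \<in> I" "q \<in> I" "b \<in> lists I" "w = r \<otimes> mprod W b" "length b = len (mprod W b)"
          "Suc (length b) = len w" "mprod W (alt_word r q n @ a) = w" "alt_word q r n' \<in> lists I"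
        for r q b
      proof -
        let ?c = "alt_word q r n' @ a"
        have c: "alt_word r q n @ a = r # ?c" "?c \<in> lists I"
          using that a by (simp_all add: n' alt_word_Suc')
        have "r \<otimes> mprod W ?c = r \<otimes> mprod W b"
          using that c by simp
        then have eq: "mprod W ?c = mprod W b"
          using that(1,3) c(2) by (metis simple_cancel_left mprod_lists_closed)
        have "length ?c = length b"
          using that(6) a(2) by (simp add: n')
        moreover have "length b < length u"
          using that(6) lu Cons by simp
        ultimately have "braid_cong b ?c"
          using less.hyps[OF _ that(3) c(2) eq[symmetric] that(5)] that(5) eq by presburger
        then show ?thesis unfolding c(1) using that(1) by (rule Cons_cong)
      qed
      have "braid_cong u (alt_word s t n @ a)"
        unfolding Cons by (rule one[OF I(1,2,3) wu ru lu a(3) alts(2)])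
      moreover have "braid_cong v (alt_word t s n @ a)"
        unfolding v by (rule one[OF I(2,1,4) wv rv lv a' alts(1)])
      moreover have "braid_cong (alt_word s t n @ a) (alt_word t s n @ a)"
      proof (rule word_cong.append[OF word_cong.rel word_cong.refl])
        show "(alt_word s t n, alt_word t s n) \<in> braid_relations W I"
          using I by (auto simp: braid_relations_def n_def)
      qed (use alts a in simp_all)
      ultimately show ?thesis
        by (meson word_cong.sym word_cong.trans)
    qed
  qed
qed

lemma braid_class_eq_length:
  assumes "u \<in> lists I" "braid_class u = braid_class v"
  shows "length u = length v"
  using assms word_class_eq_iff braid_cong_length by metis

lemma braid_class_mult:
  "\<lbrakk>u \<in> lists I; v \<in> lists I\<rbrakk> \<Longrightarrow>
    braid_class u \<otimes>\<^bsub>braid_monoid\<^esub> braid_class v = braid_class (u @ v)"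
  unfolding braid_monoid_def by (rule presented_monoid_mult)

lemma carrier_braid_monoid: "carrier braid_monoid = braid_class ` lists I"
  by (simp add: braid_monoid_def presented_monoid_def)

lemma one_braid_monoid: "\<one>\<^bsub>braid_monoid\<^esub> = braid_class []"
  by (simp add: braid_monoid_def presented_monoid_def)

lemma monoid_braid_monoid: "monoid braid_monoid"
  unfolding braid_monoid_def by (rule monoid_presented_monoid)

text \<open>The witness for the description in \<open>lift\<close>; by \<open>matsumoto\<close> its
  value does not depend on the reduced word chosen.\<close>

definition reduced_class :: "'a \<Rightarrow> 'a list set"
  where "reduced_class =
    (\<lambda>w\<in>carrier W. braid_class (SOME u. u \<in> lists I \<and> length u = len w \<and> mprod W u = w))"

lemma reduced_class_mprod:
  assumes "u \<in> lists I" "length u = len (mprod W u)"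
  shows "reduced_class (mprod W u) = braid_class u"
proof -
  define v where "v = (SOME v. v \<in> lists I \<and> length v = len (mprod W u) \<and> mprod W v = mprod W u)"
  have v: "v \<in> lists I \<and> length v = len (mprod W u) \<and> mprod W v = mprod W u"
    unfolding v_def by (rule someI[of _ u]) (use assms in simp)
  then have "braid_cong v u"
    using matsumoto[of v u] assms by simp
  moreover have "reduced_class (mprod W u) = braid_class v"
    unfolding reduced_class_def v_def using mprod_lists_closed[OF assms(1)] by simp
  ultimately show ?thesis
    using v word_class_eq_iff[of v I "braid_relations W I" u] by simp
qed

lemma len_simple [simp]: "s \<in> I \<Longrightarrow> len s = 1"
  using len_mult_simple[of \<one> s] by simp

lemma is_lift_reduced_class: "is_lift reduced_class"
  unfolding is_lift_def
proof (intro conjI ballI impI)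
  show "reduced_class \<in> carrier W \<rightarrow>\<^sub>E carrier braid_monoid"
  proof (rule PiE_I)
    fix w assume "w \<in> carrier W"
    then obtain u where "u \<in> lists I" "length u = len w" "mprod W u = w"
      by (rule reduced_word)
    then show "reduced_class w \<in> carrier braid_monoid"
      using reduced_class_mprod[of u] carrier_braid_monoid by auto
  qed (simp add: reduced_class_def)
  show "inj_on reduced_class (carrier W)"
  proof (rule inj_onI)
    fix x y assume "x \<in> carrier W" "y \<in> carrier W" "reduced_class x = reduced_class y"
    moreover obtain u where "u \<in> lists I" "length u = len x" "mprod W u = x"
      by (rule reduced_word[OF \<open>x \<in> carrier W\<close>])
    moreover obtain v where "v \<in> lists I" "length v = len y" "mprod W v = y"
      by (rule reduced_word[OF \<open>y \<in> carrier W\<close>])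
    ultimately show "x = y"
      using reduced_class_mprod[of u] reduced_class_mprod[of v] braid_cong_mprod[of u v]
        word_class_eq_iff[of u I "braid_relations W I" v] by metis
  qed
next
  fix s assume "s \<in> I"
  then show "reduced_class s = braid_gen s"
    using reduced_class_mprod[of "[s]"] by (simp add: braid_gen_def)
next
  fix x y assume xy: "x \<in> carrier W" "y \<in> carrier W" "len (x \<otimes> y) = len x + len y"
  obtain u where u: "u \<in> lists I" "length u = len x" "mprod W u = x"
    by (rule reduced_word[OF xy(1)])
  obtain v where v: "v \<in> lists I" "length v = len y" "mprod W v = y"
    by (rule reduced_word[OF xy(2)])
  have uv: "u @ v \<in> lists I" "mprod W (u @ v) = x \<otimes> y"
    using u v mprod_lists_append by auto
  then show "reduced_class (x \<otimes> y) = reduced_class x \<otimes>\<^bsub>braid_monoid\<^esub> reduced_class y"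
    using reduced_class_mprod[of u] reduced_class_mprod[of v] reduced_class_mprod[of "u @ v"]
      u v xy braid_class_mult[of u v] by simp
qed

lemma lift_eq_reduced_class: "lift = reduced_class"
  unfolding lift_def
proof (rule the_equality[where P = is_lift])
  show "is_lift reduced_class" by (rule is_lift_reduced_class)
next
  fix f assume f: "is_lift f"
  then have f_closed: "f w \<in> carrier braid_monoid" if "w \<in> carrier W" for w
    using that unfolding is_lift_def by (metis PiE_mem)
  have f_mult: "f (x \<otimes> y) = f x \<otimes>\<^bsub>braid_monoid\<^esub> f y"
    if "x \<in> carrier W" "y \<in> carrier W" "len (x \<otimes> y) = len x + len y" for x y
    using f that unfolding is_lift_def by blast
  have f_gen: "f s = braid_class [s]" if "s \<in> I" for s
    using f that unfolding is_lift_def braid_gen_def by blast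
  have f_one: "f \<one> = braid_class []"
  proof -
    obtain u where u: "u \<in> lists I" "f \<one> = braid_class u"
      using f_closed[of \<one>] by (auto simp: carrier_braid_monoid)
    have "braid_class u = braid_class (u @ u)"
      using f_mult[of \<one> \<one>] u braid_class_mult[of u u] by simp
    then show ?thesis
      using braid_class_eq_length[OF u(1)] u by fastforce
  qed
  have f_red: "f (mprod W u) = braid_class u" if "u \<in> lists I" "length u = len (mprod W u)" for u
    using that
  proof (induction u)
    case Nil
    then show ?case using f_one by simp
  next
    case (Cons s u)
    then have s: "s \<in> I" "u \<in> lists I" by auto
    have red: "length u = len (mprod W u)"
      using reduced_tail[of s u] s Cons.prems by simp
    have "f (s \<otimes> mprod W u) = f s \<otimes>\<^bsub>braid_monoid\<^esub> f (mprod W u)"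
      using f_mult[of s "mprod W u"] s Cons.prems red by simp
    then show ?case
      using Cons.IH s red f_gen braid_class_mult[of "[s]" u] by simp
  qed
  show "f = reduced_class"
  proof
    fix w
    show "f w = reduced_class w"
    proof (cases "w \<in> carrier W")
      case True
      then obtain u where "u \<in> lists I" "length u = len w" "mprod W u = w"
        by (rule reduced_word)
      then show ?thesis
        using f_red[of u] reduced_class_mprod[of u] by simp
    next
      case False
      then show ?thesis
        using f PiE_arb[of f "carrier W" "\<lambda>_. carrier braid_monoid" w]
        unfolding is_lift_def by (simp add: reduced_class_def)
    qed
  qed
qed

lemma is_lift_lift: "is_lift lift"
  using is_lift_reduced_class lift_eq_reduced_class by simp

lemma lift_mprod: "\<lbrakk>u \<in> lists I; length u = len (mprod W u)\<rbrakk> \<Longrightarrow> lift (mprod W u) = braid_class u"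
  using reduced_class_mprod lift_eq_reduced_class by simp

lemma lift_closed [simp]: "w \<in> carrier W \<Longrightarrow> lift w \<in> carrier braid_monoid"
  using is_lift_lift unfolding is_lift_def by (metis PiE_mem)

lemma lift_one: "lift \<one> = \<one>\<^bsub>braid_monoid\<^esub>"
  using lift_mprod[of "[]"] by (simp add: one_braid_monoid)

lemma lift_mult:
  "\<lbrakk>x \<in> carrier W; y \<in> carrier W; len (x \<otimes> y) = len x + len y\<rbrakk> \<Longrightarrow>
    lift (x \<otimes> y) = lift x \<otimes>\<^bsub>braid_monoid\<^esub> lift y"
  using is_lift_lift unfolding is_lift_def by blast

text \<open>The lift of \<open>inv x \<otimes> y\<close> is the braid element of a minimal gallery
  from x to y. Two of them compose to a minimal gallery when no hyperplane is crossed twice.\<close>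

lemma lift_merge:
  assumes "x \<in> carrier W" "y \<in> carrier W" "z \<in> carrier W"
    and "\<And>\<gamma>. \<lbrakk>\<gamma> \<in> roots; positive (act (inv x) \<gamma>); \<not> positive (act (inv y) \<gamma>);
      positive (act (inv z) \<gamma>)\<rbrakk> \<Longrightarrow> False"
  shows "lift (inv x \<otimes> y) \<otimes>\<^bsub>braid_monoid\<^esub> lift (inv y \<otimes> z) = lift (inv x \<otimes> z)"
proof -
  have eq: "inv x \<otimes> y \<otimes> (inv y \<otimes> z) = inv x \<otimes> z"
    using assms(1-3) by (simp add: m_assoc)
  have "len (inv x \<otimes> z) = len (inv x \<otimes> y) + len (inv y \<otimes> z)"
    by (rule len_additive[OF assms])
  then show ?thesis
    using lift_mult[of "inv x \<otimes> y" "inv y \<otimes> z"] assms(1-3) eq by simp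
qed

lemma mprod_lift_word:
  assumes "set ws \<subseteq> carrier W"
  shows "\<exists>u\<in>lists I. mprod braid_monoid (map lift ws) = braid_class u \<and> length u = sum_list (map len ws)"
  using assms
proof (induction ws)
  case Nil
  show ?case by (rule bexI[of _ "[]"]) (simp_all add: one_braid_monoid)
next
  case (Cons w ws)
  then obtain v where v: "v \<in> lists I" "mprod braid_monoid (map lift ws) = braid_class v"
      "length v = sum_list (map len ws)"
    by auto
  obtain u where u: "u \<in> lists I" "length u = len w" "mprod W u = w"
    by (rule reduced_word[of w]) (use Cons.prems in auto)
  have "lift w = braid_class u" using lift_mprod[of u] u by simp
  then show ?case
    using braid_class_mult[of u v] u v by (intro bexI[of _ "u @ v"]) simp_all
qed

text \<open>Braid relations preserve the length of words, so equations between lifts can be read as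
  equations between lengths. This is how the length of the good element is computed.\<close>

lemma mprod_lift_eq_length:
  assumes "set ws \<subseteq> carrier W" "set vs \<subseteq> carrier W"
    "mprod braid_monoid (map lift ws) = mprod braid_monoid (map lift vs)"
  shows "sum_list (map len ws) = sum_list (map len vs)"
  using mprod_lift_word[OF assms(1)] mprod_lift_word[OF assms(2)] assms(3) braid_class_eq_length
  by metis

lemma longest_eqI:
  assumes "x \<in> generate W K" "\<And>y. y \<in> generate W K \<Longrightarrow> y \<noteq> x \<Longrightarrow> len y < len x"
  shows "longest K = x"
  unfolding longest_def
proof (rule the_equality)
  show "is_arg_max len (\<lambda>v. v \<in> generate W K) x"
    using assms unfolding is_arg_max_def by (metis order_less_asym order_less_irrefl)
next
  fix y assume "is_arg_max len (\<lambda>v. v \<in> generate W K) y"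
  then show "y = x"
    using assms unfolding is_arg_max_def by metis
qed

end

section \<open>Sign changes of periodic sequences\<close>

text \<open>In the range 0, ..., d the factor for k has its only sign change at k + 1/2, so the
  product changes sign exactly between k and k + 1 for the k in P. In terms of the angle pi / d it
  has degree \<open>card P\<close>.\<close>

definition sine_prod :: "nat \<Rightarrow> nat set \<Rightarrow> nat \<Rightarrow> real"
  where "sine_prod d P t = (\<Prod>k\<in>P. sin (pi * (real t - real k - 1/2) / real d))"

text \<open>The product-to-sum formula trades a factor for a shift of \<open>b\<close> by 1 in
  either direction. The parity condition makes every final frequency b = 2 c even, so that only full
  frequencies of absolute value below j remain.\<close>

lemma sine_prod_orthogonal:
  fixes f :: "nat \<Rightarrow> real"
  assumes orth: "\<And>a \<phi>. a < j \<Longrightarrow> (\<Sum>i<d. f i * cos (2 * pi * real a * real i / real d + \<phi>)) = 0"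
    and "finite P"
  shows "\<bar>b\<bar> + int (card P) < 2 * int j \<Longrightarrow> even (b + int (card P)) \<Longrightarrow>
    (\<Sum>i<d. f i * (cos (pi * real_of_int b * real i / real d + \<phi>) * sine_prod d P i)) = 0"
  using assms(2)
proof (induction P arbitrary: b \<phi> rule: finite_induct)
  case empty
  then obtain c where c: "b = 2 * c" by auto
  \<comment> \<open>Negative frequencies are reduced to positive ones because the cosine is even;
    the sign moves into the phase.\<close>
  define a where "a = nat \<bar>c\<bar>"
  have a: "a < j" using empty c by (simp add: a_def)
  have "cos (pi * real_of_int b * real i / real d + \<phi>) =
      cos (2 * pi * real a * real i / real d + (if c \<ge> 0 then \<phi> else - \<phi>))" for i
  proof (cases "c \<ge> 0")
    case True
    then show ?thesis by (simp add: a_def c mult.commute mult.left_commute)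
  next
    case False
    then have "pi * real_of_int b * real i / real d + \<phi> =
        - (2 * pi * real a * real i / real d + (- \<phi>))"
      by (simp add: a_def c)
    then show ?thesis
      using False by (simp only: cos_minus) simp
  qed
  then show ?case
    using orth[OF a] by (simp add: sine_prod_def)
next
  case (insert k P)
  \<comment> \<open>The new factor is sin (pi i / d - \<psi>); the further shift by pi / 2 in the
    phases turns the resulting sines back into cosines, as the induction hypothesis demands.\<close>
  define \<psi> where "\<psi> = pi * (real k + 1/2) / real d"
  let ?c = "\<lambda>b \<phi> i. f i * (cos (pi * real_of_int b * real i / real d + \<phi>) * sine_prod d P i)"
  have zero: "(\<Sum>i<d. ?c (b + 1) (\<phi> - \<psi> - pi/2) i) = 0"
    "(\<Sum>i<d. ?c (b - 1) (\<phi> + \<psi> - pi/2) i) = 0"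
    using insert.prems insert.hyps by (intro insert.IH; simp; linarith)+
  have eq: "f i * (cos (pi * real_of_int b * real i / real d + \<phi>) * sine_prod d (insert k P) i) =
      (?c (b + 1) (\<phi> - \<psi> - pi/2) i - ?c (b - 1) (\<phi> + \<psi> - pi/2) i) / 2" for i
  proof -
    define x where "x = pi * real_of_int b * real i / real d + \<phi>"
    define y where "y = pi * real i / real d - \<psi>"
    have 1: "pi * real_of_int (b + 1) * real i / real d + (\<phi> - \<psi> - pi/2) = x + y - pi/2"
      by (simp add: x_def y_def distrib_left distrib_right add_divide_distrib)
    have 2: "pi * real_of_int (b - 1) * real i / real d + (\<phi> + \<psi> - pi/2) = x - y - pi/2"
      by (simp add: x_def y_def left_diff_distrib right_diff_distrib diff_divide_distrib)
    have y: "pi * (real i - real k - 1/2) / real d = y"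
      by (simp add: y_def \<psi>_def diff_divide_distrib add_divide_distrib right_diff_distrib distrib_left)
    have cs: "cos (z - pi/2) = sin z" for z :: real
      by (simp add: cos_diff)
    have "cos x * sin y = (sin (x + y) - sin (x - y)) / 2"
      by (simp add: sin_add sin_diff)
    then have "f i * ((cos x * sin y) * sine_prod d P i) =
        (f i * (sin (x + y) * sine_prod d P i) - f i * (sin (x - y) * sine_prod d P i)) / 2"
      by (simp only:) (simp add: algebra_simps)
    moreover have "sine_prod d (insert k P) i = sin y * sine_prod d P i"
      using insert.hyps by (simp add: sine_prod_def y)
    ultimately show ?thesis
      unfolding 1 2 cs x_def[symmetric] by (simp only: mult.assoc)
  qed
  show ?case
    unfolding eq using zero by (simp add: sum_subtractf flip: sum_divide_distrib)
qed

text \<open>The points t and t + 1 lie on the same side of k + 1/2 unless k = t, and all arguments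
  stay strictly between - pi and pi.\<close>

lemma sine_prod_step:
  assumes "P \<subseteq> {..<d}" "t < d"
  shows "t \<notin> P \<Longrightarrow> sine_prod d P t * sine_prod d P (Suc t) > 0"
    and "t \<in> P \<Longrightarrow> sine_prod d P t * sine_prod d P (Suc t) < 0"
proof -
  have fin: "finite P" using assms(1) finite_subset by blast
  define q where "q k = sin (pi * (real t - real k - 1/2) / real d) *
    sin (pi * (real (Suc t) - real k - 1/2) / real d)" for k
  have pos_arg: "sin (pi * x / real d) > 0" if "0 < x" "x < real d" for x
  proof (rule sin_gt_zero)
    show "0 < pi * x / real d" using that by simp
    show "pi * x / real d < pi" using that by (simp add: divide_less_eq)
  qed
  have neg_arg: "sin (pi * x / real d) < 0" if "- real d < x" "x < 0" for x
    using pos_arg[of "- x"] that by simp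
  have q_pos: "q k > 0" if "k < d" "k \<noteq> t" for k
  proof (cases "k < t")
    case True
    then have "real k + 1 \<le> real t" by linarith
    then show ?thesis
      unfolding q_def using assms(2) by (intro mult_pos_pos pos_arg) auto
  next
    case False
    then have "real t + 1 \<le> real k" "real k < real d" using that by linarith+
    then show ?thesis
      unfolding q_def by (intro mult_neg_neg neg_arg) auto
  qed
  have q_neg: "q t < 0"
    unfolding q_def using assms(2) by (intro mult_neg_pos neg_arg pos_arg) auto
  have prod: "sine_prod d P t * sine_prod d P (Suc t) = (\<Prod>k\<in>P. q k)"
    by (simp add: sine_prod_def q_def prod.distrib)
  show "sine_prod d P t * sine_prod d P (Suc t) > 0" if "t \<notin> P"
    unfolding prod using that assms(1) by (intro prod_pos) (auto intro: q_pos)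
  show "sine_prod d P t * sine_prod d P (Suc t) < 0" if "t \<in> P"
  proof -
    have "(\<Prod>k\<in>P - {t}. q k) > 0"
      using assms(1) by (intro prod_pos) (auto intro: q_pos)
    then show ?thesis
      unfolding prod prod.remove[OF fin that] using q_neg by (rule mult_neg_pos[rotated])
  qed
qed

text \<open>Hurwitz's argument: with fewer than \<open>2 * j\<close> sign changes, a trigonometric polynomial of degree
  less than \<open>j\<close> changing sign at the same places would have a non-zero scalar product with \<open>f\<close>.\<close>

lemma sign_changes_ge:
  fixes f :: "nat \<Rightarrow> real"
  assumes d: "d > 0" and per: "f d = f 0" and nz: "\<And>i. i \<le> d \<Longrightarrow> f i \<noteq> 0"
    and orth: "\<And>a \<phi>. a < j \<Longrightarrow> (\<Sum>i<d. f i * cos (2 * pi * real a * real i / real d + \<phi>)) = 0"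
  shows "2 * j \<le> card {i \<in> {..<d}. f i * f (Suc i) < 0}"
proof (rule ccontr)
  define P where "P = {i \<in> {..<d}. f i * f (Suc i) < 0}"
  assume "\<not> ?thesis"
  then have less: "card P < 2 * j" by (simp add: P_def)
  have P: "P \<subseteq> {..<d}" "finite P" by (auto simp: P_def)
  define g where "g = sine_prod d P"
  \<comment> \<open>\<open>g\<close> cancels every sign change of \<open>f\<close>, so
    \<open>h\<close> keeps one sign from 0 to d, while orthogonality will make its sum
    vanish.\<close>
  define h where "h t = f t * g t" for t
  have h_step: "h t * h (Suc t) > 0" if t: "t < d" for t
  proof (cases "t \<in> P")
    case True
    then have "f t * f (Suc t) < 0" by (simp add: P_def)
    then have "(f t * f (Suc t)) * (g t * g (Suc t)) > 0"
      using sine_prod_step(2)[OF P(1) t True] unfolding g_def by (rule mult_neg_neg)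
    then show ?thesis by (simp add: h_def algebra_simps)
  next
    case False
    then have "f t * f (Suc t) > 0"
      using t nz[of t] nz[of "Suc t"] mult_eq_0_iff[of "f t" "f (Suc t)"]
      unfolding P_def by (simp add: not_less order_less_le)
    then have "(f t * f (Suc t)) * (g t * g (Suc t)) > 0"
      using sine_prod_step(1)[OF P(1) t False] unfolding g_def by (rule mult_pos_pos)
    then show ?thesis by (simp add: h_def algebra_simps)
  qed
  have h: "h 0 * h t > 0" if "t \<le> d" for t
    using that
  proof (induction t)
    case 0
    have "h 0 \<noteq> 0" using h_step[of 0] d by auto
    then show ?case by (auto simp: zero_less_mult_iff linorder_neq_iff)
  next
    case (Suc t)
    have "h 0 * h t > 0" "h t * h (Suc t) > 0"
      using Suc h_step[of t] by auto
    then show ?case by (auto simp: zero_less_mult_iff)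
  qed
  have pos_arg: "sin (pi * x / real d) > 0" if "0 < x" "x < real d" for x
  proof (rule sin_gt_zero)
    show "0 < pi * x / real d" using that by simp
    show "pi * x / real d < pi" using that by (simp add: divide_less_eq)
  qed
  have gd: "g d > 0"
    unfolding g_def sine_prod_def
  proof (rule prod_pos, rule pos_arg)
    fix k assume "k \<in> P"
    then have "real k + 1 \<le> real d" using P by auto
    then show "0 < real d - real k - 1/2" "real d - real k - 1/2 < real d" by auto
  qed
  define r where "r = (\<Prod>k\<in>P. sin (pi * (real k + 1/2) / real d))"
  have r: "r > 0"
    unfolding r_def
  proof (rule prod_pos, rule pos_arg)
    fix k assume "k \<in> P"
    then have "real k + 1 \<le> real d" using P by auto
    then show "0 < real k + 1/2" "real k + 1/2 < real d" by auto
  qed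
  \<comment> \<open>The ends decide the parity: \<open>g d\<close> is positive and
    \<open>g 0\<close> has sign (-1)^\<open>card P\<close>, yet \<open>h\<close> has the same sign
    at both ends and f d = f 0. Hence \<open>card P\<close> is even, as
    \<open>sine_prod_orthogonal\<close> requires for b = 0.\<close>
  have g0: "g 0 = (-1) ^ card P * r"
  proof -
    have "sin (pi * (real 0 - real k - 1/2) / real d) = (-1) * sin (pi * (real k + 1/2) / real d)" for k
    proof -
      have "pi * (real 0 - real k - 1/2) / real d = - (pi * (real k + 1/2) / real d)"
        by (simp add: algebra_simps diff_divide_distrib add_divide_distrib)
      then show ?thesis by (simp only: sin_minus)
    qed
    then have "g 0 = (\<Prod>k\<in>P. (-1) * sin (pi * (real k + 1/2) / real d))"
      unfolding g_def sine_prod_def by (simp only:)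
    then show ?thesis
      unfolding r_def by (simp only: prod.distrib prod_constant)
  qed
  have "h 0 * h d > 0" using h by simp
  then have "(f 0)\<^sup>2 * (g 0 * g d) > 0"
    by (simp add: h_def per power2_eq_square algebra_simps)
  then have "g 0 > 0"
    using gd by (simp add: zero_less_mult_iff)
  then have even: "even (card P)"
    using r g0 by (cases "even (card P)") auto
  have "(\<Sum>i<d. f i * (cos (pi * real_of_int 0 * real i / real d + 0) * sine_prod d P i)) = 0"
    by (rule sine_prod_orthogonal[OF orth P(2)]) (use less even in auto)
  then have "(\<Sum>i<d. h i) = 0" by (simp add: h_def g_def)
  then have "(\<Sum>i<d. h 0 * h i) = 0" by (simp flip: sum_distrib_left)
  moreover have "(\<Sum>i<d. h 0 * h i) > 0"
    using h d by (intro sum_pos) auto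
  ultimately show False by simp
qed

section \<open>Avoiding finitely many hyperplanes, and a sum of roots of unity\<close>

lemma generic_covector:
  fixes G :: "('a \<Rightarrow> complex) set"
  assumes "finite G" "finite S" "\<And>g. g \<in> G \<Longrightarrow> \<exists>x\<in>S. g x \<noteq> 0"
  shows "\<exists>v. \<forall>g\<in>G. Re (\<Sum>x\<in>S. v x * g x) \<noteq> 0"
  using assms(1,3)
proof (induction G rule: finite_induct)
  case empty
  then show ?case by simp
next
  case (insert g G)
  obtain v where v: "\<forall>h\<in>G. Re (\<Sum>x\<in>S. v x * h x) \<noteq> 0"
    using insert by blast
  define p where "p h = Re (\<Sum>x\<in>S. v x * h x)" for h
  \<comment> \<open>The covector is perturbed by \<open>e\<close> times the conjugate of
    \<open>g\<close>, which changes its value on h by \<open>e * q h\<close>. On \<open>g\<close>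
    itself \<open>q\<close> is a positive sum of squares; each h with q h \<noteq> 0 excludes one
    value of \<open>e\<close>, and for q h = 0 the old value p h is already non-zero.\<close>
  define q where "q h = Re (\<Sum>x\<in>S. cnj (g x) * h x)" for h
  have qg: "q g \<noteq> 0"
  proof -
    obtain y where y: "y \<in> S" "g y \<noteq> 0" using insert.prems by blast
    have eq: "Re (cnj z * z) = (cmod z)\<^sup>2" for z
      by (simp add: cmod_power2) (simp add: power2_eq_square)
    have "q g = (\<Sum>x\<in>S. (cmod (g x))\<^sup>2)"
      unfolding q_def Re_sum by (simp only: eq)
    also have "\<dots> > 0"
      by (rule sum_pos2[OF assms(2) y(1)]) (use y in auto)
    finally show ?thesis by simp
  qed
  have "finite ((\<lambda>h. - p h / q h) ` insert g G)"
    using insert.hyps by simp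
  then have "infinite (UNIV - (\<lambda>h. - p h / q h) ` insert g G :: real set)"
    by (simp add: Diff_infinite_finite infinite_UNIV_char_0)
  then obtain e where e: "e \<notin> (\<lambda>h. - p h / q h) ` insert g G" "e \<noteq> 0"
    by (metis (no_types, lifting) Diff_iff finite.emptyI finite.insertI finite_subset insertI1 subsetI)
  have "p h + e * q h \<noteq> 0" if h: "h \<in> insert g G" for h
  proof (cases "q h = 0")
    case True
    then have "h \<noteq> g" using qg by auto
    then show ?thesis using True h v by (auto simp: p_def)
  next
    case False
    show ?thesis
    proof
      assume "p h + e * q h = 0"
      then have "e = - p h / q h" using False by (simp add: field_simps eq_neg_iff_add_eq_0)
      then show False using e h by blast
    qed
  qed
  moreover have "Re (\<Sum>x\<in>S. (v x + of_real e * cnj (g x)) * h x) = p h + e * q h" for h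
  proof -
    have "(\<Sum>x\<in>S. (v x + of_real e * cnj (g x)) * h x) =
        (\<Sum>x\<in>S. v x * h x) + of_real e * (\<Sum>x\<in>S. cnj (g x) * h x)"
      by (simp only: distrib_right sum.distrib sum_distrib_left mult.assoc)
    then show ?thesis
      by (simp only: p_def q_def plus_complex.simps Re_complex_of_real times_complex.simps Im_complex_of_real)
  qed
  ultimately show ?case
    by (intro exI[of _ "\<lambda>x. v x + of_real e * cnj (g x)"]) simp
qed

lemma sum_roots_of_unity:
  assumes "0 < i" "i < d"
  shows "(\<Sum>a<d. cis (2 * pi * real a * real i / real d)) = 0"
proof -
  define z where "z = cis (2 * pi * real i / real d)"
  have "z \<noteq> 1"
  proof
    assume "z = 1"
    then have "cos (2 * pi * real i / real d) = 1"
      by (simp add: z_def complex_eq_iff)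
    then obtain n :: int where "2 * pi * real i / real d = real_of_int n * 2 * pi"
      using cos_one_2pi_int by blast
    then have "real i = real_of_int n * real d"
      using assms by (simp add: field_simps)
    then have "int i = n * int d"
      by (metis of_int_eq_iff of_int_mult of_int_of_nat_eq)
    then have "int d dvd int i" by simp
    then show False using assms by (auto dest: dvd_imp_le)
  qed
  have "z ^ a = cis (2 * pi * real a * real i / real d)" for a
    by (simp add: z_def DeMoivre algebra_simps)
  moreover have "z ^ d = 1"
  proof -
    have "z ^ d = cis (2 * pi * real i)"
      using assms by (simp add: z_def DeMoivre)
    then show ?thesis by (simp add: cis_multiple_2pi)
  qed
  ultimately show ?thesis
    using \<open>z \<noteq> 1\<close> geometric_sum[of z d] by simp
qed

section \<open>Twisted conjugation\<close>

locale twisted_coxeter_system = finite_coxeter_system +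
  fixes \<sigma>
  assumes \<sigma>_iso: "\<sigma> \<in> iso W W" and \<sigma>_simple: "\<sigma> ` I = I"
begin

lemma \<sigma>_group_hom: "group_hom W W \<sigma>"
  using \<sigma>_iso by (simp add: group_hom_def group_hom_axioms_def iso_def is_group)

lemma \<sigma>_closed [simp]: "x \<in> carrier W \<Longrightarrow> \<sigma> x \<in> carrier W"
  using group_hom.hom_closed[OF \<sigma>_group_hom] .

lemma \<sigma>_mult [simp]: "\<lbrakk>x \<in> carrier W; y \<in> carrier W\<rbrakk> \<Longrightarrow> \<sigma> (x \<otimes> y) = \<sigma> x \<otimes> \<sigma> y"
  using group_hom.hom_mult[OF \<sigma>_group_hom] .

lemma \<sigma>_one [simp]: "\<sigma> \<one> = \<one>"
  using group_hom.hom_one[OF \<sigma>_group_hom] .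

lemma \<sigma>_inv [simp]: "x \<in> carrier W \<Longrightarrow> \<sigma> (inv x) = inv (\<sigma> x)"
  using group_hom.hom_inv[OF \<sigma>_group_hom] .

lemma \<sigma>_in_I [simp]: "s \<in> I \<Longrightarrow> \<sigma> s \<in> I"
  using \<sigma>_simple by blast

lemma inj_on_\<sigma>: "inj_on \<sigma> (carrier W)"
  using \<sigma>_iso by (simp add: iso_def bij_betw_def)

lemma inj_on_\<sigma>_I: "inj_on \<sigma> I"
  using inj_on_\<sigma> simple_closed by (rule inj_on_subset)

lemma \<sigma>_pow_closed [simp]: "x \<in> carrier W \<Longrightarrow> (\<sigma> ^^ n) x \<in> carrier W"
  by (induction n) auto

lemma \<sigma>_pow_in_I [simp]: "s \<in> I \<Longrightarrow> (\<sigma> ^^ n) s \<in> I"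
  by (induction n) auto

lemma \<sigma>_pow_mult [simp]:
  "\<lbrakk>x \<in> carrier W; y \<in> carrier W\<rbrakk> \<Longrightarrow> (\<sigma> ^^ n) (x \<otimes> y) = (\<sigma> ^^ n) x \<otimes> (\<sigma> ^^ n) y"
  by (induction n) auto

lemma \<sigma>_pow_inv [simp]: "x \<in> carrier W \<Longrightarrow> (\<sigma> ^^ n) (inv x) = inv ((\<sigma> ^^ n) x)"
  by (induction n) auto

lemma mprod_map_\<sigma>: "u \<in> lists (carrier W) \<Longrightarrow> mprod W (map \<sigma> u) = \<sigma> (mprod W u)"
  by (induction u) (auto simp: mprod_closed)

lemma len_\<sigma> [simp]:
  assumes x: "x \<in> carrier W"
  shows "len (\<sigma> x) = len x"
proof (rule antisym)
  obtain u where u: "u \<in> lists I" "length u = len x" "mprod W u = x"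
    by (rule reduced_word[OF x])
  have "map \<sigma> u \<in> lists I" using u by auto
  then have "len (mprod W (map \<sigma> u)) \<le> length (map \<sigma> u)" by (rule len_le)
  then show "len (\<sigma> x) \<le> len x"
    using u by (simp add: mprod_map_\<sigma>[OF lists_carrier])
next
  have "\<sigma> x \<in> carrier W" using x by simp
  then obtain u where u: "u \<in> lists I" "length u = len (\<sigma> x)" "mprod W u = \<sigma> x"
    by (rule reduced_word)
  have "u \<in> map \<sigma> ` lists I"
    using u(1) \<sigma>_simple by (metis lists_image)
  then obtain u' where u': "u' \<in> lists I" "u = map \<sigma> u'" by blast
  have "\<sigma> (mprod W u') = \<sigma> x"
    using u(3) u' by (simp add: mprod_map_\<sigma>[OF lists_carrier])
  then have "mprod W u' = x"
    using inj_on_\<sigma> u' x by (simp add: inj_on_eq_iff)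
  then show "len x \<le> len (\<sigma> x)"
    using len_le[OF u'(1)] u u' by simp
qed

lemma len_\<sigma>_pow [simp]: "x \<in> carrier W \<Longrightarrow> len ((\<sigma> ^^ n) x) = len x"
  by (induction n) auto

text \<open>The linear map sending each simple root s to the simple root of
  \<open>\<sigma> s\<close>. Values outside \<open>I\<close> are discarded, unlike in
  \<open>act\<close>; roots vanish there, so periodicity is stated for roots.\<close>

definition permute :: "('a \<Rightarrow> real) \<Rightarrow> 'a \<Rightarrow> real"
  where "permute v = (\<lambda>x. if x \<in> I then v (inv_into I \<sigma> x) else 0)"

lemma permute_\<sigma> [simp]: "x \<in> I \<Longrightarrow> permute v (\<sigma> x) = v x"
  using inj_on_\<sigma>_I by (simp add: permute_def)

lemma permute_eqI:
  assumes "\<And>x. x \<in> I \<Longrightarrow> permute v (\<sigma> x) = u (\<sigma> x)" "\<And>x. x \<notin> I \<Longrightarrow> u x = 0"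
  shows "permute v = u"
proof
  fix x
  show "permute v x = u x"
  proof (cases "x \<in> I")
    case True
    then obtain y where "y \<in> I" "x = \<sigma> y" using \<sigma>_simple by blast
    then show ?thesis using assms(1) by blast
  qed (simp add: permute_def assms(2))
qed

lemma permute_simple_root: "s \<in> I \<Longrightarrow> permute (simple_root s) = simple_root (\<sigma> s)"
  by (rule permute_eqI) (auto simp: simple_root_def inj_on_eq_iff[OF inj_on_\<sigma>_I])

lemma coxeter_form_\<sigma>: "s \<in> I \<Longrightarrow> t \<in> I \<Longrightarrow> coxeter_form (\<sigma> s) (\<sigma> t) = coxeter_form s t"
  using ord_iso[OF \<sigma>_iso, of "s \<otimes> t"] by (simp add: coxeter_form_def)

lemma pairing_permute:
  assumes "s \<in> I"
  shows "pairing (permute v) (\<sigma> s) = pairing v s"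
proof -
  have "pairing (permute v) (\<sigma> s) = (\<Sum>t\<in>\<sigma> ` I. permute v t * coxeter_form t (\<sigma> s))"
    by (simp add: pairing_def \<sigma>_simple)
  also have "\<dots> = (\<Sum>t\<in>I. permute v (\<sigma> t) * coxeter_form (\<sigma> t) (\<sigma> s))"
    using inj_on_\<sigma>_I by (simp add: sum.reindex)
  also have "\<dots> = pairing v s"
    unfolding pairing_def using assms by (intro sum.cong) (auto simp: coxeter_form_\<sigma>)
  finally show ?thesis .
qed

lemma permute_reflect:
  assumes "s \<in> I"
  shows "permute (reflect s v) = reflect (\<sigma> s) (permute v)"
proof (rule permute_eqI)
  fix x assume "x \<in> I"
  then show "permute (reflect s v) (\<sigma> x) = reflect (\<sigma> s) (permute v) (\<sigma> x)"
    using assms by (simp add: reflect_def pairing_permute inj_on_eq_iff[OF inj_on_\<sigma>_I])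
next
  fix x assume "x \<notin> I"
  moreover have "\<sigma> s \<in> I" using assms by simp
  ultimately show "reflect (\<sigma> s) (permute v) x = 0"
    by (auto simp: reflect_def permute_def)
qed

lemma permute_act:
  assumes x: "x \<in> carrier W"
  shows "permute (act x v) = act (\<sigma> x) (permute v)"
proof -
  obtain u where u: "u \<in> lists I" "mprod W u = x"
    using word_exists[OF x] by blast
  have u': "map \<sigma> u \<in> lists I" using u by auto
  from u(1) have "permute (foldr reflect u v) = foldr reflect (map \<sigma> u) (permute v)"
    by (induction u) (auto simp: permute_reflect)
  then show ?thesis
    using act_mprod[OF u(1)] act_mprod[OF u'] u(2) mprod_map_\<sigma>[OF lists_carrier[OF u(1)]] by simp
qed

lemma permute_sum: "permute (\<lambda>x. \<Sum>i\<in>A. c i * f i x) = (\<lambda>x. \<Sum>i\<in>A. c i * permute (f i) x)"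
  by (auto simp: permute_def)

lemma permute_uminus: "permute (- v) = - permute v"
  by (auto simp: permute_def fun_Compl_def)

lemma permute_in_roots [simp]:
  assumes "\<gamma> \<in> roots"
  shows "permute \<gamma> \<in> roots"
proof -
  obtain v s where "v \<in> carrier W" "s \<in> I" "\<gamma> = act v (simple_root s)"
    using assms unfolding roots_def by blast
  then show ?thesis
    by (simp add: permute_act permute_simple_root)
qed

lemma positive_permute [simp]:
  assumes "\<gamma> \<in> roots"
  shows "positive (permute \<gamma>) \<longleftrightarrow> positive \<gamma>"
proof
  assume pos: "positive (permute \<gamma>)"
  show "positive \<gamma>"
    unfolding positive_def
  proof
    fix x show "\<gamma> x \<ge> 0"
      using pos permute_\<sigma>[of x \<gamma>] root_outside[OF assms, of x] unfolding positive_def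
      by (cases "x \<in> I") (metis, simp)
  qed
qed (simp add: positive_def permute_def)

lemma permute_pow:
  "\<lbrakk>v \<in> carrier W; s \<in> I\<rbrakk> \<Longrightarrow> (permute ^^ n) (act v (simple_root s)) =
    act ((\<sigma> ^^ n) v) (simple_root ((\<sigma> ^^ n) s))"
  by (induction n) (simp_all add: permute_act permute_simple_root)

section \<open>Powers and the order of w \<sigma> in the semidirect product\<close>

definition twisted_power :: "'a \<Rightarrow> nat \<Rightarrow> 'a"
  where "twisted_power w n = mprod W (map (\<lambda>i. (\<sigma> ^^ i) w) [0..<n])"

lemma twisted_power_0 [simp]: "twisted_power w 0 = \<one>"
  by (simp add: twisted_power_def)

lemma twisted_power_closed [simp]: "w \<in> carrier W \<Longrightarrow> twisted_power w n \<in> carrier W"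
  unfolding twisted_power_def by (rule mprod_closed) auto

lemma twisted_power_Suc:
  assumes "w \<in> carrier W"
  shows "twisted_power w (Suc n) = twisted_power w n \<otimes> (\<sigma> ^^ n) w"
  unfolding twisted_power_def using assms by (simp add: mprod_append)

lemma twisted_power_Suc':
  assumes "w \<in> carrier W"
  shows "twisted_power w (Suc n) = w \<otimes> \<sigma> (twisted_power w n)"
proof (induction n)
  case 0
  then show ?case using assms by (simp add: twisted_power_Suc)
next
  case (Suc n)
  have "twisted_power w (Suc (Suc n)) = w \<otimes> \<sigma> (twisted_power w n) \<otimes> \<sigma> ((\<sigma> ^^ n) w)"
    using twisted_power_Suc[OF assms, of "Suc n"] Suc by simp
  also have "\<dots> = w \<otimes> \<sigma> (twisted_power w (Suc n))"
    using assms by (simp add: twisted_power_Suc m_assoc)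
  finally show ?case .
qed

lemma twisted_power_conj:
  assumes "x \<in> carrier W" "w \<in> carrier W"
  shows "twisted_power (inv x \<otimes> w \<otimes> \<sigma> x) n = inv x \<otimes> twisted_power w n \<otimes> (\<sigma> ^^ n) x"
proof (induction n)
  case (Suc n)
  have "(\<sigma> ^^ n) (\<sigma> x) = (\<sigma> ^^ Suc n) x" by (simp only: funpow_Suc_right comp_def)
  then show ?case
    using assms Suc by (simp add: twisted_power_Suc m_assoc del: funpow.simps)
qed (use assms in simp)

definition is_twisted_period :: "'a \<Rightarrow> nat \<Rightarrow> bool"
  where "is_twisted_period w d \<longleftrightarrow> d > 0 \<and> twisted_power w d = \<one> \<and> (\<forall>x\<in>carrier W. (\<sigma> ^^ d) x = x)"

lemma twisted_order_eq: "twisted_order \<sigma> w = (LEAST d. is_twisted_period w d)"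
  unfolding twisted_order_def is_twisted_period_def twisted_power_def ..

text \<open>The map sending x to \<open>w \<otimes> \<sigma> x\<close> permutes the finite group, so
  some power n of it is the identity. At \<open>\<one>\<close> this says that the twisted power is
  trivial, and then at any x that \<sigma>^n fixes x. Extending by the identity outside the carrier
  meets the definition of \<open>permutes\<close>.\<close>

lemma twisted_period_exists:
  assumes w: "w \<in> carrier W"
  shows "\<exists>d. is_twisted_period w d"
proof -
  define h where "h x = (if x \<in> carrier W then w \<otimes> \<sigma> x else x)" for x
  have "inj_on h (carrier W)"
  proof (rule inj_onI)
    fix x y assume "x \<in> carrier W" "y \<in> carrier W" "h x = h y"
    then show "x = y"
      using w inj_on_eq_iff[OF inj_on_\<sigma>] by (simp add: h_def)
  qed
  moreover have "h ` carrier W \<subseteq> carrier W"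
    using w by (auto simp: h_def)
  ultimately have "bij_betw h (carrier W) (carrier W)"
    using finite_carrier by (simp add: bij_betw_def endo_inj_surj)
  then have "h permutes carrier W"
    by (rule bij_imp_permutes) (simp add: h_def)
  then have "permutation h"
    using finite_carrier permutation_permutes by blast
  then obtain n where n: "h ^^ n = id" "n > 0"
    by (rule permutation_is_nilpotent)
  have h_pow: "(h ^^ k) x = twisted_power w k \<otimes> (\<sigma> ^^ k) x" if x: "x \<in> carrier W" for k x
    by (induction k) (use x w in \<open>simp_all add: h_def twisted_power_Suc' m_assoc\<close>)
  have \<sigma>1: "(\<sigma> ^^ k) \<one> = \<one>" for k by (induction k) auto
  have one: "twisted_power w n = \<one>"
    using h_pow[of \<one> n] n w by (simp add: \<sigma>1)
  then have "(\<sigma> ^^ n) x = x" if "x \<in> carrier W" for x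
    using h_pow[OF that, of n] n that by simp
  then show ?thesis
    using one n by (auto simp: is_twisted_period_def)
qed

lemma is_twisted_period_order:
  assumes "w \<in> carrier W"
  shows "is_twisted_period w (twisted_order \<sigma> w)"
  unfolding twisted_order_eq using twisted_period_exists[OF assms] by (rule LeastI_ex)

text \<open>At a period \<sigma>^d is trivial, so twisted conjugation of the twisted power is
  ordinary conjugation, which detects \<open>\<one>\<close>.\<close>

lemma twisted_order_conj:
  assumes "x \<in> carrier W" "w \<in> carrier W"
  shows "twisted_order \<sigma> (inv x \<otimes> w \<otimes> \<sigma> x) = twisted_order \<sigma> w"
proof -
  have "is_twisted_period (inv x \<otimes> w \<otimes> \<sigma> x) d \<longleftrightarrow> is_twisted_period w d" for d
  proof -
    have "inv x \<otimes> twisted_power w d \<otimes> x = \<one> \<longleftrightarrow> twisted_power w d = \<one>"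
    proof
      assume "inv x \<otimes> twisted_power w d \<otimes> x = \<one>"
      then have "x \<otimes> (inv x \<otimes> twisted_power w d \<otimes> x) \<otimes> inv x = x \<otimes> \<one> \<otimes> inv x"
        by simp
      then show "twisted_power w d = \<one>"
        using assms by (simp add: m_assoc)
    qed (use assms in simp)
    then show ?thesis
      using assms by (auto simp: is_twisted_period_def twisted_power_conj)
  qed
  then show ?thesis by (simp add: twisted_order_eq)
qed

definition twist :: "'a \<Rightarrow> ('a \<Rightarrow> real) \<Rightarrow> 'a \<Rightarrow> real"
  where "twist w v = act w (permute v)"

lemma twist_in_roots [simp]: "\<lbrakk>w \<in> carrier W; \<gamma> \<in> roots\<rbrakk> \<Longrightarrow> twist w \<gamma> \<in> roots"
  by (simp add: twist_def)

lemma twist_pow_in_roots [simp]: "\<lbrakk>w \<in> carrier W; \<gamma> \<in> roots\<rbrakk> \<Longrightarrow> (twist w ^^ n) \<gamma> \<in> roots"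
  by (induction n) auto

lemma permute_pow_in_roots [simp]: "\<gamma> \<in> roots \<Longrightarrow> (permute ^^ n) \<gamma> \<in> roots"
  by (induction n) auto

lemma positive_permute_pow [simp]: "\<gamma> \<in> roots \<Longrightarrow> positive ((permute ^^ n) \<gamma>) \<longleftrightarrow> positive \<gamma>"
  by (induction n) auto

lemma permute_pow_act:
  "x \<in> carrier W \<Longrightarrow> (permute ^^ n) (act x v) = act ((\<sigma> ^^ n) x) ((permute ^^ n) v)"
  by (induction n) (auto simp: permute_act)

lemma twist_pow:
  assumes "w \<in> carrier W"
  shows "(twist w ^^ n) v = act (twisted_power w n) ((permute ^^ n) v)"
  using assms
  by (induction n) (simp_all add: twist_def permute_act twisted_power_Suc' act_mult)

lemma twist_pow_sum:
  assumes "finite A"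
  shows "(twist w ^^ n) (\<lambda>x. \<Sum>i\<in>A. c i * f i x) = (\<lambda>x. \<Sum>i\<in>A. c i * (twist w ^^ n) (f i) x)"
  by (induction n) (simp_all add: twist_def permute_sum act_sum[OF assms])

lemma twist_pow_uminus: "(twist w ^^ n) (- v) = - (twist w ^^ n) v"
  by (induction n) (simp_all only: funpow.simps id_apply comp_def twist_def permute_uminus act_uminus)

lemma twist_pow_period:
  assumes w: "w \<in> carrier W" and d: "is_twisted_period w d" and \<gamma>: "\<gamma> \<in> roots"
  shows "(twist w ^^ d) \<gamma> = \<gamma>"
proof -
  obtain v s where "v \<in> carrier W" "s \<in> I" "\<gamma> = act v (simple_root s)"
    using \<gamma> unfolding roots_def by blast
  then show ?thesis
    using d w by (simp add: twist_pow permute_pow is_twisted_period_def)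
qed

end

context twisted_coxeter_system
begin

lemma lift_\<sigma>:
  assumes x: "x \<in> carrier W"
  shows "braid_aut \<sigma> (lift x) = lift (\<sigma> x)"
proof -
  obtain u where u: "u \<in> lists I" "length u = len x" "mprod W u = x"
    by (rule reduced_word[OF x])
  have u': "map \<sigma> u \<in> lists I" using u by auto
  have m: "mprod W (map \<sigma> u) = \<sigma> x"
    using u mprod_map_\<sigma>[OF lists_carrier[OF u(1)]] by simp
  have "lift x = braid_class u" using lift_mprod[OF u(1)] u by simp
  moreover have "lift (\<sigma> x) = braid_class (map \<sigma> u)" using lift_mprod[OF u'] m u x by simp
  ultimately show ?thesis
    using braid_aut_class[OF \<sigma>_iso \<sigma>_simple u(1)] by simp
qed

lemma lift_\<sigma>_pow: "x \<in> carrier W \<Longrightarrow> (braid_aut \<sigma> ^^ n) (lift x) = lift ((\<sigma> ^^ n) x)"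
  by (induction n) (simp_all add: lift_\<sigma>)

end

section \<open>Fourier levels of roots\<close>

locale twisted_element = twisted_coxeter_system +
  fixes w d
  assumes w_closed [simp]: "w \<in> carrier W" and period: "is_twisted_period w d"
begin

lemma d_pos: "d > 0"
  using period by (simp add: is_twisted_period_def)

text \<open>Up to the factor d, the projection of the root to the eigenspace of w \<sigma> with
  eigenvalue \<open>cis (- (2 * pi * a / d))\<close>.\<close>

definition dft :: "nat \<Rightarrow> ('a \<Rightarrow> real) \<Rightarrow> 'a \<Rightarrow> complex"
  where "dft a \<gamma> x =
    (\<Sum>i<d. cis (2 * pi * real a * real i / real d) * complex_of_real ((twist w ^^ i) \<gamma> x))"

text \<open>The level indexes the smallest rotation angle \<open>2 * pi * a / d\<close> of \<open>w \<sigma>\<close> on whose eigenspace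
  the root does not vanish.\<close>

definition level :: "('a \<Rightarrow> real) \<Rightarrow> nat"
  where "level \<gamma> = (LEAST a. \<exists>x\<in>I. dft a \<gamma> x \<noteq> 0)"

lemma dft_twist:
  assumes "\<gamma> \<in> roots"
  shows "dft a (twist w \<gamma>) x = cis (- (2 * pi * real a / real d)) * dft a \<gamma> x"
proof -
  define g where "g i = cis (2 * pi * real a * real i / real d) *
    complex_of_real ((twist w ^^ i) \<gamma> x)" for i
  have "cis (2 * pi * real a * real d / real d) = 1"
    using d_pos cis_multiple_2pi[of "real a"] by simp
  then have gd: "g d = g 0"
    using twist_pow_period[OF w_closed period assms] by (simp add: g_def)
  have "(\<Sum>i<d. g (Suc i)) + g 0 = (\<Sum>i<d. g i) + g d"
    using sum.lessThan_Suc_shift[of g d] by (simp add: add.commute)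
  then have shift: "(\<Sum>i<d. g (Suc i)) = (\<Sum>i<d. g i)"
    by (simp add: gd)
  have "cis (2 * pi * real a * real i / real d) * complex_of_real ((twist w ^^ i) (twist w \<gamma>) x) =
      cis (- (2 * pi * real a / real d)) * g (Suc i)" for i
  proof -
    have "2 * pi * real a * real i / real d =
        - (2 * pi * real a / real d) + 2 * pi * real a * real (Suc i) / real d"
      by (simp add: distrib_left add_divide_distrib)
    then have "cis (2 * pi * real a * real i / real d) =
        cis (- (2 * pi * real a / real d)) * cis (2 * pi * real a * real (Suc i) / real d)"
      by (simp only: cis_mult)
    then show ?thesis
      by (simp only: g_def funpow_Suc_right comp_def mult.assoc)
  qed
  then have "dft a (twist w \<gamma>) x = (\<Sum>i<d. cis (- (2 * pi * real a / real d)) * g (Suc i))"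
    by (simp only: dft_def)
  also have "\<dots> = cis (- (2 * pi * real a / real d)) * (\<Sum>i<d. g i)"
    by (simp only: shift flip: sum_distrib_left)
  finally show ?thesis by (simp only: g_def dft_def)
qed

text \<open>The orbit is real, so the frequencies a and d - a are conjugate and those up to d / 2
  already detect a root. This gives \<open>level_bound\<close>, which later keeps each rotation step
  within a half turn.\<close>

lemma dft_reflection:
  assumes "a \<le> d"
  shows "dft (d - a) \<gamma> x = cnj (dft a \<gamma> x)"
proof -
  have "cis (2 * pi * real (d - a) * real i / real d) = cis (- (2 * pi * real a * real i / real d))" for i
  proof -
    have "2 * pi * real (d - a) * real i / real d =
        2 * pi * real i + - (2 * pi * real a * real i / real d)"
      using d_pos assms by (simp add: of_nat_diff field_simps)
    then show ?thesis
      using cis_multiple_2pi[of "real i"] by (simp only: cis_mult[symmetric]) simp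
  qed
  then show ?thesis
    by (simp add: dft_def cis_cnj)
qed

lemma dft_inversion: "(\<Sum>a<d. dft a \<gamma> x) = of_nat d * complex_of_real (\<gamma> x)"
proof -
  have "(\<Sum>a<d. dft a \<gamma> x) = (\<Sum>i<d. \<Sum>a<d. cis (2 * pi * real a * real i / real d) *
      complex_of_real ((twist w ^^ i) \<gamma> x))"
    unfolding dft_def by (rule sum.swap)
  also have "\<dots> = (\<Sum>i<d. if i = 0 then of_nat d * complex_of_real (\<gamma> x) else 0)"
  proof (rule sum.cong)
    fix i assume i: "i \<in> {..<d}"
    show "(\<Sum>a<d. cis (2 * pi * real a * real i / real d) * complex_of_real ((twist w ^^ i) \<gamma> x)) =
        (if i = 0 then of_nat d * complex_of_real (\<gamma> x) else 0)"
    proof (cases "i = 0")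
      case False
      then have "(\<Sum>a<d. cis (2 * pi * real a * real i / real d)) = 0"
        using i sum_roots_of_unity[of i d] by simp
      then show ?thesis
        using False by (simp only: sum_distrib_right[symmetric]) simp
    qed simp
  qed simp
  also have "\<dots> = of_nat d * complex_of_real (\<gamma> x)"
    using d_pos by simp
  finally show ?thesis .
qed

lemma dft_nonzero_exists:
  assumes "\<gamma> \<in> roots"
  shows "\<exists>a. 2 * a \<le> d \<and> (\<exists>x\<in>I. dft a \<gamma> x \<noteq> 0)"
proof (rule ccontr)
  assume none: "\<not> ?thesis"
  obtain x where x: "x \<in> I" "\<gamma> x \<noteq> 0"
    using root_nonzero[OF assms] by blast
  have "dft a \<gamma> x = 0" if a: "a < d" for a
  proof (cases "2 * a \<le> d")
    case True
    then show ?thesis using none x by blast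
  next
    case False
    then have "dft (d - a) \<gamma> x = 0" using none x by auto
    then show ?thesis using dft_reflection[of a \<gamma> x] a by simp
  qed
  then show False
    using dft_inversion[of \<gamma> x] x d_pos by simp
qed

lemma dft_level: "\<gamma> \<in> roots \<Longrightarrow> \<exists>x\<in>I. dft (level \<gamma>) \<gamma> x \<noteq> 0"
  unfolding level_def using dft_nonzero_exists by (intro LeastI_ex[of "\<lambda>a. \<exists>x\<in>I. dft a \<gamma> x \<noteq> 0"]) blast

lemma dft_below_level: "\<lbrakk>a < level \<gamma>; x \<in> I\<rbrakk> \<Longrightarrow> dft a \<gamma> x = 0"
  unfolding level_def using not_less_Least by blast

lemma level_le: "\<lbrakk>x \<in> I; dft a \<gamma> x \<noteq> 0\<rbrakk> \<Longrightarrow> level \<gamma> \<le> a"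
  using dft_below_level not_less by blast

lemma level_bound:
  assumes "\<gamma> \<in> roots"
  shows "2 * level \<gamma> \<le> d"
proof -
  obtain a x where "2 * a \<le> d" "x \<in> I" "dft a \<gamma> x \<noteq> 0"
    using dft_nonzero_exists[OF assms] by blast
  then show ?thesis using level_le[of x a \<gamma>] by simp
qed

lemma level_ge_iff: "\<gamma> \<in> roots \<Longrightarrow> k \<le> level \<gamma> \<longleftrightarrow> (\<forall>a<k. \<forall>x\<in>I. dft a \<gamma> x = 0)"
  using dft_below_level[of _ \<gamma>] dft_level[of \<gamma>] by (meson not_less order_less_le_trans)

lemma level_eqI:
  assumes "\<And>a x. \<lbrakk>a < k; x \<in> I\<rbrakk> \<Longrightarrow> dft a \<gamma> x = 0" "x \<in> I" "dft k \<gamma> x \<noteq> 0" "\<gamma> \<in> roots"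
  shows "level \<gamma> = k"
  using level_le[OF assms(2,3)] level_ge_iff[OF assms(4)] assms(1) by (metis antisym)

lemma level_cong:
  assumes "\<And>a x. x \<in> I \<Longrightarrow> dft a \<gamma> x = 0 \<longleftrightarrow> dft a \<delta> x = 0"
  shows "level \<gamma> = level \<delta>"
  unfolding level_def using assms by (metis (no_types, lifting))

lemma level_twist [simp]: "\<gamma> \<in> roots \<Longrightarrow> level (twist w \<gamma>) = level \<gamma>"
  by (rule level_cong) (simp add: dft_twist)

lemma level_twist_pow [simp]: "\<gamma> \<in> roots \<Longrightarrow> level ((twist w ^^ n) \<gamma>) = level \<gamma>"
  by (induction n) simp_all

lemma dft_uminus: "dft a (- \<gamma>) x = - dft a \<gamma> x"
  by (simp add: dft_def twist_pow_uminus sum_negf)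

lemma level_uminus [simp]: "level (- \<gamma>) = level \<gamma>"
  by (rule level_cong) (simp add: dft_uminus)

lemma dft_act:
  assumes "\<gamma> \<in> roots"
  shows "dft a (act y \<gamma>) x = (\<Sum>s\<in>I. complex_of_real (\<gamma> s) * dft a (act y (simple_root s)) x)"
proof -
  have "act y \<gamma> = (\<lambda>x. \<Sum>s\<in>I. \<gamma> s * act y (simple_root s) x)"
    using act_root_expansion[OF assms] by blast
  then have pow: "(twist w ^^ i) (act y \<gamma>) x =
      (\<Sum>s\<in>I. \<gamma> s * (twist w ^^ i) (act y (simple_root s)) x)" for i
    by (simp only: twist_pow_sum[OF finite_I])
  have "dft a (act y \<gamma>) x = (\<Sum>i<d. \<Sum>s\<in>I. complex_of_real (\<gamma> s) *
      (cis (2 * pi * real a * real i / real d) *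
       complex_of_real ((twist w ^^ i) (act y (simple_root s)) x)))"
    unfolding dft_def pow by (simp add: sum_distrib_left mult.left_commute)
  also have "\<dots> = (\<Sum>s\<in>I. complex_of_real (\<gamma> s) * dft a (act y (simple_root s)) x)"
    unfolding dft_def sum_distrib_left by (rule sum.swap)
  finally show ?thesis .
qed

lemma twist_pow_surj:
  assumes "\<gamma> \<in> roots"
  shows "\<exists>\<delta>\<in>roots. (twist w ^^ i) \<delta> = \<gamma>"
proof -
  have mult: "(twist w ^^ (d * n)) \<gamma> = \<gamma>" for n
    using twist_pow_period[OF w_closed period assms]
    by (induction n) (simp_all add: funpow_add)
  have "i \<le> d * i" using d_pos by simp
  then have "(twist w ^^ i) ((twist w ^^ (d * i - i)) \<gamma>) = (twist w ^^ (d * i)) \<gamma>"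
    by (simp add: funpow_add[THEN fun_cong, unfolded comp_def, symmetric])
  then show ?thesis
    using mult assms by (metis twist_pow_in_roots w_closed)
qed

lemma twist_pow_inj: "inj_on (twist w ^^ i) roots"
proof (rule eq_card_imp_inj_on)
  have "(twist w ^^ i) ` roots = roots"
    using twist_pow_surj by (auto simp: image_iff) metis
  then show "card ((twist w ^^ i) ` roots) = card roots" by simp
qed simp

section \<open>The lower bound for the length\<close>

text \<open>The sum of coordinates is a linear functional whose sign on roots tells positive from
  negative. Along the orbit it gives a real sequence whose Fourier coefficients are combinations of
  \<open>dft a \<gamma> s\<close>, hence zero below the level.\<close>

lemma sign_changes_root:
  assumes y: "y \<in> carrier W" and \<gamma>: "\<gamma> \<in> roots"
  shows "2 * level \<gamma> \<le> card {i \<in> {..<d}. positive (act (inv y) ((twist w ^^ i) \<gamma>)) \<noteq>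
    positive (act (inv y) ((twist w ^^ Suc i) \<gamma>))}"
proof -
  define r where "r i = act (inv y) ((twist w ^^ i) \<gamma>)" for i
  define f where "f i = (\<Sum>x\<in>I. r i x)" for i
  have r: "r i \<in> roots" for i
    using y \<gamma> by (simp add: r_def)
  have f_pos: "f i > 0 \<longleftrightarrow> positive (r i)" "f i \<noteq> 0" for i
  proof -
    have pos: "(\<Sum>x\<in>I. \<delta> x) > 0" if \<delta>: "\<delta> \<in> roots" "positive \<delta>" for \<delta>
    proof -
      obtain x where "x \<in> I" "\<delta> x \<noteq> 0" using root_nonzero[OF \<delta>(1)] by blast
      then have "\<delta> x > 0" using \<delta>(2) by (simp add: positive_def order_less_le)
      then show ?thesis
        using \<delta>(2) \<open>x \<in> I\<close> by (intro sum_pos2[OF finite_I]) (auto simp: positive_def)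
    qed
    have neg: "f i < 0" if "\<not> positive (r i)"
      using pos[of "- r i"] that r[of i] positive_uminus_iff[OF r, of i] by (simp add: f_def sum_negf)
    have "f i > 0" if "positive (r i)"
      using pos[OF r that] by (simp add: f_def)
    then show "f i > 0 \<longleftrightarrow> positive (r i)" "f i \<noteq> 0"
      using neg by force+
  qed
  have "2 * level \<gamma> \<le> card {i \<in> {..<d}. f i * f (Suc i) < 0}"
  proof (rule sign_changes_ge)
    show "d > 0" by (rule d_pos)
    show "f d = f 0"
      using twist_pow_period[OF w_closed period \<gamma>] by (simp add: f_def r_def)
    show "f i \<noteq> 0" for i by (rule f_pos)
  next
    fix a \<phi> assume a: "a < level \<gamma>"
    define c where "c s = (\<Sum>x\<in>I. act (inv y) (simple_root s) x)" for s
    have f: "f i = (\<Sum>s\<in>I. c s * (twist w ^^ i) \<gamma> s)" for i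
    proof -
      have "f i = (\<Sum>x\<in>I. \<Sum>s\<in>I. (twist w ^^ i) \<gamma> s * act (inv y) (simple_root s) x)"
        using \<gamma> by (simp add: f_def r_def act_root_expansion)
      also have "\<dots> = (\<Sum>s\<in>I. \<Sum>x\<in>I. (twist w ^^ i) \<gamma> s * act (inv y) (simple_root s) x)"
        by (rule sum.swap)
      finally show ?thesis
        by (simp add: c_def mult.commute flip: sum_distrib_left)
    qed
    have "(\<Sum>i<d. complex_of_real (f i) * cis (2 * pi * real a * real i / real d)) =
        (\<Sum>i<d. \<Sum>s\<in>I. complex_of_real (c s) * (cis (2 * pi * real a * real i / real d) *
          complex_of_real ((twist w ^^ i) \<gamma> s)))"
      by (simp add: f sum_distrib_right sum_distrib_left mult_ac)
    also have "\<dots> = (\<Sum>s\<in>I. complex_of_real (c s) * dft a \<gamma> s)"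
      unfolding dft_def sum_distrib_left by (rule sum.swap)
    also have "\<dots> = 0"
      using a by (simp add: dft_below_level)
    \<comment> \<open>Multiplying by \<open>cis \<phi>\<close> before taking real parts gives the
      orthogonality for all phases at once.\<close>
    finally have "0 = (\<Sum>i<d. complex_of_real (f i) * cis (2 * pi * real a * real i / real d)) * cis \<phi>"
      by simp
    also have "\<dots> = (\<Sum>i<d. complex_of_real (f i) * cis (2 * pi * real a * real i / real d + \<phi>))"
      by (simp add: sum_distrib_right mult.assoc cis_mult)
    finally have "Re (\<Sum>i<d. complex_of_real (f i) * cis (2 * pi * real a * real i / real d + \<phi>)) = 0"
      by simp
    then show "(\<Sum>i<d. f i * cos (2 * pi * real a * real i / real d + \<phi>)) = 0"
      by simp
  qed
  also have "{i \<in> {..<d}. f i * f (Suc i) < 0} = {i \<in> {..<d}. positive (r i) \<noteq> positive (r (Suc i))}"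
  proof -
    have "f i < 0 \<longleftrightarrow> \<not> positive (r i)" for i
      using f_pos[of i] by (metis linorder_neqE_linordered_idom order_less_asym)
    then show ?thesis
      using f_pos(1) by (auto simp: mult_less_0_iff)
  qed
  finally show ?thesis unfolding r_def .
qed

text \<open>Pairs (i, \<gamma>) with a change of sign are counted twice. For fixed \<gamma> there
  are at least twice the level; for fixed i the map (w \<sigma>)^(i+1) carries the roots becoming
  positive onto the hyperplanes separating y from w \<sigma>(y), and their negatives are the roots
  ceasing to be positive.\<close>

lemma length_lower_bound:
  assumes y: "y \<in> carrier W"
  shows "(\<Sum>\<gamma>\<in>roots. level \<gamma>) \<le> d * len (inv y \<otimes> w \<otimes> \<sigma> y)"
proof -
  define p where "p i \<gamma> = positive (act (inv y) ((twist w ^^ i) \<gamma>))" for i \<gamma>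
  let ?y' = "w \<otimes> \<sigma> y"
  let ?l = "len (inv y \<otimes> w \<otimes> \<sigma> y)"
  have p_uminus: "p i (- \<gamma>) \<longleftrightarrow> \<not> p i \<gamma>" if "\<gamma> \<in> roots" for i \<gamma>
    using that y by (simp add: p_def twist_pow_uminus act_uminus positive_uminus_iff)
  have up: "card {\<gamma> \<in> roots. \<not> p i \<gamma> \<and> p (Suc i) \<gamma>} = ?l" for i
  proof -
    have "separating y ?y' = (twist w ^^ Suc i) ` {\<gamma> \<in> roots. \<not> p i \<gamma> \<and> p (Suc i) \<gamma>}"
    proof -
      have eq: "positive (act (inv ?y') ((twist w ^^ Suc i) \<gamma>)) \<longleftrightarrow> p i \<gamma>" if \<gamma>: "\<gamma> \<in> roots" for \<gamma>
      proof -
        let ?\<delta> = "(twist w ^^ i) \<gamma>"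
        have "act (inv ?y') ((twist w ^^ Suc i) \<gamma>) = act (inv (\<sigma> y)) (permute ?\<delta>)"
          using y by (simp add: twist_def inv_mult_group act_mult)
        also have "\<dots> = permute (act (inv y) ?\<delta>)"
          using y by (simp add: permute_act)
        finally show ?thesis
          using y \<gamma> by (simp add: p_def del: funpow.simps)
      qed
      show ?thesis
      proof (intro equalityI subsetI)
        fix \<gamma> assume \<gamma>: "\<gamma> \<in> separating y ?y'"
        then obtain \<delta> where \<delta>: "\<delta> \<in> roots" "(twist w ^^ Suc i) \<delta> = \<gamma>"
          using twist_pow_surj[of \<gamma> "Suc i"] by (auto simp: separating_def)
        then have "\<delta> \<in> {\<gamma> \<in> roots. \<not> p i \<gamma> \<and> p (Suc i) \<gamma>}"
          using \<gamma> eq[OF \<delta>(1)] by (simp add: separating_def p_def del: funpow.simps)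
        then show "\<gamma> \<in> (twist w ^^ Suc i) ` {\<gamma> \<in> roots. \<not> p i \<gamma> \<and> p (Suc i) \<gamma>}"
          using \<delta>(2) by blast
      next
        fix \<gamma> assume "\<gamma> \<in> (twist w ^^ Suc i) ` {\<gamma> \<in> roots. \<not> p i \<gamma> \<and> p (Suc i) \<gamma>}"
        then obtain \<delta> where \<delta>: "\<delta> \<in> roots" "\<not> p i \<delta>" "p (Suc i) \<delta>" "\<gamma> = (twist w ^^ Suc i) \<delta>"
          by blast
        then show "\<gamma> \<in> separating y ?y'"
          using eq[OF \<delta>(1)] twist_pow_in_roots[OF w_closed \<delta>(1), of "Suc i"]
          by (simp add: separating_def p_def del: funpow.simps)
      qed
    qed
    moreover have "inj_on (twist w ^^ Suc i) {\<gamma> \<in> roots. \<not> p i \<gamma> \<and> p (Suc i) \<gamma>}"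
      by (rule inj_on_subset[OF twist_pow_inj]) blast
    ultimately have "card {\<gamma> \<in> roots. \<not> p i \<gamma> \<and> p (Suc i) \<gamma>} = card (separating y ?y')"
      by (simp only: card_image)
    then show ?thesis
      using y by (simp add: card_separating m_assoc)
  qed
  have down: "card {\<gamma> \<in> roots. p i \<gamma> \<and> \<not> p (Suc i) \<gamma>} = ?l" for i
  proof -
    have "{\<gamma> \<in> roots. p i \<gamma> \<and> \<not> p (Suc i) \<gamma>} = uminus ` {\<gamma> \<in> roots. \<not> p i \<gamma> \<and> p (Suc i) \<gamma>}"
    proof (intro equalityI subsetI)
      fix \<gamma> assume \<gamma>: "\<gamma> \<in> {\<gamma> \<in> roots. p i \<gamma> \<and> \<not> p (Suc i) \<gamma>}"
      have "\<gamma> = - (- \<gamma>)" by (simp add: fun_Compl_def)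
      moreover have "- \<gamma> \<in> {\<gamma> \<in> roots. \<not> p i \<gamma> \<and> p (Suc i) \<gamma>}"
        using \<gamma> p_uminus[of \<gamma>] uminus_in_roots[of \<gamma>] by blast
      ultimately show "\<gamma> \<in> uminus ` {\<gamma> \<in> roots. \<not> p i \<gamma> \<and> p (Suc i) \<gamma>}" by blast
    next
      fix \<gamma> assume "\<gamma> \<in> uminus ` {\<gamma> \<in> roots. \<not> p i \<gamma> \<and> p (Suc i) \<gamma>}"
      then show "\<gamma> \<in> {\<gamma> \<in> roots. p i \<gamma> \<and> \<not> p (Suc i) \<gamma>}"
        using p_uminus uminus_in_roots by blast
    qed
    moreover have "inj_on uminus A" for A :: "('a \<Rightarrow> real) set"
      by (rule inj_on_inverseI[of _ uminus]) (simp add: fun_Compl_def)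
    ultimately show ?thesis using up[of i] by (simp only: card_image)
  qed
  have "(\<Sum>\<gamma>\<in>roots. 2 * level \<gamma>) \<le> (\<Sum>\<gamma>\<in>roots. card {i \<in> {..<d}. p i \<gamma> \<noteq> p (Suc i) \<gamma>})"
    using sign_changes_root[OF y] unfolding p_def by (rule sum_mono)
  also have "\<dots> = (\<Sum>\<gamma>\<in>roots. \<Sum>i<d. if p i \<gamma> \<noteq> p (Suc i) \<gamma> then 1 else 0)"
    by (simp only: card_eq_sum sum.inter_filter[OF finite_lessThan])
  also have "\<dots> = (\<Sum>i<d. \<Sum>\<gamma>\<in>roots. if p i \<gamma> \<noteq> p (Suc i) \<gamma> then 1 else 0)"
    by (rule sum.swap)
  also have "\<dots> = (\<Sum>i<d. card {\<gamma> \<in> roots. p i \<gamma> \<noteq> p (Suc i) \<gamma>})"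
    by (simp only: card_eq_sum sum.inter_filter[OF finite_roots])
  also have "\<dots> = (\<Sum>i<d. 2 * ?l)"
  proof (rule sum.cong)
    fix i
    have "{\<gamma> \<in> roots. p i \<gamma> \<noteq> p (Suc i) \<gamma>} =
        {\<gamma> \<in> roots. \<not> p i \<gamma> \<and> p (Suc i) \<gamma>} \<union> {\<gamma> \<in> roots. p i \<gamma> \<and> \<not> p (Suc i) \<gamma>}"
      by blast
    moreover have "{\<gamma> \<in> roots. \<not> p i \<gamma> \<and> p (Suc i) \<gamma>} \<inter> {\<gamma> \<in> roots. p i \<gamma> \<and> \<not> p (Suc i) \<gamma>} = {}"
      by blast
    ultimately have "card {\<gamma> \<in> roots. p i \<gamma> \<noteq> p (Suc i) \<gamma>} =
        card {\<gamma> \<in> roots. \<not> p i \<gamma> \<and> p (Suc i) \<gamma>} + card {\<gamma> \<in> roots. p i \<gamma> \<and> \<not> p (Suc i) \<gamma>}"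
      by (simp add: card_Un_disjoint)
    then show "card {\<gamma> \<in> roots. p i \<gamma> \<noteq> p (Suc i) \<gamma>} = 2 * ?l"
      by (simp only: up down mult_2)
  qed simp
  finally show ?thesis
    by (simp flip: sum_distrib_left)
qed

lemma generic_covector_exists:
  "\<exists>v. \<forall>\<gamma>\<in>roots. Re (\<Sum>x\<in>I. v x * dft (level \<gamma>) \<gamma> x) \<noteq> 0"
proof -
  have "\<exists>v. \<forall>g\<in>(\<lambda>\<gamma>. dft (level \<gamma>) \<gamma>) ` roots. Re (\<Sum>x\<in>I. v x * g x) \<noteq> 0"
    by (rule generic_covector) (use finite_I dft_level in auto)
  then show ?thesis by blast
qed

end

section \<open>Chambers and galleries\<close>

text \<open>A state \<open>t\<close> assigns to each level \<open>a\<close> a time: the component of the generic covector \<open>v\<close> at level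
  \<open>a\<close> has been rotated by the angle \<open>pi * t a\<close>. The chamber of a state is found by comparing the
  components lexicographically, so that a root only sees the component at its own level. In
  particular changes of the state at different levels commute.\<close>

locale twisted_covector = twisted_element +
  fixes v :: "'a \<Rightarrow> complex"
  assumes generic: "\<gamma> \<in> roots \<Longrightarrow> Re (\<Sum>x\<in>I. v x * dft (level \<gamma>) \<gamma> x) \<noteq> 0"
begin

text \<open>Time is measured in half turns: advancing \<open>t\<close> by 1 negates the
  component.\<close>

definition phase :: "nat \<Rightarrow> real \<Rightarrow> ('a \<Rightarrow> real) \<Rightarrow> real"
  where "phase a t \<gamma> = Re (cis (pi * t) * (\<Sum>x\<in>I. v x * dft a \<gamma> x))"

definition height :: "(nat \<Rightarrow> real) \<Rightarrow> ('a \<Rightarrow> real) \<Rightarrow> real"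
  where "height t \<gamma> = phase (level \<gamma>) (t (level \<gamma>)) \<gamma>"

definition regular :: "(nat \<Rightarrow> real) \<Rightarrow> bool"
  where "regular t \<longleftrightarrow> (\<forall>\<gamma>\<in>roots. height t \<gamma> \<noteq> 0)"

definition is_chamber :: "(nat \<Rightarrow> real) \<Rightarrow> 'a \<Rightarrow> bool"
  where "is_chamber t x \<longleftrightarrow>
    x \<in> carrier W \<and> (\<forall>\<gamma>\<in>roots. height t \<gamma> > 0 \<longleftrightarrow> positive (act (inv x) \<gamma>))"

definition chamber :: "(nat \<Rightarrow> real) \<Rightarrow> 'a"
  where "chamber t = (SOME x. is_chamber t x)"

lemma phase_uminus: "phase a t (- \<gamma>) = - phase a t \<gamma>"
  by (simp add: phase_def dft_uminus sum_negf)

lemma phase_below_level: "a < level \<gamma> \<Longrightarrow> phase a t \<gamma> = 0"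
  by (simp add: phase_def dft_below_level)

lemma phase_act:
  assumes "\<gamma> \<in> roots"
  shows "phase a t (act y \<gamma>) = (\<Sum>s\<in>I. \<gamma> s * phase a t (act y (simple_root s)))"
proof -
  have "cis (pi * t) * (\<Sum>x\<in>I. v x * dft a (act y \<gamma>) x) =
      (\<Sum>x\<in>I. \<Sum>s\<in>I. complex_of_real (\<gamma> s) * (cis (pi * t) * (v x * dft a (act y (simple_root s)) x)))"
    by (simp add: dft_act[OF assms] sum_distrib_left mult_ac)
  also have "\<dots> = (\<Sum>s\<in>I. \<Sum>x\<in>I. complex_of_real (\<gamma> s) * (cis (pi * t) * (v x * dft a (act y (simple_root s)) x)))"
    by (rule sum.swap)
  also have "\<dots> = (\<Sum>s\<in>I. complex_of_real (\<gamma> s) * (cis (pi * t) * (\<Sum>x\<in>I. v x * dft a (act y (simple_root s)) x)))"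
    by (simp only: sum_distrib_left)
  finally have eq: "cis (pi * t) * (\<Sum>x\<in>I. v x * dft a (act y \<gamma>) x) =
    (\<Sum>s\<in>I. complex_of_real (\<gamma> s) * (cis (pi * t) * (\<Sum>x\<in>I. v x * dft a (act y (simple_root s)) x)))" .
  have "Re (complex_of_real r * z) = r * Re z" for r z by simp
  then show ?thesis
    unfolding phase_def eq Re_sum by (simp only:)
qed

lemma height_uminus: "height t (- \<gamma>) = - height t \<gamma>"
  by (simp add: height_def phase_uminus)

text \<open>The convexity needed for \<open>chamber_exists\<close>. Let k be the lowest level among
  the simple roots occurring in \<gamma>. At k all contributions are non-negative and one is
  positive, so nothing cancels and the image of \<gamma> has level exactly k.\<close>

lemma height_act_pos:
  assumes y: "y \<in> carrier W" and simple: "\<And>s. s \<in> I \<Longrightarrow> height t (act y (simple_root s)) > 0"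
    and \<gamma>: "\<gamma> \<in> roots" "positive \<gamma>"
  shows "height t (act y \<gamma>) > 0"
proof -
  define S where "S = {s \<in> I. \<gamma> s \<noteq> 0}"
  define l where "l s = level (act y (simple_root s))" for s
  have S: "finite S" "S \<noteq> {}"
    using finite_I root_nonzero[OF \<gamma>(1)] by (auto simp: S_def)
  define k where "k = Min (l ` S)"
  have k_le: "k \<le> l s" if "s \<in> S" for s
    using S that by (simp add: k_def)
  obtain s0 where s0: "s0 \<in> S" "l s0 = k"
    using Min_in[of "l ` S"] S unfolding k_def by (metis (mono_tags, lifting) finite_imageI image_iff image_is_empty)
  have \<gamma>_nonneg: "\<gamma> s \<ge> 0" for s using \<gamma>(2) by (simp add: positive_def)
  have zero: "dft a (act y \<gamma>) x = 0" if "a < k" "x \<in> I" for a x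
    unfolding dft_act[OF \<gamma>(1)]
  proof (rule sum.neutral, rule ballI)
    fix s assume "s \<in> I"
    show "complex_of_real (\<gamma> s) * dft a (act y (simple_root s)) x = 0"
    proof (cases "s \<in> S")
      case True
      then have "a < l s" using k_le[of s] that by simp
      then show ?thesis using dft_below_level that by (simp add: l_def)
    next
      case False
      then show ?thesis using \<open>s \<in> I\<close> by (simp add: S_def)
    qed
  qed
  have at_k: "phase k (t k) (act y (simple_root s)) > 0" if "s \<in> I" "l s = k" for s
    using simple[OF that(1)] that(2) by (simp add: height_def l_def)
  have "phase k (t k) (act y \<gamma>) > 0"
    unfolding phase_act[OF \<gamma>(1)]
  proof (rule sum_pos2[OF finite_I, of s0])
    show "s0 \<in> I" using s0 by (simp add: S_def)
    then show "0 < \<gamma> s0 * phase k (t k) (act y (simple_root s0))"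
      using at_k[of s0] s0 \<gamma>_nonneg[of s0] by (simp add: S_def order_less_le)
    fix s assume s: "s \<in> I"
    show "0 \<le> \<gamma> s * phase k (t k) (act y (simple_root s))"
    proof (cases "s \<in> S")
      case True
      then consider "l s = k" | "k < l s" using k_le[of s] by fastforce
      then show ?thesis
      proof cases
        case 1
        then show ?thesis using at_k[OF s] \<gamma>_nonneg[of s] by simp
      next
        case 2
        then show ?thesis by (simp add: phase_below_level l_def)
      qed
    next
      case False
      then show ?thesis using s by (simp add: S_def)
    qed
  qed
  moreover from this have "\<exists>x\<in>I. dft k (act y \<gamma>) x \<noteq> 0"
    by (metis (no_types, lifting) dft_below_level level_le not_less phase_below_level
        order_less_irrefl level_ge_iff act_in_roots[OF \<gamma>(1) y] dft_level zero le_neq_implies_less)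
  then have "level (act y \<gamma>) = k"
    using level_eqI[of k "act y \<gamma>"] zero y \<gamma> by auto
  ultimately show ?thesis by (simp add: height_def)
qed

lemma is_chamber_chamber:
  assumes "regular t"
  shows "is_chamber t (chamber t)"
proof -
  have "\<exists>x\<in>carrier W. \<forall>\<gamma>\<in>roots. height t \<gamma> > 0 \<longleftrightarrow> positive (act (inv x) \<gamma>)"
  proof (rule chamber_exists)
    fix \<gamma> assume "\<gamma> \<in> roots"
    then have "height t \<gamma> \<noteq> 0" using assms by (simp add: regular_def)
    then show "height t (- \<gamma>) > 0 \<longleftrightarrow> \<not> height t \<gamma> > 0"
      by (auto simp: height_uminus)
  qed (rule height_act_pos)
  then have "\<exists>x. is_chamber t x" by (auto simp: is_chamber_def)
  then show ?thesis unfolding chamber_def by (rule someI_ex)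
qed

lemma chamber_closed [simp]: "regular t \<Longrightarrow> chamber t \<in> carrier W"
  using is_chamber_chamber by (simp add: is_chamber_def)

lemma chamber_sign: "\<lbrakk>regular t; \<gamma> \<in> roots\<rbrakk> \<Longrightarrow> positive (act (inv (chamber t)) \<gamma>) \<longleftrightarrow> height t \<gamma> > 0"
  using is_chamber_chamber by (simp add: is_chamber_def)

lemma chamber_eqI:
  assumes "regular t" "is_chamber t x"
  shows "chamber t = x"
proof (rule separating_empty)
  show "separating (chamber t) x = {}"
    using chamber_sign[OF assms(1)] assms(2) unfolding separating_def is_chamber_def by blast
qed (use assms in \<open>auto simp: is_chamber_def\<close>)

lemma phase_expand:
  "phase a t \<gamma> = cos (pi * t) * Re (\<Sum>x\<in>I. v x * dft a \<gamma> x) - sin (pi * t) * Im (\<Sum>x\<in>I. v x * dft a \<gamma> x)"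
  by (simp add: phase_def)

text \<open>The phase is a sinusoid of half period 1. The identity f(t) sin (pi (r - s)) + f(r) sin
  (pi (s - t)) = f(s) sin (pi (r - t)) shows that within one half period it cannot go from positive
  to negative and back.\<close>

lemma phase_no_return:
  assumes "t \<le> s" "s \<le> r" "r \<le> t + 1" "phase a t \<gamma> > 0" "phase a r \<gamma> > 0"
  shows "phase a s \<gamma> \<ge> 0"
proof (rule ccontr)
  assume neg: "\<not> ?thesis"
  have "sin (pi * x) \<ge> 0" if "0 \<le> x" "x \<le> 1" for x
    using that by (intro sin_ge_zero) (auto simp: mult_left_le)
  then have nonneg: "sin (pi * (r - s)) \<ge> 0" "sin (pi * (s - t)) \<ge> 0" "sin (pi * (r - t)) \<ge> 0"
    using assms by auto
  have "t \<noteq> s" using neg assms by auto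
  then have "0 < pi * (r - s) \<or> r = s" "pi * (r - s) < pi"
    using assms by auto
  moreover have "r \<noteq> s" using neg assms by auto
  ultimately have "sin (pi * (r - s)) > 0"
    by (intro sin_gt_zero) auto
  then have "phase a t \<gamma> * sin (pi * (r - s)) + phase a r \<gamma> * sin (pi * (s - t)) > 0"
    using assms nonneg by (simp add: add_pos_nonneg)
  moreover have "phase a t \<gamma> * sin (pi * (r - s)) + phase a r \<gamma> * sin (pi * (s - t)) =
      phase a s \<gamma> * sin (pi * (r - t))"
    unfolding phase_expand right_diff_distrib sin_diff by (simp add: algebra_simps)
  moreover have "phase a s \<gamma> * sin (pi * (r - t)) \<le> 0"
    using neg nonneg by (simp add: mult_nonpos_nonneg)
  ultimately show False by simp
qed

section \<open>Galleries through states, and their independence of the path\<close>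

definition gallery_step :: "(nat \<Rightarrow> real) \<Rightarrow> (nat \<Rightarrow> real) \<Rightarrow> 'a list set"
  where "gallery_step t s = lift (inv (chamber t) \<otimes> chamber s)"

lemma gallery_step_closed [simp]:
  "\<lbrakk>regular t; regular s\<rbrakk> \<Longrightarrow> gallery_step t s \<in> carrier braid_monoid"
  by (simp add: gallery_step_def)

lemma gallery_step_self: "regular t \<Longrightarrow> gallery_step t t = \<one>\<^bsub>braid_monoid\<^esub>"
  by (simp add: gallery_step_def lift_one)

text \<open>Since the states lie within one half turn at every level, \<open>phase_no_return\<close>
  forbids crossing a hyperplane and returning, which is the hypothesis of
  \<open>lift_merge\<close>.\<close>

lemma gallery_step_merge:
  assumes "regular t" "regular s" "regular r" "t \<le> s" "s \<le> r" "\<And>a. r a \<le> t a + 1"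
  shows "gallery_step t s \<otimes>\<^bsub>braid_monoid\<^esub> gallery_step s r = gallery_step t r"
  unfolding gallery_step_def
proof (rule lift_merge)
  fix \<gamma> assume \<gamma>: "\<gamma> \<in> roots" and "positive (act (inv (chamber t)) \<gamma>)"
    "\<not> positive (act (inv (chamber s)) \<gamma>)" "positive (act (inv (chamber r)) \<gamma>)"
  then have h: "height t \<gamma> > 0" "\<not> height s \<gamma> > 0" "height r \<gamma> > 0"
    using assms(1-3) by (simp_all add: chamber_sign)
  then have "height s \<gamma> \<ge> 0"
    using assms(4-6) unfolding height_def le_fun_def
    by (intro phase_no_return[of "t (level \<gamma>)" "s (level \<gamma>)" "r (level \<gamma>)"]) auto
  then show False
    using h assms(2) \<gamma> by (auto simp: regular_def)
qed (use assms in auto)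

primrec gallery :: "(nat \<Rightarrow> real) list \<Rightarrow> (nat \<Rightarrow> real) \<Rightarrow> 'a list set"
  where
    "gallery [] t = \<one>\<^bsub>braid_monoid\<^esub>"
  | "gallery (s # ts) t = gallery_step t s \<otimes>\<^bsub>braid_monoid\<^esub> gallery ts s"

primrec chain :: "(nat \<Rightarrow> real) list \<Rightarrow> (nat \<Rightarrow> real) \<Rightarrow> bool"
  where
    "chain [] t \<longleftrightarrow> regular t"
  | "chain (s # ts) t \<longleftrightarrow> regular t \<and> t \<le> s \<and> (\<forall>a. s a \<le> t a + 1) \<and> chain ts s"

lemma chain_regular: "chain ts t \<Longrightarrow> regular t"
  by (cases ts) auto

lemma chain_le_last: "chain ts t \<Longrightarrow> t \<le> last (t # ts)"
proof (induction ts arbitrary: t)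
  case (Cons s ts)
  then have "t \<le> s" "s \<le> last (s # ts)" by auto
  then have "t \<le> last (s # ts)" by (rule order_trans)
  then show ?case by simp
qed simp

lemma chain_le: "\<lbrakk>chain ts t; s \<in> set ts\<rbrakk> \<Longrightarrow> t \<le> s"
proof (induction ts arbitrary: t)
  case (Cons r ts)
  then have "t \<le> r" "s = r \<or> r \<le> s" by auto
  then show ?case by auto
qed simp

lemma gallery_closed [simp]: "chain ts t \<Longrightarrow> gallery ts t \<in> carrier braid_monoid"
proof (induction ts arbitrary: t)
  case Nil
  then show ?case using monoid.one_closed[OF monoid_braid_monoid] by simp
next
  case (Cons s ts)
  then have "regular s" by (auto dest: chain_regular)
  then show ?case
    using Cons monoid.m_closed[OF monoid_braid_monoid] by simp
qed

text \<open>At each level the supremum agrees with one of the two states, and a root sees no level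
  but its own. This independence of the levels carries the comparison of galleries.\<close>

lemma regular_sup:
  assumes "regular t" "regular s"
  shows "regular (sup t s)"
  unfolding regular_def
proof
  fix \<gamma> assume "\<gamma> \<in> roots"
  moreover have "sup t s (level \<gamma>) = t (level \<gamma>) \<or> sup t s (level \<gamma>) = s (level \<gamma>)"
    by (auto simp: sup_max max_def)
  ultimately show "height (sup t s) \<gamma> \<noteq> 0"
    using assms by (auto simp: regular_def height_def)
qed

text \<open>A diamond argument: the detour t, u, sup u s and the path t, s, sup u s both merge to
  the direct step from t to sup u s. Repeating this along the gallery pushes \<open>u\<close> to the
  end, where it is absorbed because it lies below the last state.\<close>

lemma gallery_insert:
  assumes "chain ts t" "regular u" "t \<le> u" "\<And>a. u a \<le> t a + 1" "u \<le> last (t # ts)"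
  shows "chain (map (sup u) ts) u \<and>
    gallery ts t = gallery_step t u \<otimes>\<^bsub>braid_monoid\<^esub> gallery (map (sup u) ts) u \<and>
    last (u # map (sup u) ts) = last (t # ts)"
  using assms
proof (induction ts arbitrary: t u)
  case Nil
  then have "t = u" by (simp add: antisym)
  then show ?case
    using Nil monoid.r_one[OF monoid_braid_monoid monoid.one_closed[OF monoid_braid_monoid]]
    by (simp add: gallery_step_self)
next
  case (Cons s ts)
  define u' where "u' = sup u s"
  have t: "regular t" "t \<le> s" "\<And>a. s a \<le> t a + 1" "chain ts s"
    using Cons.prems(1) by auto
  have s: "regular s" using t(4) by (rule chain_regular)
  have u': "regular u'" "s \<le> u'" "u \<le> u'"
    using regular_sup Cons.prems(2) s by (auto simp: u'_def)
  have u'_t: "u' a \<le> t a + 1" for a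
    using t(3)[of a] Cons.prems(4)[of a] by (simp add: u'_def)
  have u'_s: "u' a \<le> s a + 1" for a
    using Cons.prems(4)[of a] t(2) le_funD[of t s a] by (simp add: u'_def)
  have u'_u: "u' a \<le> u a + 1" for a
    using t(3)[of a] Cons.prems(3) le_funD[of t u a] by (simp add: u'_def)
  have "u' \<le> last (s # ts)"
    using chain_le_last[OF t(4)] Cons.prems(5) by (simp add: u'_def)
  note IH = Cons.IH[OF t(4) u'(1,2) u'_s this]
  \<comment> \<open>All later states lie above \<open>s\<close>, so taking the supremum with
    \<open>u'\<close> or with \<open>u\<close> makes no difference.\<close>
  have map_eq: "map (sup u') ts = map (sup u) ts"
  proof (rule map_cong)
    fix r assume "r \<in> set ts"
    then have "s \<le> r" by (rule chain_le[OF t(4)])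
    then show "sup u' r = sup u r"
      by (simp add: u'_def sup_assoc sup_absorb2)
  qed simp
  let ?R = "gallery (map (sup u) ts) u'"
  have R: "?R \<in> carrier braid_monoid" "chain (map (sup u) ts) u'"
    using IH gallery_closed unfolding map_eq by auto
  have "gallery (s # ts) t = gallery_step t s \<otimes>\<^bsub>braid_monoid\<^esub> (gallery_step s u' \<otimes>\<^bsub>braid_monoid\<^esub> ?R)"
    using IH unfolding map_eq by simp
  also have "\<dots> = gallery_step t u' \<otimes>\<^bsub>braid_monoid\<^esub> ?R"
    using gallery_step_merge[OF t(1) s u'(1) t(2) u'(2) u'_t] R(1) t(1) s u'(1)
    by (simp flip: monoid.m_assoc[OF monoid_braid_monoid])
  also have "\<dots> = gallery_step t u \<otimes>\<^bsub>braid_monoid\<^esub> (gallery_step u u' \<otimes>\<^bsub>braid_monoid\<^esub> ?R)"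
    using gallery_step_merge[OF t(1) Cons.prems(2) u'(1) Cons.prems(3) u'(3) u'_t] R(1) t(1) u'(1) Cons.prems(2)
    by (simp flip: monoid.m_assoc[OF monoid_braid_monoid])
  finally have "gallery (s # ts) t =
      gallery_step t u \<otimes>\<^bsub>braid_monoid\<^esub> gallery (map (sup u) (s # ts)) u"
    by (simp add: u'_def)
  moreover have "chain (map (sup u) (s # ts)) u"
    using R(2) Cons.prems(2) u'(3) u'_u by (simp add: u'_def)
  moreover have "last (u # map (sup u) (s # ts)) = last (t # s # ts)"
  proof -
    have "last (u # map (sup u) (s # ts)) = last (u' # map (sup u) ts)"
      by (simp only: list.map last.simps list.distinct if_False u'_def)
    also have "\<dots> = last (s # ts)"
      using IH unfolding map_eq by blast
    finally show ?thesis by simp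
  qed
  ultimately show ?case by blast
qed

lemma gallery_trivial: "\<lbrakk>chain ts t; last (t # ts) = t\<rbrakk> \<Longrightarrow> gallery ts t = \<one>\<^bsub>braid_monoid\<^esub>"
proof (induction ts)
  case (Cons s ts)
  then have "s \<le> t"
    using chain_le_last[of ts s] by simp
  then have "s = t" using Cons.prems(1) by (simp add: antisym)
  then show ?case
    using Cons monoid.r_one[OF monoid_braid_monoid monoid.one_closed[OF monoid_braid_monoid]]
    by (simp add: gallery_step_self)
qed simp

text \<open>Induction over the second gallery: its first state is inserted into the first gallery,
  after which both begin with the same step.\<close>

lemma gallery_unique:
  assumes "chain ts t" "chain ts' t" "last (t # ts) = last (t # ts')"
  shows "gallery ts t = gallery ts' t"
  using assms
proof (induction ts' arbitrary: t ts)
  case Nil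
  then show ?case using gallery_trivial[of ts t] by simp
next
  case (Cons u us)
  have u: "regular u" "t \<le> u" "\<And>a. u a \<le> t a + 1" "chain us u"
    using Cons.prems(2) chain_regular by auto
  have "u \<le> last (t # ts)"
    using chain_le_last[OF u(4)] Cons.prems(3) by simp
  note ins = gallery_insert[OF Cons.prems(1) u(1,2,3) this]
  have "gallery (map (sup u) ts) u = gallery us u"
    using Cons.IH[of "map (sup u) ts" u] ins u(4) Cons.prems(3) by simp
  then show ?case using ins by simp
qed

lemma gallery_map:
  "gallery (map (\<lambda>i. f (Suc i)) [0..<n]) (f 0) =
    mprod braid_monoid (map (\<lambda>i. gallery_step (f i) (f (Suc i))) [0..<n])"
proof (induction n arbitrary: f)
  case (Suc n)
  have "[0..<Suc n] = 0 # map Suc [0..<n]"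
    by (simp only: upt_conv_Cons[OF zero_less_Suc] map_Suc_upt)
  then show ?case
    using Suc[of "\<lambda>i. f (Suc i)"] by (simp del: upt_Suc add: comp_def)
qed simp

lemma chain_map:
  "\<lbrakk>\<And>i. i \<le> n \<Longrightarrow> regular (f i); \<And>i. i < n \<Longrightarrow> f i \<le> f (Suc i);
    \<And>i a. i < n \<Longrightarrow> f (Suc i) a \<le> f i a + 1\<rbrakk> \<Longrightarrow> chain (map (\<lambda>i. f (Suc i)) [0..<n]) (f 0)"
proof (induction n arbitrary: f)
  case (Suc n)
  have "[0..<Suc n] = 0 # map Suc [0..<n]"
    by (simp only: upt_conv_Cons[OF zero_less_Suc] map_Suc_upt)
  then show ?case
    using Suc.IH[of "\<lambda>i. f (Suc i)"] Suc.prems by (simp del: upt_Suc add: comp_def)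
qed simp

lemma last_map_upt: "last (f 0 # map (\<lambda>i. f (Suc i)) [0..<n]) = f n"
  by (cases n) simp_all

lemma mprod_gallery_step_unique:
  assumes f: "\<And>i. i \<le> n \<Longrightarrow> regular (f i)" "\<And>i. i < n \<Longrightarrow> f i \<le> f (Suc i)"
      "\<And>i a. i < n \<Longrightarrow> f (Suc i) a \<le> f i a + 1"
    and g: "\<And>i. i \<le> m \<Longrightarrow> regular (g i)" "\<And>i. i < m \<Longrightarrow> g i \<le> g (Suc i)"
      "\<And>i a. i < m \<Longrightarrow> g (Suc i) a \<le> g i a + 1"
    and ends: "f 0 = g 0" "f n = g m"
  shows "mprod braid_monoid (map (\<lambda>i. gallery_step (f i) (f (Suc i))) [0..<n]) =
    mprod braid_monoid (map (\<lambda>i. gallery_step (g i) (g (Suc i))) [0..<m])"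
proof -
  have "gallery (map (\<lambda>i. f (Suc i)) [0..<n]) (f 0) = gallery (map (\<lambda>i. g (Suc i)) [0..<m]) (f 0)"
  proof (rule gallery_unique)
    show "chain (map (\<lambda>i. f (Suc i)) [0..<n]) (f 0)" using f by (rule chain_map)
    have "chain (map (\<lambda>i. g (Suc i)) [0..<m]) (g 0)" using g by (rule chain_map)
    then show "chain (map (\<lambda>i. g (Suc i)) [0..<m]) (f 0)" by (simp only: ends)
    have "last (f 0 # map (\<lambda>i. g (Suc i)) [0..<m]) = g m"
      unfolding ends(1) by (rule last_map_upt)
    then show "last (f 0 # map (\<lambda>i. f (Suc i)) [0..<n]) = last (f 0 # map (\<lambda>i. g (Suc i)) [0..<m])"
      using last_map_upt[of f n] ends(2) by presburger
  qed
  then show ?thesis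
    using gallery_map[of f n] gallery_map[of g m] ends(1) by simp
qed

end

context twisted_covector
begin

section \<open>Two galleries with the same ends\<close>

definition base :: 'a
  where "base = chamber (\<lambda>_. 0)"

lemma phase_nat: "phase a (real n) \<gamma> = (-1) ^ n * phase a 0 \<gamma>"
proof -
  have "cos (pi * real n) = (-1) ^ n" "sin (pi * real n) = 0"
    by (simp_all add: cos_npi sin_npi mult.commute)
  then show ?thesis by (simp add: phase_expand)
qed

lemma phase_0_nonzero: "\<gamma> \<in> roots \<Longrightarrow> phase (level \<gamma>) 0 \<gamma> \<noteq> 0"
  using generic[of \<gamma>] by (simp add: phase_expand del: Re_sum)

lemma regular_0 [simp]: "regular (\<lambda>_. 0)"
  by (simp add: regular_def height_def phase_0_nonzero)

lemma base_closed [simp]: "base \<in> carrier W"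
  by (simp add: base_def)

lemma positive_iff_phase:
  "\<gamma> \<in> roots \<Longrightarrow> positive (act (inv base) \<gamma>) \<longleftrightarrow> phase (level \<gamma>) 0 \<gamma> > 0"
  by (simp add: base_def chamber_sign height_def)

text \<open>In half turns, frequency a advances by 2 a / d per step, which is at most 1. Frequencies
  above d / 2 are not levels; they rest at 0 so that the step bound holds for every a.\<close>

definition rotation_state :: "nat \<Rightarrow> nat \<Rightarrow> real"
  where "rotation_state i a = (if 2 * a \<le> d then 2 * real a * real i / real d else 0)"

lemma phase_twist:
  assumes "\<gamma> \<in> roots"
  shows "phase a (t + 2 * real a / real d) (twist w \<gamma>) = phase a t \<gamma>"
proof -
  have "pi * (t + 2 * real a / real d) + - (2 * pi * real a / real d) = pi * t"
    by (simp add: distrib_left)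
  then have "cis (pi * (t + 2 * real a / real d)) * cis (- (2 * pi * real a / real d)) = cis (pi * t)"
    by (simp only: cis_mult)
  moreover have "(\<Sum>x\<in>I. v x * (cis (- (2 * pi * real a / real d)) * dft a \<gamma> x)) =
      cis (- (2 * pi * real a / real d)) * (\<Sum>x\<in>I. v x * dft a \<gamma> x)"
    by (simp only: mult.left_commute[of _ "cis (- (2 * pi * real a / real d))"] sum_distrib_left)
  ultimately have "cis (pi * (t + 2 * real a / real d)) *
      (\<Sum>x\<in>I. v x * (cis (- (2 * pi * real a / real d)) * dft a \<gamma> x)) =
      cis (pi * t) * (\<Sum>x\<in>I. v x * dft a \<gamma> x)"
    by (simp only: mult.assoc[symmetric])
  then show ?thesis
    unfolding phase_def dft_twist[OF assms] by (simp only:)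
qed

lemma phase_twist_pow:
  assumes "\<gamma> \<in> roots"
  shows "phase a (2 * real a * real i / real d) ((twist w ^^ i) \<gamma>) = phase a 0 \<gamma>"
proof (induction i)
  case (Suc i)
  have "2 * real a * real (Suc i) / real d = 2 * real a * real i / real d + 2 * real a / real d"
    by (simp add: distrib_left add_divide_distrib)
  then show ?case
    using phase_twist[of "(twist w ^^ i) \<gamma>" a "2 * real a * real i / real d"] Suc assms by simp
qed simp

lemma height_rotation_state:
  "\<gamma> \<in> roots \<Longrightarrow> height (rotation_state i) ((twist w ^^ i) \<gamma>) = phase (level \<gamma>) 0 \<gamma>"
  using level_bound[of \<gamma>] by (simp add: height_def rotation_state_def phase_twist_pow)

lemma regular_rotation_state [simp]: "regular (rotation_state i)"
  unfolding regular_def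
proof
  fix \<gamma> assume "\<gamma> \<in> roots"
  then obtain \<delta> where "\<delta> \<in> roots" "(twist w ^^ i) \<delta> = \<gamma>"
    using twist_pow_surj[of \<gamma> i] by blast
  then show "height (rotation_state i) \<gamma> \<noteq> 0"
    using height_rotation_state[of \<delta> i] phase_0_nonzero[of \<delta>] by simp
qed

text \<open>Rotating by 2 a / d at each level a compensates the eigenvalue of w \<sigma>. So state i
  is the initial state transported by (w \<sigma>)^i, and its chamber is the image of
  \<open>base\<close>.\<close>

lemma chamber_rotation_state:
  "chamber (rotation_state i) = twisted_power w i \<otimes> (\<sigma> ^^ i) base"
proof (rule chamber_eqI)
  let ?x = "twisted_power w i \<otimes> (\<sigma> ^^ i) base"
  show "is_chamber (rotation_state i) ?x"
    unfolding is_chamber_def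
  proof (intro conjI ballI)
    fix \<gamma> assume "\<gamma> \<in> roots"
    then obtain \<delta> where \<delta>: "\<delta> \<in> roots" "(twist w ^^ i) \<delta> = \<gamma>"
      using twist_pow_surj[of \<gamma> i] by blast
    have "act (inv ?x) \<gamma> = act (inv ((\<sigma> ^^ i) base)) ((permute ^^ i) \<delta>)"
      unfolding \<delta>(2)[symmetric] twist_pow[OF w_closed] by (simp add: inv_mult_group act_mult)
    also have "\<dots> = (permute ^^ i) (act (inv base) \<delta>)"
      by (simp add: permute_pow_act)
    finally have "positive (act (inv ?x) \<gamma>) \<longleftrightarrow> positive (act (inv base) \<delta>)"
      using \<delta>(1) by simp
    then show "0 < height (rotation_state i) \<gamma> \<longleftrightarrow> positive (act (inv ?x) \<gamma>)"
      using positive_iff_phase[OF \<delta>(1)] height_rotation_state[OF \<delta>(1), of i] \<delta>(2) by simp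
  qed simp
qed simp

text \<open>The relative position of the chamber \<open>base\<close> and its image under w
  \<sigma>.\<close>

definition good_element :: 'a
  where "good_element = inv base \<otimes> w \<otimes> \<sigma> base"

lemma good_element_closed [simp]: "good_element \<in> carrier W"
  by (simp add: good_element_def)

lemma rotation_state_step:
  "inv (chamber (rotation_state i)) \<otimes> chamber (rotation_state (Suc i)) = (\<sigma> ^^ i) good_element"
proof -
  have "(\<sigma> ^^ i) (\<sigma> base) = (\<sigma> ^^ Suc i) base" by (simp only: funpow_Suc_right comp_def)
  then show ?thesis
    by (simp add: chamber_rotation_state good_element_def twisted_power_Suc inv_mult_group m_assoc
        del: funpow.simps)
qed

text \<open>Level a makes 2 a half turns and then rests, ending where
  \<open>rotation_state d\<close> ends. The two steps from 2 k to 2 k + 2 both advance exactly the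
  levels above k, and at even n all levels have made whole turns.\<close>

definition flip_state :: "nat \<Rightarrow> nat \<Rightarrow> real"
  where "flip_state n a = (if 2 * a \<le> d then real (min (2 * a) n) else 0)"

lemma height_flip_state:
  "\<gamma> \<in> roots \<Longrightarrow> height (flip_state n) \<gamma> =
    (if even n \<or> 2 * level \<gamma> < n then 1 else - 1) * phase (level \<gamma>) 0 \<gamma>"
  using level_bound[of \<gamma>]
  by (auto simp: height_def flip_state_def phase_nat min_def simp del: of_nat_mult)

lemma regular_flip_state [simp]: "regular (flip_state n)"
  by (auto simp: regular_def height_flip_state phase_0_nonzero)

lemma chamber_flip_state_even: "even n \<Longrightarrow> chamber (flip_state n) = base"
  by (rule chamber_eqI) (auto simp: is_chamber_def height_flip_state positive_iff_phase)

text \<open>The walls of the chamber \<open>base\<close> of level at least k, named by simple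
  reflections. The parabolic subgroup that they generate acts, seen from \<open>base\<close>,
  without affecting components of frequency below k; the sets decrease with k.\<close>

definition level_simples :: "nat \<Rightarrow> 'a set"
  where "level_simples k = {s \<in> I. k \<le> level (act base (simple_root s))}"

lemma level_simples_subset: "level_simples k \<subseteq> I"
  by (auto simp: level_simples_def)

lemma generate_level_simples_closed: "y \<in> generate W (level_simples k) \<Longrightarrow> y \<in> carrier W"
  using generate_in_carrier[of "level_simples k" y] level_simples_subset simple_closed by blast

text \<open>The reflection changes only the coordinate at \<open>s\<close>, and the corresponding
  simple root, moved by \<open>base\<close>, has no component of frequency below k.\<close>

lemma phase_reflect:
  assumes "\<gamma> \<in> roots" "s \<in> level_simples k" "a < k"
  shows "x \<in> I \<Longrightarrow> dft a (act base (reflect s \<gamma>)) x = dft a (act base \<gamma>) x"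
    and "phase a t (act base (reflect s \<gamma>)) = phase a t (act base \<gamma>)"
proof -
  have s: "s \<in> I" "a < level (act base (simple_root s))"
    using assms(2,3) by (auto simp: level_simples_def)
  have refl: "reflect s \<gamma> \<in> roots"
    using act_in_roots[OF assms(1), of s] s act_simple by simp
  show dft_eq: "dft a (act base (reflect s \<gamma>)) x = dft a (act base \<gamma>) x" if "x \<in> I" for x
    unfolding dft_act[OF refl] dft_act[OF assms(1)]
  proof (rule sum.cong)
    fix r
    show "complex_of_real (reflect s \<gamma> r) * dft a (act base (simple_root r)) x =
        complex_of_real (\<gamma> r) * dft a (act base (simple_root r)) x"
      using s dft_below_level[OF s(2) that] by (cases "r = s") (simp_all add: reflect_def)
  qed simp
  show "phase a t (act base (reflect s \<gamma>)) = phase a t (act base \<gamma>)"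
    using dft_eq by (simp add: phase_def)
qed

lemma level_positive_reflect:
  assumes "\<gamma> \<in> roots" "s \<in> level_simples k" "level (act base \<gamma>) < k"
  shows "level (act base (reflect s \<gamma>)) = level (act base \<gamma>)"
    and "positive (reflect s \<gamma>) \<longleftrightarrow> positive \<gamma>"
proof -
  let ?l = "level (act base \<gamma>)"
  have s: "s \<in> I" using assms(2) by (simp add: level_simples_def)
  have refl: "reflect s \<gamma> \<in> roots"
    using act_in_roots[OF assms(1), of s] s act_simple by simp
  obtain x where x: "x \<in> I" "dft ?l (act base \<gamma>) x \<noteq> 0"
    using dft_level[of "act base \<gamma>"] assms(1) by auto
  show eq: "level (act base (reflect s \<gamma>)) = ?l"
  proof (rule level_eqI)
    show "dft a (act base (reflect s \<gamma>)) y = 0" if "a < ?l" "y \<in> I" for a y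
      using phase_reflect(1)[OF assms(1,2), of a y] that assms(3) by (simp add: dft_below_level)
    show "dft ?l (act base (reflect s \<gamma>)) x \<noteq> 0"
      using phase_reflect(1)[OF assms x(1)] x(2) by simp
  qed (use x refl in auto)
  show "positive (reflect s \<gamma>) \<longleftrightarrow> positive \<gamma>"
    using positive_iff_phase[of "act base \<gamma>"] positive_iff_phase[of "act base (reflect s \<gamma>)"]
      phase_reflect(2)[OF assms, of 0] assms(1) refl eq by simp
qed

lemma level_positive_generate:
  assumes "y \<in> generate W (level_simples k)"
  shows "\<gamma> \<in> roots \<Longrightarrow> level (act base \<gamma>) < k \<Longrightarrow>
    level (act base (act y \<gamma>)) = level (act base \<gamma>) \<and> (positive (act y \<gamma>) \<longleftrightarrow> positive \<gamma>)"
  using assms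
proof (induction y arbitrary: \<gamma> rule: generate.induct)
  case one
  then show ?case by simp
next
  case (incl s)
  then have "s \<in> I" by (simp add: level_simples_def)
  then show ?case
    using level_positive_reflect[OF incl.prems(1) incl.hyps incl.prems(2)] by (simp add: act_simple)
next
  case (inv s)
  then have "s \<in> I" by (simp add: level_simples_def)
  then show ?case
    using level_positive_reflect[OF inv.prems(1) inv.hyps inv.prems(2)] by (simp add: act_simple)
next
  case (eng y z)
  have "y \<in> carrier W" "z \<in> carrier W"
    using eng.hyps generate_level_simples_closed by blast+
  then show ?case
    using eng.IH(2)[OF eng.prems] eng.IH(1)[of "act z \<gamma>"] eng.prems by (simp add: act_mult)
qed

text \<open>Strip a left descent: its simple root is itself an inversion, hence of level at least k.
  What remains satisfies the same hypothesis, because such a reflection preserves signs and levels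
  below k.\<close>

lemma generate_level_simplesI:
  assumes "y \<in> carrier W"
    "\<And>\<gamma>. \<lbrakk>\<gamma> \<in> roots; positive \<gamma>; \<not> positive (act (inv y) \<gamma>)\<rbrakk> \<Longrightarrow> k \<le> level (act base \<gamma>)"
  shows "y \<in> generate W (level_simples k)"
  using assms
proof (induction "len y" arbitrary: y rule: less_induct)
  case less
  show ?case
  proof (cases "y = \<one>")
    case True
    then show ?thesis by (simp add: generate.one)
  next
    case False
    obtain s where s: "s \<in> I" "Suc (len (s \<otimes> y)) = len y"
      using descent_exists[OF less.prems(1) False] .
    then have "\<not> positive (act (inv y) (simple_root s))"
      using left_descent_iff[OF less.prems(1) s(1)] by simp
    then have sk: "s \<in> level_simples k"
      using less.prems(2)[of "simple_root s"] s by (simp add: level_simples_def)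
    have "s \<otimes> y \<in> generate W (level_simples k)"
    proof (rule less.hyps)
      show "len (s \<otimes> y) < len y" using s by simp
      show "s \<otimes> y \<in> carrier W" using s less.prems by simp
      fix \<gamma> assume \<gamma>: "\<gamma> \<in> roots" "positive \<gamma>" "\<not> positive (act (inv (s \<otimes> y)) \<gamma>)"
      then have neg: "\<not> positive (act (inv y) (reflect s \<gamma>))"
        using s less.prems by (simp add: inv_mult_group act_mult act_simple)
      have refl: "reflect s \<gamma> \<in> roots"
        using act_in_roots[OF \<gamma>(1), of s] s act_simple by simp
      show "k \<le> level (act base \<gamma>)"
      proof (rule ccontr)
        assume "\<not> ?thesis"
        then have "level (act base (reflect s \<gamma>)) < k" "positive (reflect s \<gamma>)"
          using level_positive_reflect[OF \<gamma>(1) sk] \<gamma>(2) by simp_all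
        then show False
          using less.prems(2)[OF refl] neg by simp
      qed
    qed
    then have "s \<otimes> (s \<otimes> y) \<in> generate W (level_simples k)"
      using generate.eng[OF generate.incl[OF sk]] by blast
    then show ?thesis using s less.prems by simp
  qed
qed

text \<open>Elements of the parabolic subgroup only invert roots of level at least k, and
  \<open>u\<close> inverts all of them, so every other element is strictly shorter. The inverse has
  the same length and lies in the subgroup, hence equals \<open>u\<close>.\<close>

lemma longest_level_simples:
  assumes u: "u \<in> carrier W"
    and sign: "\<And>\<gamma>. \<gamma> \<in> roots \<Longrightarrow> positive (act (inv u) \<gamma>) \<longleftrightarrow> (positive \<gamma> \<noteq> (k \<le> level (act base \<gamma>)))"
  shows "longest (level_simples k) = u" "inv u = u"
    "len u = card {\<gamma> \<in> roots. positive \<gamma> \<and> k \<le> level (act base \<gamma>)}"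
proof -
  have len_sep: "len y = card (separating \<one> y)" if "y \<in> carrier W" for y
    using card_separating[of \<one> y] that by simp
  have sep_u: "separating \<one> u = {\<gamma> \<in> roots. positive \<gamma> \<and> k \<le> level (act base \<gamma>)}"
    using sign by (auto simp: separating_def)
  show "len u = card {\<gamma> \<in> roots. positive \<gamma> \<and> k \<le> level (act base \<gamma>)}"
    using len_sep[OF u] sep_u by simp
  have u_gen: "u \<in> generate W (level_simples k)"
    by (rule generate_level_simplesI[OF u]) (use sign in auto)
  have less: "len y < len u" if y: "y \<in> generate W (level_simples k)" "y \<noteq> u" for y
  proof -
    have yc: "y \<in> carrier W" using y(1) by (rule generate_level_simples_closed)
    have "inv y \<in> generate W (level_simples k)"
      using y(1) level_simples_subset simple_closed by (intro generate_m_inv_closed) auto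
    then have sub: "separating \<one> y \<subseteq> separating \<one> u"
      unfolding sep_u using level_positive_generate[of "inv y" k]
      by (auto simp: separating_def not_less[symmetric])
    moreover have "separating \<one> y \<noteq> separating \<one> u"
    proof
      assume eq: "separating \<one> y = separating \<one> u"
      have pos: "positive (act (inv y) \<gamma>) \<longleftrightarrow> positive (act (inv u) \<gamma>)"
        if "\<gamma> \<in> roots" "positive \<gamma>" for \<gamma>
        using eq that by (auto simp: separating_def set_eq_iff)
      have "positive (act (inv y) \<gamma>) \<longleftrightarrow> positive (act (inv u) \<gamma>)" if \<gamma>: "\<gamma> \<in> roots" for \<gamma>
      proof (cases "positive \<gamma>")
        case False
        then have "positive (act (inv y) (- \<gamma>)) \<longleftrightarrow> positive (act (inv u) (- \<gamma>))"
          using pos[of "- \<gamma>"] \<gamma> uminus_in_roots[of \<gamma>] positive_uminus_iff[OF \<gamma>] by blast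
        then show ?thesis
          using \<gamma> u yc by (simp add: act_uminus positive_uminus_iff)
      qed (use pos \<gamma> in blast)
      then have "separating y u = {}" by (auto simp: separating_def)
      then show False
        using separating_empty[OF yc u] y(2) by blast
    qed
    ultimately have "card (separating \<one> y) < card (separating \<one> u)"
      by (intro psubset_card_mono) auto
    then show ?thesis using len_sep u yc by simp
  qed
  show "longest (level_simples k) = u"
    using longest_eqI[OF u_gen less] .
  have "inv u \<in> generate W (level_simples k)"
    using u_gen level_simples_subset simple_closed by (intro generate_m_inv_closed) auto
  then show "inv u = u"
    using less[of "inv u"] u by auto
qed

text \<open>In the odd state exactly the levels above k are negated relative to \<open>base\<close>,
  so \<open>longest_level_simples\<close> identifies the relative position; being an involution, it
  also leads back. Roots come in opposite pairs, whence the factor 2 before the length.\<close>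

lemma flip_state_steps:
  fixes k
  defines "u \<equiv> longest (level_simples (Suc k))"
  shows "inv (chamber (flip_state (2 * k))) \<otimes> chamber (flip_state (Suc (2 * k))) = u"
    and "inv (chamber (flip_state (Suc (2 * k)))) \<otimes> chamber (flip_state (Suc (Suc (2 * k)))) = u"
    and "u \<in> carrier W"
    and "2 * len u = card {\<gamma> \<in> roots. k < level \<gamma>}"
proof -
  define x where "x = inv base \<otimes> chamber (flip_state (Suc (2 * k)))"
  have x: "x \<in> carrier W" by (simp add: x_def)
  have sign: "positive (act (inv x) \<gamma>) \<longleftrightarrow> (positive \<gamma> \<noteq> (Suc k \<le> level (act base \<gamma>)))"
    if \<gamma>: "\<gamma> \<in> roots" for \<gamma>
  proof -
    have r: "act base \<gamma> \<in> roots" using \<gamma> by simp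
    have "act (inv x) \<gamma> = act (inv (chamber (flip_state (Suc (2 * k))))) (act base \<gamma>)"
      by (simp add: x_def inv_mult_group act_mult)
    then have "positive (act (inv x) \<gamma>) \<longleftrightarrow> height (flip_state (Suc (2 * k))) (act base \<gamma>) > 0"
      using r by (simp add: chamber_sign)
    moreover have "positive \<gamma> \<longleftrightarrow> phase (level (act base \<gamma>)) 0 (act base \<gamma>) > 0"
      using positive_iff_phase[OF r] by simp
    moreover have "phase (level (act base \<gamma>)) 0 (act base \<gamma>) \<noteq> 0"
      using r by (rule phase_0_nonzero)
    ultimately show ?thesis
      using height_flip_state[OF r, of "Suc (2 * k)"] by auto
  qed
  note longest = longest_level_simples[OF x sign]
  have ux: "u = x" using longest(1) by (simp add: u_def)
  show "u \<in> carrier W" using ux x by simp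
  show "inv (chamber (flip_state (2 * k))) \<otimes> chamber (flip_state (Suc (2 * k))) = u"
    by (simp add: ux x_def chamber_flip_state_even)
  have "inv (chamber (flip_state (Suc (2 * k)))) \<otimes> chamber (flip_state (Suc (Suc (2 * k)))) = inv x"
    by (simp add: x_def chamber_flip_state_even inv_mult_group)
  then show "inv (chamber (flip_state (Suc (2 * k)))) \<otimes> chamber (flip_state (Suc (Suc (2 * k)))) = u"
    using longest(2) ux by simp
  let ?P = "{\<gamma> \<in> roots. positive \<gamma> \<and> Suc k \<le> level (act base \<gamma>)}"
  have "{\<gamma> \<in> roots. k < level \<gamma>} = act base ` (?P \<union> uminus ` ?P)"
  proof (intro equalityI subsetI)
    fix \<gamma> assume \<gamma>: "\<gamma> \<in> {\<gamma> \<in> roots. k < level \<gamma>}"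
    define \<delta> where "\<delta> = act (inv base) \<gamma>"
    have \<delta>: "\<delta> \<in> roots" "act base \<delta> = \<gamma>" using \<gamma> by (simp_all add: \<delta>_def)
    have "\<delta> \<in> ?P \<union> uminus ` ?P"
    proof (cases "positive \<delta>")
      case False
      moreover have "level (act base (- \<delta>)) = level \<gamma>"
        by (simp only: act_uminus \<delta>(2) level_uminus)
      ultimately have "- \<delta> \<in> ?P"
        using \<delta>(1) \<gamma> positive_uminus_iff[of \<delta>] by simp
      moreover have "\<delta> = - (- \<delta>)" by (simp add: fun_Compl_def)
      ultimately show ?thesis by blast
    qed (use \<delta> \<gamma> in auto)
    then show "\<gamma> \<in> act base ` (?P \<union> uminus ` ?P)" using \<delta>(2) by blast
  next
    fix \<gamma> assume "\<gamma> \<in> act base ` (?P \<union> uminus ` ?P)"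
    then obtain \<delta> where "\<delta> \<in> ?P" "\<gamma> = act base \<delta> \<or> \<gamma> = - act base \<delta>"
      by (auto simp: act_uminus)
    then show "\<gamma> \<in> {\<gamma> \<in> roots. k < level \<gamma>}"
      by (auto simp only: mem_Collect_eq uminus_in_roots level_uminus act_in_roots_iff[OF base_closed])
  qed
  moreover have "inj_on (act base) A" for A
    by (rule inj_on_inverseI[of _ "act (inv base)"]) simp
  moreover have "inj_on uminus A" for A :: "('a \<Rightarrow> real) set"
    by (rule inj_on_inverseI[of _ uminus]) (simp add: fun_Compl_def)
  moreover have "?P \<inter> uminus ` ?P = {}"
    using positive_uminus_iff by blast
  moreover have "finite ?P" by simp
  ultimately have "card {\<gamma> \<in> roots. k < level \<gamma>} = 2 * card ?P"
    by (simp add: card_image card_Un_disjoint)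
  then show "2 * len u = card {\<gamma> \<in> roots. k < level \<gamma>}"
    using longest(3) ux by simp
qed

text \<open>Both galleries start at time 0 and end with each level a having made a full turns, and
  no step exceeds a half turn, so \<open>mprod_gallery_step_unique\<close> applies.\<close>

lemma mprod_rotation_eq_flip:
  "mprod braid_monoid (map (\<lambda>i. lift ((\<sigma> ^^ i) good_element)) [0..<d]) =
   mprod braid_monoid (map (\<lambda>n. lift (inv (chamber (flip_state n)) \<otimes> chamber (flip_state (Suc n)))) [0..<2 * d])"
proof -
  have "mprod braid_monoid (map (\<lambda>i. gallery_step (rotation_state i) (rotation_state (Suc i))) [0..<d]) =
    mprod braid_monoid (map (\<lambda>n. gallery_step (flip_state n) (flip_state (Suc n))) [0..<2 * d])"
  proof (rule mprod_gallery_step_unique)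
    show "rotation_state i \<le> rotation_state (Suc i)" for i
      by (auto simp: le_fun_def rotation_state_def divide_right_mono mult_left_mono)
    show "rotation_state (Suc i) a \<le> rotation_state i a + 1" for i a
    proof (cases "2 * a \<le> d")
      case True
      then have "2 * real a / real d \<le> 1" using d_pos by (simp add: divide_le_eq)
      then show ?thesis
        using True by (simp add: rotation_state_def distrib_left add_divide_distrib)
    qed (simp add: rotation_state_def)
    show "flip_state n \<le> flip_state (Suc n)" for n
      by (auto simp: le_fun_def flip_state_def)
    show "flip_state (Suc n) a \<le> flip_state n a + 1" for n a
      by (auto simp: flip_state_def)
    show "rotation_state 0 = flip_state 0"
      by (auto simp: rotation_state_def flip_state_def)
    show "rotation_state d = flip_state (2 * d)"
      using d_pos by (auto simp: rotation_state_def flip_state_def)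
  qed simp_all
  then show ?thesis
    by (simp only: gallery_step_def rotation_state_step)
qed

lemma good_element_good:
  assumes "twisted_order \<sigma> w = d"
  shows "good \<sigma> good_element"
proof -
  let ?B = braid_monoid
  have order: "twisted_order \<sigma> good_element = d"
    unfolding good_element_def using twisted_order_conj[of base w] assms by simp
  define q where "q k = lift (longest (level_simples k)) [^]\<^bsub>?B\<^esub> (2::nat)" for k
  define g where "g n = lift (inv (chamber (flip_state n)) \<otimes> chamber (flip_state (Suc n)))" for n
  have g: "g n \<in> carrier ?B" for n by (simp add: g_def)
  have gq: "g (2 * k) \<otimes>\<^bsub>?B\<^esub> g (Suc (2 * k)) = q (Suc k)" for k
    using flip_state_steps[of k] monoid.l_one[OF monoid_braid_monoid]
    by (simp add: g_def q_def numeral_2_eq_2 monoid.nat_pow_Suc monoid.nat_pow_0 monoid_braid_monoid)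
  have q: "q (Suc k) \<in> carrier ?B" for k
    using gq[of k] g monoid.m_closed[OF monoid_braid_monoid] by metis
  have "mprod ?B (map g [0..<2 * n]) = mprod ?B (map (\<lambda>k. q (Suc k)) [0..<n])" for n
  proof (induction n)
    case (Suc n)
    have g_lists: "map g xs \<in> lists (carrier ?B)" for xs
      using g by auto
    have q_lists: "map (\<lambda>k. q (Suc k)) xs \<in> lists (carrier ?B)" for xs
      using q by auto
    have "map g [0..<2 * Suc n] = map g [0..<2 * n] @ [g (2 * n), g (Suc (2 * n))]"
      by simp
    then have "mprod ?B (map g [0..<2 * Suc n]) =
        mprod ?B (map g [0..<2 * n]) \<otimes>\<^bsub>?B\<^esub> (g (2 * n) \<otimes>\<^bsub>?B\<^esub> g (Suc (2 * n)))"
      using monoid.mprod_append[OF monoid_braid_monoid g_lists, of "[g (2 * n), g (Suc (2 * n))]"] g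
        monoid.r_one[OF monoid_braid_monoid] by simp
    also have "\<dots> = mprod ?B (map (\<lambda>k. q (Suc k)) [0..<n]) \<otimes>\<^bsub>?B\<^esub> q (Suc n)"
      using Suc gq by simp
    also have "\<dots> = mprod ?B (map (\<lambda>k. q (Suc k)) [0..<Suc n])"
      using monoid.mprod_append[OF monoid_braid_monoid q_lists, of "[q (Suc n)]"] q
        monoid.r_one[OF monoid_braid_monoid] by simp
    finally show ?case .
  qed simp
  then have "mprod ?B (map (\<lambda>i. (braid_aut \<sigma> ^^ i) (lift good_element)) [0..<d]) =
      mprod ?B (map (\<lambda>k. q (Suc k)) [0..<d])"
    using mprod_rotation_eq_flip by (simp only: g_def[abs_def] lift_\<sigma>_pow[OF good_element_closed])
  also have "map (\<lambda>k. q (Suc k)) [0..<d] = map q [1..<Suc d]"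
    by (simp only: map_Suc_upt[symmetric] One_nat_def map_map comp_def)
  finally have eq: "mprod ?B (map (\<lambda>i. (braid_aut \<sigma> ^^ i) (lift good_element)) [0..<d]) =
      mprod ?B (map (\<lambda>K. lift (longest K) [^]\<^bsub>?B\<^esub> (2::nat)) (map level_simples [1..<Suc d]))"
    by (simp only: q_def[abs_def] map_map comp_def)
  \<comment> \<open>The indices start at 1 because components of frequency 0 never move. Beyond d /
    2 the sets are empty and contribute trivial factors.\<close>
  have "sorted_wrt (\<supseteq>) (map level_simples [1..<Suc d])"
    unfolding sorted_wrt_map
    by (rule sorted_wrt_mono_rel[OF _ sorted_wrt_upt]) (auto simp: level_simples_def)
  moreover have "map level_simples [1..<Suc d] \<noteq> []"
    using d_pos by simp
  ultimately show ?thesis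
    unfolding good_def order using eq level_simples_subset
    by (intro exI[of _ "map level_simples [1..<Suc d]"] conjI ballI) auto
qed

text \<open>Lengths are compared in \<open>mprod_rotation_eq_flip\<close>. The k-th pair of flips
  has as its length the number of roots of level above k, and summing over k counts each root as
  often as its level says: the lower bound is attained.\<close>

lemma length_good_element: "d * len good_element = (\<Sum>\<gamma>\<in>roots. level \<gamma>)"
proof -
  let ?vs = "\<lambda>n. map (\<lambda>n. inv (chamber (flip_state n)) \<otimes> chamber (flip_state (Suc n))) [0..<n]"
  have "sum_list (map len (map (\<lambda>i. (\<sigma> ^^ i) good_element) [0..<d])) = sum_list (map len (?vs (2 * d)))"
  proof (rule mprod_lift_eq_length)
    show "mprod braid_monoid (map lift (map (\<lambda>i. (\<sigma> ^^ i) good_element) [0..<d])) =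
        mprod braid_monoid (map lift (?vs (2 * d)))"
      using mprod_rotation_eq_flip by (simp only: map_map comp_def)
  qed auto
  moreover have "sum_list (map len (map (\<lambda>i. (\<sigma> ^^ i) good_element) [0..<d])) = d * len good_element"
    by (simp add: comp_def sum_list_triv)
  moreover have "sum_list (map len (?vs (2 * n))) = (\<Sum>k<n. card {\<gamma> \<in> roots. k < level \<gamma>})" for n
  proof (induction n)
    case (Suc n)
    have "?vs (2 * Suc n) = ?vs (2 * n) @
        [inv (chamber (flip_state (2 * n))) \<otimes> chamber (flip_state (Suc (2 * n))),
         inv (chamber (flip_state (Suc (2 * n)))) \<otimes> chamber (flip_state (Suc (Suc (2 * n))))]"
      by simp
    then show ?case
      using Suc flip_state_steps[of n] by (simp only: map_append sum_list_append) simp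
  qed simp
  moreover have "(\<Sum>k<d. card {\<gamma> \<in> roots. k < level \<gamma>}) = (\<Sum>\<gamma>\<in>roots. level \<gamma>)"
  proof -
    have "(\<Sum>k<d. card {\<gamma> \<in> roots. k < level \<gamma>}) = (\<Sum>k<d. \<Sum>\<gamma>\<in>roots. if k < level \<gamma> then 1 else 0)"
      by (simp only: card_eq_sum sum.inter_filter[OF finite_roots])
    also have "\<dots> = (\<Sum>\<gamma>\<in>roots. \<Sum>k<d. if k < level \<gamma> then 1 else 0)"
      by (rule sum.swap)
    also have "\<dots> = (\<Sum>\<gamma>\<in>roots. card {k \<in> {..<d}. k < level \<gamma>})"
      by (simp only: card_eq_sum sum.inter_filter[OF finite_lessThan])
    also have "\<dots> = (\<Sum>\<gamma>\<in>roots. level \<gamma>)"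
    proof (rule sum.cong)
      fix \<gamma> assume "\<gamma> \<in> roots"
      then have "{k \<in> {..<d}. k < level \<gamma>} = {..<level \<gamma>}"
        using level_bound[of \<gamma>] by auto
      then show "card {k \<in> {..<d}. k < level \<gamma>} = level \<gamma>" by simp
    qed simp
    finally show ?thesis .
  qed
  ultimately show ?thesis by simp
qed

lemma good_element_minimal:
  assumes "y \<in> carrier W"
  shows "len good_element \<le> len (inv y \<otimes> w \<otimes> \<sigma> y)"
  using length_lower_bound[OF assms] d_pos by (simp flip: length_good_element)

end

theorem theorem7p26:
  fixes W :: "('a, 'b) monoid_scheme" and I :: "'a set"
    and \<sigma> :: "'a \<Rightarrow> 'a" and \<O> :: "'a set"
  assumes "coxeter_system W I"
    and "finite (carrier W)"
    and "\<sigma> \<in> iso W W"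
    and "\<sigma> ` I = I"
    and "\<O> \<in> coxeter_system.twisted_conj_classes W \<sigma>"
  shows "\<exists>w \<in> coxeter_system.min_length W I \<O>. coxeter_system.good W I \<sigma> w"
proof -
  interpret coxeter_system W I by fact
  interpret twisted_coxeter_system W I \<sigma>
    by unfold_locales (use assms in auto)
  obtain w where w: "w \<in> carrier W" and \<O>: "\<O> = orbit W (twisted_conj \<sigma>) w"
    using assms(5) by (auto simp: twisted_conj_classes_def orbits_def)
  \<comment> \<open>The class is parametrised by the inverse of the acting element, to match the
    relative positions of chambers used above.\<close>
  have mem: "inv\<^bsub>W\<^esub> y \<otimes>\<^bsub>W\<^esub> w \<otimes>\<^bsub>W\<^esub> \<sigma> y \<in> \<O>" if "y \<in> carrier W" for y
  proof -
    have "inv\<^bsub>W\<^esub> y \<otimes>\<^bsub>W\<^esub> w \<otimes>\<^bsub>W\<^esub> \<sigma> y = twisted_conj \<sigma> (inv\<^bsub>W\<^esub> y) w"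
      using that w by (simp add: twisted_conj_def)
    then show ?thesis
      using that unfolding \<O> orbit_def by blast
  qed
  have mem': "\<exists>y\<in>carrier W. z = inv\<^bsub>W\<^esub> y \<otimes>\<^bsub>W\<^esub> w \<otimes>\<^bsub>W\<^esub> \<sigma> y" if z: "z \<in> \<O>" for z
  proof -
    obtain x where x: "x \<in> carrier W" "z = twisted_conj \<sigma> x w"
      using z unfolding \<O> orbit_def by blast
    then show ?thesis
      using w by (intro bexI[of _ "inv\<^bsub>W\<^esub> x"]) (simp_all add: twisted_conj_def)
  qed
  interpret twisted_element W I \<sigma> w "twisted_order \<sigma> w"
    by unfold_locales (use w is_twisted_period_order in auto)
  obtain v where "\<forall>\<gamma>\<in>roots. Re (\<Sum>x\<in>I. v x * dft (level \<gamma>) \<gamma> x) \<noteq> 0"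
    using generic_covector_exists by blast
  then interpret twisted_covector W I \<sigma> w "twisted_order \<sigma> w" v
    by unfold_locales blast
  have "good_element \<in> \<O>"
    unfolding good_element_def by (rule mem) simp
  moreover have "len good_element \<le> len z" if "z \<in> \<O>" for z
    using mem'[OF that] good_element_minimal by blast
  ultimately have "good_element \<in> min_length \<O>"
    by (auto simp: min_length_def is_arg_min_def not_less)
  then show ?thesis
    using good_element_good by blast
qed

end
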